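(* Let $H$ be a labelled graph with vertex set $\{1,\dots,h\}$, and let $r$ be the coloring number of the property of not containing $H$ as an induced subgraph (defined in the context). For every $\varepsilon>0$ there is $\delta=\delta(\varepsilon)>0$ such that for all sufficiently large $n$, \[ \left(1-\frac1r\right)\binom{n}{2}\;\leq\;\log_2\left|\mathcal{P}_n\big(H;\lfloor\delta\log n\rfloor,\lceil n^{1-\sqrt{\delta}}\rceil\big)\right|\;\leq\;\left(1-\frac1r+\varepsilon\right)\binom{n}{2}. \]
   Context: $\log$ denotes the natural logarithm. For integers $0\leq s\leq r$, let $\mathcal{H}(r,s)$ be the class of graphs whose vertex set can be partitioned into $s$ cliques and $r-s$ independent sets (parts may be empty). For a graph property $\mathcal{P}$, the coloring number is $\chi_c(\mathcal{P})=\max\{r:\ \mathcal{H}(r,s)\subseteq\mathcal{P}\text{ for some } s \text{ with } 0\le s\le r\}$; here $\mathcal{P}$ is the property of containing no induced subgraph isomorphic to $H$. Given a labelled graph $H$ with vertex set $\{1,\dots,h\}$ and positive integers $p_1,\dots,p_h$, a graph $F$ is of type $H(p_1,\dots,p_h)$ if $F$ can be obtained by replacing each vertex $u$ of $H$ by a (arbitrary) graph $G_u$ of order $p_u$ (the $G_u$ on disjoint vertex sets), and for distinct $u,v$: if $uv\in E(H)$, all edges between $V(G_u)$ and $V(G_v)$ are present, and if $uv\notin E(H)$, no edges between $V(G_u)$ and $V(G_v)$ are present. For positive integers $p,q$, $\mathcal{P}_n(H;p,q)$ is the set of labelled graphs on the vertex set $\{1,\dots,n\}$ that contain no induced subgraph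 of type $H(p,\dots,p,q)$ (i.e. $p_1=\dots=p_{h-1}=p$, $p_h=q$). *)

theory Defs
  imports Complex_Main "HOL-Library.Disjoint_Sets" "Graph_Theory.Graph_Theory"
begin

text \<open>
  A finite simple graph is a \<^locale>\<open>pair_graph\<close>: a finite symmetric loop-free digraph without
  parallel arcs, where an edge $uv$ is represented by the two arcs $(u,v)$ and $(v,u)$.
  A \<^typ>\<open>'a pair_pre_digraph\<close> has no fields besides its vertex and arc sets, so counting these
  objects on a fixed vertex set counts labelled graphs.
\<close>

definition contains_induced :: "'a pair_pre_digraph \<Rightarrow> 'b pair_pre_digraph \<Rightarrow> bool" where
  "contains_induced G H \<longleftrightarrow>
     (\<exists>F :: 'a pair_pre_digraph.
        induced_subgraph (with_proj F) (with_proj G) \<and> digraph_iso (with_proj F) (with_proj H))"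

definition clique_in :: "'a pair_pre_digraph \<Rightarrow> 'a set \<Rightarrow> bool" where
  "clique_in G S \<longleftrightarrow> (\<forall>x\<in>S. \<forall>y\<in>S. x \<noteq> y \<longrightarrow> (x, y) \<in> parcs G)"

definition independent_in :: "'a pair_pre_digraph \<Rightarrow> 'a set \<Rightarrow> bool" where
  "independent_in G S \<longleftrightarrow> (\<forall>x\<in>S. \<forall>y\<in>S. (x, y) \<notin> parcs G)"

text \<open>
  Graph classes and graph properties are sets of finite graphs with vertices in \<^typ>\<open>nat\<close>;
  every finite graph is isomorphic to such a graph. For $s \le r$, the parts $V_0,\dots,V_{s-1}$
  below are the cliques and $V_s,\dots,V_{r-1}$ the independent sets; parts may be empty.
\<close>

definition clique_indep_class :: "nat \<Rightarrow> nat \<Rightarrow> nat pair_pre_digraph set" where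
  "clique_indep_class r s =
     {G. pair_graph G \<and>
         (\<exists>V :: nat \<Rightarrow> nat set.
            disjoint_family_on V {..<r} \<and> (\<Union>i<r. V i) = pverts G \<and>
            (\<forall>i<s. clique_in G (V i)) \<and> (\<forall>i\<in>{s..<r}. independent_in G (V i)))}"

definition coloring_number :: "nat pair_pre_digraph set \<Rightarrow> nat" where
  "coloring_number P = Max {r. \<exists>s\<le>r. clique_indep_class r s \<subseteq> P}"

definition induced_free :: "'b pair_pre_digraph \<Rightarrow> nat pair_pre_digraph set" where
  "induced_free H = {G. pair_graph G \<and> \<not> contains_induced G H}"

text \<open>
  The set \<open>W u\<close> is the vertex set of the graph replacing the vertex \<open>u\<close> of \<open>H\<close>, which has order
  \<open>p u\<close>. That graph is arbitrary, so arcs inside \<open>W u\<close> are unconstrained.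
\<close>

definition of_type :: "'b pair_pre_digraph \<Rightarrow> ('b \<Rightarrow> nat) \<Rightarrow> 'a pair_pre_digraph \<Rightarrow> bool" where
  "of_type H p F \<longleftrightarrow>
     pair_graph F \<and>
     (\<exists>W. disjoint_family_on W (pverts H) \<and> (\<Union>u\<in>pverts H. W u) = pverts F \<and>
          (\<forall>u\<in>pverts H. card (W u) = p u) \<and>
          (\<forall>u\<in>pverts H. \<forall>v\<in>pverts H. u \<noteq> v \<longrightarrow>
             (\<forall>x\<in>W u. \<forall>y\<in>W v. (x, y) \<in> parcs F \<longleftrightarrow> (u, v) \<in> parcs H)))"

text \<open>
  \<open>type_free_graphs n H p q\<close> is $\mathcal{P}_n(H;p,q)$. It is meant for \<open>H\<close> with vertex set
  $\{1,\dots,h\}$, so that \<open>card (pverts H)\<close> is the last vertex $h$, the one replaced by a graph of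
  order \<open>q\<close>.
\<close>

definition type_free_graphs ::
  "nat \<Rightarrow> nat pair_pre_digraph \<Rightarrow> nat \<Rightarrow> nat \<Rightarrow> nat pair_pre_digraph set" where
  "type_free_graphs n H p q =
     {G. pair_graph G \<and> pverts G = {1..n} \<and>
         \<not> (\<exists>F :: nat pair_pre_digraph.
              induced_subgraph (with_proj F) (with_proj G) \<and>
              of_type H (\<lambda>u. if u = card (pverts H) then q else p) F)}"

end

theory Submission
  imports Defs "HOL-Library.FuncSet" "HOL-Library.Ramsey" "HOL-Real_Asymp.Real_Asymp"
begin

text \<open>
  Lower bound: fix a balanced partition into $r$ parts with $\mathcal{H}(r,s)\subseteq\mathcal{P}$,
  make $s$ parts cliques and the others independent, and choose the edges between parts freely.

  Upper bound: the weak (Frieze--Kannan) regularity lemma approximates the adjacency function of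
  $G$ in cut norm by a step function $W$ with boundedly many classes. Call a pair of vertices free if
  $\gamma\le W\le 1-\gamma$. If more than $(1-1/r+\rho)n^2$ ordered pairs are free, then a bounded
  random sample of vertices contains, by the arguments of Turan, Erdos--Stone and Ramsey, $r+1$
  blocks of size $h$ with all pairs between different blocks free and each block compatible with a
  clique or with an independent set. Since $H$ splits into $s$ cliques and $r+1-s$ independent sets
  for every $s\le r+1$, the density of induced copies of $H$ in $W$ is at least a constant which does
  not depend on the number of classes. The counting lemma transfers this to $G$, and a graph with
  $cn^h$ induced copies of $H$ contains a graph of type
  $H(\lfloor\delta\log n\rfloor,\dots,\lceil n^{1-\sqrt\delta}\rceil)$ (Nikiforov's argument).
  So every graph in question differs in few places from one of $2^{o(n^2)}$ templates, each with at
  most $(1-1/r+\rho)n^2/2$ free pairs.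
\<close>

section \<open>Sums over finite function spaces and sampling\<close>

text \<open>What shapes the proof is the order in which the constants are fixed. The counting lemma
  loses a multiple of the cut-norm error \<open>\<eta>\<close>, so \<open>\<eta>\<close> must be
  small against the density \<open>c0\<close> of copies of H in the template, whereas the number of
  classes grows like 4 to the power \<open>1 / \<eta> ^ 2\<close>. A bound \<open>c0\<close> found
  by searching for H among the classes would depend on their number, and the choice would be
  circular. Sampling boundedly many vertices gives a \<open>c0\<close> that depends only on H,
  \<open>r\<close>, \<open>\<rho>\<close> and \<open>\<gamma>\<close>; then \<open>\<eta>\<close>
  and the number of classes follow. The threshold \<open>\<gamma>\<close> has to come even earlier:
  it is dictated by the entropy of the pairs on which a graph disobeys its template. The unequal
  part sizes reflect the last coordinate of the tuple argument. Making the first h - 1 parts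
  logarithmic leaves only a small power of n of possible neighbourhoods, so a pigeonhole costs the
  last part no more than that power.\<close>

lemma sum_PiE_insert:
  assumes "i \<notin> I"
  shows "(\<Sum>x\<in>PiE (insert i I) (\<lambda>_. V). F x) = (\<Sum>x\<in>PiE I (\<lambda>_. V). \<Sum>a\<in>V. F (x(i := a)))"
proof -
  have "(\<Sum>x\<in>PiE (insert i I) (\<lambda>_. V). F x) = (\<Sum>p\<in>V \<times> PiE I (\<lambda>_. V). F ((\<lambda>(y, g). g(i := y)) p))"
    unfolding PiE_insert_eq by (subst sum.reindex[OF inj_combinator[OF assms]]) (simp add: comp_def)
  also have "\<dots> = (\<Sum>a\<in>V. \<Sum>x\<in>PiE I (\<lambda>_. V). F (x(i := a)))"
    by (simp add: sum.cartesian_product split_def)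
  finally show ?thesis by (simp add: sum.swap[of _ V])
qed

lemma sum_PiE_restrict:
  fixes F :: "('i \<Rightarrow> 'a) \<Rightarrow> 'b::comm_semiring_1"
  assumes "finite I" "J \<inter> I = {}"
  shows "(\<Sum>x\<in>PiE (J \<union> I) (\<lambda>_. V). F (restrict x J))
           = of_nat (card V ^ card I) * (\<Sum>z\<in>PiE J (\<lambda>_. V). F z)"
  using assms
proof (induction I)
  case empty
  have "(\<Sum>x\<in>PiE J (\<lambda>_. V). F (restrict x J)) = (\<Sum>x\<in>PiE J (\<lambda>_. V). F x)"
    by (intro sum.cong refl) simp
  then show ?case by simp
next
  case (insert i I)
  have i: "i \<notin> J \<union> I" using insert by auto
  have "(\<Sum>x\<in>PiE (J \<union> insert i I) (\<lambda>_. V). F (restrict x J))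
      = (\<Sum>x\<in>PiE (J \<union> I) (\<lambda>_. V). \<Sum>a\<in>V. F (restrict (x(i := a)) J))"
    using sum_PiE_insert[OF i] by simp
  also have "\<dots> = of_nat (card V) * (\<Sum>x\<in>PiE (J \<union> I) (\<lambda>_. V). F (restrict x J))"
  proof -
    have "restrict (x(i := a)) J = restrict x J" for x and a :: 'a using i by (auto simp: restrict_def)
    then show ?thesis by (simp add: sum_distrib_left)
  qed
  also have "(\<Sum>x\<in>PiE (J \<union> I) (\<lambda>_. V). F (restrict x J))
      = of_nat (card V ^ card I) * (\<Sum>z\<in>PiE J (\<lambda>_. V). F z)"
    using insert.prems by (intro insert.IH) auto
  finally show ?case using insert.hyps by (simp add: mult.assoc)
qed

text \<open>A uniform random tuple read along an injection of the indices is again uniform: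
  coordinates outside the image of \<open>\<phi>\<close> are free and contribute a factor
  \<open>card V\<close> each.\<close>

lemma sum_PiE_reindex:
  fixes F :: "('j \<Rightarrow> 'a) \<Rightarrow> 'b::comm_semiring_1"
  assumes fin: "finite K" and inj: "inj_on \<phi> M" and sub: "\<phi> ` M \<subseteq> K"
  shows "(\<Sum>x\<in>PiE K (\<lambda>_. V). F (restrict (x \<circ> \<phi>) M))
           = of_nat (card V ^ (card K - card M)) * (\<Sum>y\<in>PiE M (\<lambda>_. V). F y)"
proof -
  let ?J = "\<phi> ` M" let ?I = "K - \<phi> ` M"
  have K: "K = ?J \<union> ?I" using sub by auto
  have cI: "card ?I = card K - card M"
    using fin sub inj by (simp add: card_Diff_subset finite_subset card_image)
  have "(\<Sum>x\<in>PiE K (\<lambda>_. V). F (restrict (x \<circ> \<phi>) M))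
      = (\<Sum>x\<in>PiE (?J \<union> ?I) (\<lambda>_. V). F (restrict (restrict x ?J \<circ> \<phi>) M))"
    unfolding K[symmetric] by (intro sum.cong refl arg_cong[of _ _ F]) (auto simp: restrict_def)
  also have "\<dots> = of_nat (card V ^ card ?I) * (\<Sum>z\<in>PiE ?J (\<lambda>_. V). F (restrict (z \<circ> \<phi>) M))"
    by (rule sum_PiE_restrict[where F = "\<lambda>z. F (restrict (z \<circ> \<phi>) M)"]) (use fin in auto)
  also have "(\<Sum>z\<in>PiE ?J (\<lambda>_. V). F (restrict (z \<circ> \<phi>) M)) = (\<Sum>y\<in>PiE M (\<lambda>_. V). F y)"
  proof (rule sum.reindex_bij_witness[where j = "\<lambda>z. restrict (z \<circ> \<phi>) M"
        and i = "\<lambda>y. restrict (y \<circ> the_inv_into M \<phi>) ?J"])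
    fix z assume z: "z \<in> ?J \<rightarrow>\<^sub>E V"
    show "restrict (restrict (z \<circ> \<phi>) M \<circ> the_inv_into M \<phi>) ?J = z"
    proof
      fix t show "restrict (restrict (z \<circ> \<phi>) M \<circ> the_inv_into M \<phi>) ?J t = z t"
        using inj PiE_arb[OF z, of t] by (cases "t \<in> ?J") (auto simp: the_inv_into_f_f)
    qed
    show "restrict (z \<circ> \<phi>) M \<in> M \<rightarrow>\<^sub>E V" using z by auto
  next
    fix y assume y: "y \<in> M \<rightarrow>\<^sub>E V"
    show "restrict (y \<circ> the_inv_into M \<phi>) ?J \<in> ?J \<rightarrow>\<^sub>E V"
      using y inj by (auto simp: the_inv_into_f_f)
    show "restrict (restrict (y \<circ> the_inv_into M \<phi>) ?J \<circ> \<phi>) M = y"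
    proof
      fix t show "restrict (restrict (y \<circ> the_inv_into M \<phi>) ?J \<circ> \<phi>) M t = y t"
        using inj PiE_arb[OF y, of t] by (cases "t \<in> M") (auto simp: the_inv_into_f_f)
    qed
  qed auto
  finally show ?thesis unfolding cI .
qed

lemma sum_PiE_two_coordinates:
  assumes "finite K" "i \<in> K" "j \<in> K" "i \<noteq> j" "finite V"
  shows "card {x \<in> PiE K (\<lambda>_. V). R (x i) (x j)}
           = card V ^ (card K - 2) * card {(x, y) \<in> V \<times> V. R x y}"
proof -
  \<comment> \<open>The two-element type \<open>bool\<close> serves as index set of a pair.\<close>
  define \<phi> where "\<phi> b = (if b then i else j)" for b
  have inj: "inj_on \<phi> UNIV" using assms by (auto simp: inj_on_def \<phi>_def)
  have "card {x \<in> PiE K (\<lambda>_. V). R (x i) (x j)}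
     = (\<Sum>x\<in>PiE K (\<lambda>_. V). if R (x i) (x j) then 1 else 0)"
    using assms by (simp add: finite_PiE sum.If_cases Int_def)
  also have "\<dots> = (\<Sum>x\<in>PiE K (\<lambda>_. V). (\<lambda>z. if R (z True) (z False) then 1 else 0) (restrict (x \<circ> \<phi>) UNIV))"
    by (simp add: \<phi>_def)
  also have "\<dots> = card V ^ (card K - card (UNIV::bool set))
       * (\<Sum>z\<in>PiE (UNIV::bool set) (\<lambda>_. V). if R (z True) (z False) then 1 else 0)"
    by (subst sum_PiE_reindex) (use assms inj in \<open>auto simp: \<phi>_def\<close>)
  also have "(\<Sum>z\<in>PiE (UNIV::bool set) (\<lambda>_. V). if R (z True) (z False) then 1 else 0)
     = card {(x, y) \<in> V \<times> V. R x y}"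
  proof -
    have U: "(UNIV::bool set) = insert True (insert False {})" by auto
    have "(\<Sum>z\<in>PiE (UNIV::bool set) (\<lambda>_. V). if R (z True) (z False) then 1 else 0)
       = (\<Sum>y\<in>V. \<Sum>x\<in>V. if R x y then 1 else (0::nat))"
      unfolding U by (subst sum_PiE_insert, simp)+ simp
    also have "\<dots> = (\<Sum>p\<in>V\<times>V. if (case p of (x, y) \<Rightarrow> R x y) then 1 else 0)"
      by (subst sum.swap) (simp add: sum.cartesian_product split_def)
    also have "\<dots> = card {p \<in> V \<times> V. (case p of (x, y) \<Rightarrow> R x y)}"
      using assms by (simp add: sum.If_cases Int_def)
    also have "{p \<in> V \<times> V. (case p of (x, y) \<Rightarrow> R x y)} = {(x, y) \<in> V \<times> V. R x y}" by auto
    finally show ?thesis .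
  qed
  finally show ?thesis by simp
qed

text \<open>First-moment argument. The mean pair density over all \<open>k\<close>-samples is
  \<open>a + e\<close> up to the diagonal, so at least a fraction \<open>e / 2\<close> of the
  samples has density above \<open>a\<close>. Each of these shows the pattern along one of at most
  \<open>k ^ m\<close> injections, and every injection sees all \<open>m\<close>-tuples equally
  often. The constant obtained does not depend on \<open>V\<close> or \<open>R\<close>.\<close>

lemma sampling:
  fixes V :: "'a set" and R :: "'a \<Rightarrow> 'a \<Rightarrow> bool" and P :: "(nat \<Rightarrow> 'a) \<Rightarrow> bool" and a e :: real
  assumes finV: "finite V" and a: "0 \<le> a" and e: "0 < e" and m: "0 < m" and k2: "2 \<le> k"
    and k: "2 * (a + e) \<le> e * real k"
    and pat: "\<And>x. x \<in> {..<k} \<rightarrow>\<^sub>E V \<Longrightarrow>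
        a * real k ^ 2 < real (card {(i, j). i < k \<and> j < k \<and> i \<noteq> j \<and> R (x i) (x j)}) \<Longrightarrow>
        \<exists>\<phi>. \<phi> ` {..<m} \<subseteq> {..<k} \<and> inj_on \<phi> {..<m} \<and> P (restrict (x \<circ> \<phi>) {..<m})"
    and dens: "(a + e) * real (card V) ^ 2 \<le> real (card {(x, y) \<in> V \<times> V. R x y})"
  shows "e / 2 / real k ^ m * real (card V) ^ m \<le> real (card {y \<in> {..<m} \<rightarrow>\<^sub>E V. P y})"
proof (cases "V = {}")
  case True then show ?thesis using m by (simp add: power_0_left)
next
  case False
  define n where "n = card V"
  have n: "n > 0" using False finV by (simp add: n_def card_gt_0_iff)
  let ?X = "{..<k} \<rightarrow>\<^sub>E V"
  have finX: "finite ?X" using finV by (simp add: finite_PiE)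
  have cX: "card ?X = n ^ k" using finV by (simp add: card_PiE n_def)
  define f where "f x = card {(i, j). i < k \<and> j < k \<and> i \<noteq> j \<and> R (x i) (x j)}" for x
  define Off where "Off = {(i, j). i < k \<and> j < k \<and> i \<noteq> j}"
  have Offeq: "Off = {..<k} \<times> {..<k} - (\<lambda>i. (i, i)) ` {..<k}" by (auto simp: Off_def)
  have finOff: "finite Off" unfolding Offeq by simp
  have cOff: "card Off = k * k - k"
    unfolding Offeq by (subst card_Diff_subset) (auto simp: card_cartesian_product card_image inj_on_def)
  have cOffr: "real (card Off) = real k * (real k - 1)"
    unfolding cOff using k2 by (simp add: of_nat_diff algebra_simps)
  have f_sum: "f x = (\<Sum>p\<in>Off. if R (x (fst p)) (x (snd p)) then 1 else 0)" for x
  proof -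
    have "{(i, j). i < k \<and> j < k \<and> i \<noteq> j \<and> R (x i) (x j)} = {p \<in> Off. R (x (fst p)) (x (snd p))}"
      by (auto simp: Off_def)
    then show ?thesis unfolding f_def using finOff by (simp add: sum.If_cases Int_def)
  qed
  have f_le: "real (f x) \<le> real k ^ 2" for x
  proof -
    have "f x \<le> (\<Sum>p\<in>Off. 1)" unfolding f_sum by (rule sum_mono) simp
    also have "\<dots> \<le> k * k" using cOff by simp
    finally show ?thesis by (simp add: power2_eq_square flip: of_nat_mult)
  qed
  define r where "r = card {(x, y) \<in> V \<times> V. R x y}"
  have "(\<Sum>x\<in>?X. f x) = (\<Sum>p\<in>Off. \<Sum>x\<in>?X. if R (x (fst p)) (x (snd p)) then 1 else 0)"
    unfolding f_sum by (rule sum.swap)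
  also have "\<dots> = (\<Sum>p\<in>Off. n ^ (k - 2) * r)"
  proof (rule sum.cong[OF refl])
    fix p assume p: "p \<in> Off"
    have "(\<Sum>x\<in>?X. if R (x (fst p)) (x (snd p)) then 1 else 0) = card {x \<in> ?X. R (x (fst p)) (x (snd p))}"
      using finX by (simp add: sum.If_cases Int_def)
    also have "\<dots> = n ^ (k - 2) * r"
      using sum_PiE_two_coordinates[of "{..<k}" "fst p" "snd p" V R] p finV
      by (auto simp: Off_def n_def r_def)
    finally show "(\<Sum>x\<in>?X. if R (x (fst p)) (x (snd p)) then 1 else 0) = n ^ (k - 2) * r" .
  qed
  finally have sumf: "(\<Sum>x\<in>?X. f x) = card Off * (n ^ (k - 2) * r)" by simp
  have nk: "real n ^ k = real n ^ (k - 2) * real n ^ 2"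
    using power_add[of "real n" "k - 2" 2] unfolding le_add_diff_inverse2[OF k2] .
  have low: "real k * (real k - 1) * (a + e) * real n ^ k \<le> (\<Sum>x\<in>?X. real (f x))"
  proof -
    have "real k * (real k - 1) * real n ^ (k - 2) * ((a + e) * real n ^ 2)
        \<le> real k * (real k - 1) * real n ^ (k - 2) * real r"
      using dens k2 by (intro mult_left_mono) (auto simp: n_def r_def)
    also have "\<dots> = real (\<Sum>x\<in>?X. f x)" unfolding sumf by (simp add: cOffr algebra_simps)
    finally show ?thesis by (simp add: nk algebra_simps)
  qed
  define Good where "Good = {x \<in> ?X. a * real k ^ 2 < real (f x)}"
  have "(\<Sum>x\<in>?X. real (f x)) \<le> (\<Sum>x\<in>?X. a * real k ^ 2 + (if x \<in> Good then real k ^ 2 else 0))"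
    by (rule sum_mono) (use f_le a in \<open>auto simp: Good_def add_increasing\<close>)
  also have "\<dots> = real n ^ k * (a * real k ^ 2) + real (card Good) * real k ^ 2"
    using finX by (simp add: sum.distrib cX sum.If_cases Int_def Good_def conj_commute)
  finally have up: "(\<Sum>x\<in>?X. real (f x)) \<le> real n ^ k * (a * real k ^ 2) + real (card Good) * real k ^ 2" .
  have kpos: "real k > 0" using k2 by simp
  \<comment> \<open>Leaving out the pairs \<open>i = j\<close> costs a factor
    \<open>(k - 1) / k\<close>; the hypothesis on \<open>k\<close> says exactly that half of
    \<open>e\<close> survives this loss.\<close>
  have "e / 2 * real n ^ k * real k ^ 2 \<le> (real k * (real k - 1) * (a + e) - a * real k ^ 2) * real n ^ k"
  proof -
    have "e / 2 * real k \<le> (real k - 1) * (a + e) - a * real k" using k by (simp add: algebra_simps)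
    from mult_left_mono[OF this, of "real k"]
    have "e / 2 * real k ^ 2 \<le> real k * (real k - 1) * (a + e) - a * real k ^ 2"
      using kpos by (simp add: algebra_simps power2_eq_square)
    from mult_right_mono[OF this, of "real n ^ k"] show ?thesis by (simp add: algebra_simps)
  qed
  also have "\<dots> \<le> real (card Good) * real k ^ 2" using low up by (simp add: algebra_simps)
  finally have good: "e / 2 * real n ^ k \<le> real (card Good)" using kpos by simp
  define \<Phi> where "\<Phi> = {\<phi> \<in> {..<m} \<rightarrow>\<^sub>E {..<k}. inj_on \<phi> {..<m}}"
  have fin\<Phi>: "finite \<Phi>" unfolding \<Phi>_def by (simp add: finite_PiE)
  have c\<Phi>: "card \<Phi> \<le> k ^ m"
  proof -
    have "card \<Phi> \<le> card ({..<m} \<rightarrow>\<^sub>E {..<k})"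
      unfolding \<Phi>_def by (intro card_mono) (auto simp: finite_PiE)
    then show ?thesis by (simp add: card_PiE)
  qed
  define Y where "Y = card {y \<in> {..<m} \<rightarrow>\<^sub>E V. P y}"
  have ex: "\<exists>\<phi>\<in>\<Phi>. P (restrict (x \<circ> \<phi>) {..<m})" if "x \<in> Good" for x
  proof -
    from that pat[of x] obtain \<phi> where \<phi>: "\<phi> ` {..<m} \<subseteq> {..<k}" "inj_on \<phi> {..<m}" "P (restrict (x \<circ> \<phi>) {..<m})"
      by (auto simp: Good_def f_def)
    have "restrict (x \<circ> restrict \<phi> {..<m}) {..<m} = restrict (x \<circ> \<phi>) {..<m}" by auto
    moreover have "restrict \<phi> {..<m} \<in> \<Phi>" using \<phi> by (auto simp: \<Phi>_def inj_on_def)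
    ultimately show ?thesis using \<phi>(3) by metis
  qed
  have "card Good \<le> (\<Sum>x\<in>?X. \<Sum>\<phi>\<in>\<Phi>. if P (restrict (x \<circ> \<phi>) {..<m}) then 1 else 0)"
  proof -
    have "card Good = (\<Sum>x\<in>Good. 1)" by simp
    also have "\<dots> \<le> (\<Sum>x\<in>Good. \<Sum>\<phi>\<in>\<Phi>. if P (restrict (x \<circ> \<phi>) {..<m}) then 1 else 0)"
    proof (rule sum_mono)
      fix x assume "x \<in> Good"
      from ex[OF this] obtain \<phi> where \<phi>: "\<phi> \<in> \<Phi>" "P (restrict (x \<circ> \<phi>) {..<m})" by blast
      have "(1::nat) = (if P (restrict (x \<circ> \<phi>) {..<m}) then 1 else 0)" using \<phi> by simp
      also have "\<dots> \<le> (\<Sum>\<phi>\<in>\<Phi>. if P (restrict (x \<circ> \<phi>) {..<m}) then 1 else 0)"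
        by (rule member_le_sum[OF \<phi>(1)]) (use fin\<Phi> in auto)
      finally show "1 \<le> (\<Sum>\<phi>\<in>\<Phi>. if P (restrict (x \<circ> \<phi>) {..<m}) then 1 else (0::nat))" .
    qed
    also have "\<dots> \<le> (\<Sum>x\<in>?X. \<Sum>\<phi>\<in>\<Phi>. if P (restrict (x \<circ> \<phi>) {..<m}) then 1 else 0)"
      by (rule sum_mono2) (use finX in \<open>auto simp: Good_def\<close>)
    finally show ?thesis .
  qed
  also have "\<dots> = (\<Sum>\<phi>\<in>\<Phi>. \<Sum>x\<in>?X. if P (restrict (x \<circ> \<phi>) {..<m}) then 1 else 0)" by (rule sum.swap)
  also have "\<dots> = (\<Sum>\<phi>\<in>\<Phi>. n ^ (k - m) * Y)"
  proof (rule sum.cong[OF refl])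
    fix \<phi> assume \<phi>: "\<phi> \<in> \<Phi>"
    have "(\<Sum>x\<in>?X. if P (restrict (x \<circ> \<phi>) {..<m}) then 1 else 0)
       = card V ^ (card {..<k} - card {..<m}) * (\<Sum>y\<in>{..<m} \<rightarrow>\<^sub>E V. if P y then 1 else (0::nat))"
      using sum_PiE_reindex[of "{..<k}" \<phi> "{..<m}" "\<lambda>y. if P y then 1 else (0::nat)" V] \<phi>
      by (auto simp: \<Phi>_def)
    also have "(\<Sum>y\<in>{..<m} \<rightarrow>\<^sub>E V. if P y then 1 else (0::nat)) = Y"
      using finV by (simp add: Y_def sum.If_cases Int_def finite_PiE)
    finally show "(\<Sum>x\<in>?X. if P (restrict (x \<circ> \<phi>) {..<m}) then 1 else 0) = n ^ (k - m) * Y"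
      unfolding n_def card_lessThan .
  qed
  also have "\<dots> = card \<Phi> * (n ^ (k - m) * Y)" by simp
  finally have gY: "card Good \<le> card \<Phi> * (n ^ (k - m) * Y)" .
  have gpos: "0 < real (card Good)"
  proof -
    have "0 < e / 2 * real n ^ k" using e n by simp
    then show ?thesis using good by linarith
  qed
  \<comment> \<open>An injection exists, so \<open>m \<le> k\<close> and the exponent
    \<open>k - m\<close> is a genuine difference.\<close>
  then have "\<Phi> \<noteq> {}" using gY by auto
  then obtain \<phi> where "\<phi> ` {..<m} \<subseteq> {..<k}" "inj_on \<phi> {..<m}" by (auto simp: \<Phi>_def)
  then have mk: "m \<le> k" using card_inj_on_le[of \<phi> "{..<m}" "{..<k}"] by simp
  have "e / 2 * real n ^ k \<le> real (k ^ m * (n ^ (k - m) * Y))"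
  proof -
    have "card Good \<le> k ^ m * (n ^ (k - m) * Y)"
      using gY mult_right_mono[OF c\<Phi>, of "n ^ (k - m) * Y"] by linarith
    then show ?thesis using good by (meson of_nat_mono order_trans)
  qed
  also have "\<dots> = real k ^ m * real Y * real n ^ (k - m)" by simp
  finally have "(e / 2 * real n ^ m) * real n ^ (k - m) \<le> (real k ^ m * real Y) * real n ^ (k - m)"
    using mk by (simp add: mult.assoc flip: power_add)
  then have "e / 2 * real n ^ m \<le> real k ^ m * real Y" using n by simp
  then show ?thesis using kpos by (simp add: Y_def n_def field_simps)
qed

section \<open>Counting in the cut norm\<close>

text \<open>A bilinear form on the unit cube is maximal at a vertex. With \<open>b\<close> fixed,
  \<open>a\<close> is rounded to the indicator of the rows with positive sum; then \<open>b\<close>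
  is rounded in the same way.\<close>

lemma bilinear_le_cut:
  fixes D :: "'a \<Rightarrow> 'a \<Rightarrow> real"
  assumes fin: "finite V"
    and cut: "\<And>A B. A \<subseteq> V \<Longrightarrow> B \<subseteq> V \<Longrightarrow> (\<Sum>x\<in>A. \<Sum>y\<in>B. D x y) \<le> C"
    and a: "\<And>x. x \<in> V \<Longrightarrow> 0 \<le> a x \<and> a x \<le> 1" and b: "\<And>x. x \<in> V \<Longrightarrow> 0 \<le> b x \<and> b x \<le> 1"
  shows "(\<Sum>x\<in>V. \<Sum>y\<in>V. D x y * a x * b y) \<le> C"
proof -
  have ext: "(\<Sum>x\<in>V. g x * c x) \<le> (\<Sum>x\<in>{x\<in>V. g x > 0}. g x)"
    if "\<And>x. x \<in> V \<Longrightarrow> 0 \<le> c x \<and> c x \<le> 1" for g c :: "'a \<Rightarrow> real"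
  proof -
    have "(\<Sum>x\<in>V. g x * c x) \<le> (\<Sum>x\<in>V. if g x > 0 then g x else 0)"
    proof (rule sum_mono)
      fix x assume "x \<in> V"
      with that[of x] show "g x * c x \<le> (if g x > 0 then g x else 0)"
        by (auto simp: mult_left_le mult_nonpos_nonneg)
    qed
    then show ?thesis using fin by (simp add: sum.If_cases Int_def)
  qed
  define A where "A = {x\<in>V. (\<Sum>y\<in>V. D x y * b y) > 0}"
  define B where "B = {y\<in>V. (\<Sum>x\<in>A. D x y) > 0}"
  have "(\<Sum>x\<in>V. \<Sum>y\<in>V. D x y * a x * b y) = (\<Sum>x\<in>V. (\<Sum>y\<in>V. D x y * b y) * a x)"
    by (simp add: sum_distrib_left sum_distrib_right mult_ac)
  also have "\<dots> \<le> (\<Sum>x\<in>A. \<Sum>y\<in>V. D x y * b y)" unfolding A_def by (rule ext[OF a])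
  also have "\<dots> = (\<Sum>y\<in>V. (\<Sum>x\<in>A. D x y) * b y)"
    by (subst sum.swap) (simp add: sum_distrib_right)
  also have "\<dots> \<le> (\<Sum>y\<in>B. \<Sum>x\<in>A. D x y)" unfolding B_def by (rule ext[OF b])
  also have "\<dots> = (\<Sum>x\<in>A. \<Sum>y\<in>B. D x y)" by (rule sum.swap)
  also have "\<dots> \<le> C" by (rule cut) (auto simp: A_def B_def)
  finally show ?thesis .
qed

text \<open>
  Once the coordinates other than \<open>u\<close>, \<open>v\<close> are frozen, \<open>\<alpha>\<close> depends on \<open>x u\<close> only and \<open>\<beta>\<close> on \<open>x v\<close>
  only.
\<close>

lemma sum_PiE_le_cut:
  fixes D :: "'a \<Rightarrow> 'a \<Rightarrow> real"
  assumes fin: "finite V" and I: "u \<in> I" "v \<in> I" "u \<noteq> v" "finite I"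
    and cut: "\<And>A B. A \<subseteq> V \<Longrightarrow> B \<subseteq> V \<Longrightarrow> (\<Sum>x\<in>A. \<Sum>y\<in>B. D x y) \<le> C"
    and \<alpha>: "\<And>x. x \<in> I \<rightarrow>\<^sub>E V \<Longrightarrow> 0 \<le> \<alpha> x \<and> \<alpha> x \<le> 1" "\<And>x t. \<alpha> (x(v := t)) = \<alpha> x"
    and \<beta>: "\<And>x. x \<in> I \<rightarrow>\<^sub>E V \<Longrightarrow> 0 \<le> \<beta> x \<and> \<beta> x \<le> 1" "\<And>x s. \<beta> (x(u := s)) = \<beta> x"
  shows "(\<Sum>x\<in>I \<rightarrow>\<^sub>E V. D (x u) (x v) * \<alpha> x * \<beta> x) \<le> C * real (card V) ^ (card I - 2)"
proof (cases "V = {}")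
  case True
  have "0 \<le> C" using cut[of "{}" "{}"] by simp
  moreover have "I \<rightarrow>\<^sub>E V = {}" using True I(1) by auto
  ultimately show ?thesis by simp
next
  case False
  then obtain t0 where t0: "t0 \<in> V" by blast
  let ?I' = "I - {u, v}"
  have Ieq: "I = insert u (insert v ?I')" using I by auto
  have u: "u \<notin> insert v ?I'" using I by auto
  have v: "v \<notin> ?I'" by auto
  have upd: "z(v := t, u := s) \<in> I \<rightarrow>\<^sub>E V" if "z \<in> ?I' \<rightarrow>\<^sub>E V" "s \<in> V" "t \<in> V" for z s t
    using that I by (auto simp: PiE_iff extensional_def)
  have "(\<Sum>x\<in>I \<rightarrow>\<^sub>E V. D (x u) (x v) * \<alpha> x * \<beta> x)
     = (\<Sum>z\<in>?I' \<rightarrow>\<^sub>E V. \<Sum>t\<in>V. \<Sum>s\<in>V. D s t * \<alpha> (z(v := t, u := s)) * \<beta> (z(v := t, u := s)))"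
    by (subst (1) Ieq, subst sum_PiE_insert[OF u], subst sum_PiE_insert[OF v]) (use I in simp)
  also have "\<dots> \<le> (\<Sum>z\<in>?I' \<rightarrow>\<^sub>E V. C)"
  proof (rule sum_mono)
    fix z assume z: "z \<in> ?I' \<rightarrow>\<^sub>E V"
    have "(\<Sum>t\<in>V. \<Sum>s\<in>V. D s t * \<alpha> (z(v := t, u := s)) * \<beta> (z(v := t, u := s)))
       = (\<Sum>s\<in>V. \<Sum>t\<in>V. D s t * \<alpha> (z(v := t, u := s)) * \<beta> (z(v := t, u := s)))"
      by (rule sum.swap)
    \<comment> \<open>\<open>t0\<close> is a dummy value written into the coordinate that the
      respective factor ignores; afterwards the weights are functions of \<open>s\<close> alone and
      of \<open>t\<close> alone.\<close>
    also have "\<dots> = (\<Sum>s\<in>V. \<Sum>t\<in>V. D s t * \<alpha> (z(v := t0, u := s)) * \<beta> (z(v := t, u := t0)))"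
    proof (intro sum.cong refl)
      fix s t
      have "\<alpha> (z(v := t, u := s)) = \<alpha> (z(v := t0, u := s))"
        using \<alpha>(2)[of "z(v := t, u := s)" t0] I by (simp add: fun_upd_twist)
      moreover have "\<beta> (z(v := t, u := s)) = \<beta> (z(v := t, u := t0))"
        using \<beta>(2)[of "z(v := t, u := s)" t0] by simp
      ultimately show "D s t * \<alpha> (z(v := t, u := s)) * \<beta> (z(v := t, u := s))
          = D s t * \<alpha> (z(v := t0, u := s)) * \<beta> (z(v := t, u := t0))" by simp
    qed
    also have "\<dots> \<le> C"
      by (rule bilinear_le_cut[OF fin cut]) (use \<alpha>(1) \<beta>(1) upd z t0 in auto)
    finally show "(\<Sum>t\<in>V. \<Sum>s\<in>V. D s t * \<alpha> (z(v := t, u := s)) * \<beta> (z(v := t, u := s))) \<le> C" .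
  qed
  also have "\<dots> = C * real (card V) ^ card ?I'" using I by (simp add: card_PiE)
  also have "card ?I' = card I - 2" using I by (simp add: card_Diff_subset)
  finally show ?thesis .
qed

text \<open>An unnormalised homomorphism density in which every index pair has its own weight, so
  that edges and non-edges of H are handled alike. The tuples need not be injective.\<close>

definition hom_sum ::
  "'a set \<Rightarrow> 'i set \<Rightarrow> ('i \<times> 'i) set \<Rightarrow> ('i \<Rightarrow> 'i \<Rightarrow> 'a \<Rightarrow> 'a \<Rightarrow> real) \<Rightarrow> real" where
  "hom_sum V I E f = (\<Sum>x\<in>I \<rightarrow>\<^sub>E V. \<Prod>(u, v)\<in>E. f u v (x u) (x v))"

text \<open>The factors other than that of \<open>(u, v)\<close> are split into those that involve
  \<open>v\<close>, collected in \<open>\<beta>\<close>, and the rest, collected in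
  \<open>\<alpha>\<close>. No factor of \<open>\<beta>\<close> involves \<open>u\<close>, because
  \<open>E\<close> lists pairs in increasing order only and \<open>(u, v)\<close> itself is removed.
  This is the separation of variables that \<open>sum_PiE_le_cut\<close> asks for.\<close>

lemma hom_sum_replace:
  fixes F :: "nat \<Rightarrow> nat \<Rightarrow> 'a \<Rightarrow> 'a \<Rightarrow> real"
  assumes fin: "finite V" "finite I" and E: "E \<subseteq> {(u, v). u \<in> I \<and> v \<in> I \<and> u < v}" and uv: "(u, v) \<in> E"
    and F: "\<And>u v x y. (u, v) \<in> E \<Longrightarrow> x \<in> V \<Longrightarrow> y \<in> V \<Longrightarrow> 0 \<le> F u v x y \<and> F u v x y \<le> 1"
    and cut: "\<And>A B. A \<subseteq> V \<Longrightarrow> B \<subseteq> V \<Longrightarrow> (\<Sum>x\<in>A. \<Sum>y\<in>B. F u v x y - G u v x y) \<le> C"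
    and same: "\<And>p. p \<in> E \<Longrightarrow> p \<noteq> (u, v) \<Longrightarrow> G (fst p) (snd p) = F (fst p) (snd p)"
  shows "hom_sum V I E F \<le> hom_sum V I E G + C * real (card V) ^ (card I - 2)"
proof -
  have finE: "finite E" by (rule finite_subset[OF E], rule finite_subset[of _ "I \<times> I"]) (use fin in auto)
  have u: "u \<in> I" "v \<in> I" "u < v" using E uv by auto
  let ?E = "E - {(u, v)}"
  define Ev where "Ev = {p \<in> ?E. fst p = v \<or> snd p = v}"
  define Eu where "Eu = ?E - Ev"
  define g where "g p x = F (fst p) (snd p) (x (fst p)) (x (snd p))" for p x
  define \<alpha> where "\<alpha> x = (\<Prod>p\<in>Eu. g p x)" for x
  define \<beta> where "\<beta> x = (\<Prod>p\<in>Ev. g p x)" for x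
  have split: "(\<Prod>p\<in>?E. g p x) = \<alpha> x * \<beta> x" for x
    unfolding \<alpha>_def \<beta>_def Eu_def using finE by (subst prod.subset_diff[of Ev]) (auto simp: Ev_def)
  have g01: "0 \<le> g p x \<and> g p x \<le> 1" if "p \<in> E" "x \<in> I \<rightarrow>\<^sub>E V" for p x
    unfolding g_def using that E by (intro F) (auto simp: PiE_iff)
  have PF: "(\<Prod>(a, b)\<in>E. F a b (x a) (x b)) = F u v (x u) (x v) * (\<Prod>p\<in>?E. g p x)" for x
    using prod.remove[OF finE uv, of "\<lambda>(a, b). F a b (x a) (x b)"] by (simp add: g_def split_def)
  have PG: "(\<Prod>(a, b)\<in>E. G a b (x a) (x b)) = G u v (x u) (x v) * (\<Prod>p\<in>?E. g p x)" for x
  proof -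
    have "(\<Prod>p\<in>?E. G (fst p) (snd p) (x (fst p)) (x (snd p))) = (\<Prod>p\<in>?E. g p x)"
      by (rule prod.cong[OF refl]) (use same in \<open>auto simp: g_def\<close>)
    then show ?thesis using prod.remove[OF finE uv, of "\<lambda>(a, b). G a b (x a) (x b)"] by (simp add: split_def)
  qed
  have "hom_sum V I E F - hom_sum V I E G
     = (\<Sum>x\<in>I \<rightarrow>\<^sub>E V. (F u v (x u) (x v) - G u v (x u) (x v)) * \<alpha> x * \<beta> x)"
    unfolding hom_sum_def PF PG split by (simp add: algebra_simps flip: sum_subtractf)
  also have "\<dots> \<le> C * real (card V) ^ (card I - 2)"
  proof (rule sum_PiE_le_cut[where D = "\<lambda>x y. F u v x y - G u v x y"])
    show "u \<noteq> v" using u by simp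
    show "0 \<le> \<alpha> x \<and> \<alpha> x \<le> 1" "0 \<le> \<beta> x \<and> \<beta> x \<le> 1" if "x \<in> I \<rightarrow>\<^sub>E V" for x
      unfolding \<alpha>_def \<beta>_def Eu_def Ev_def using g01 that by (auto intro!: prod_nonneg prod_le_1)
    show "\<alpha> (x(v := t)) = \<alpha> x" for x t
      unfolding \<alpha>_def by (rule prod.cong[OF refl]) (auto simp: Eu_def Ev_def g_def)
    show "\<beta> (x(u := s)) = \<beta> x" for x s
      unfolding \<beta>_def
    proof (rule prod.cong[OF refl])
      fix p assume p: "p \<in> Ev"
      then have "p \<in> E" "p \<noteq> (u, v)" "fst p = v \<or> snd p = v" by (auto simp: Ev_def)
      then have "fst p \<noteq> u" "snd p \<noteq> u" using E u by (cases p; auto)+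
      then show "g p (x(u := s)) = g p x" by (simp add: g_def)
    qed
  qed (use fin u cut in auto)
  finally show ?thesis by simp
qed

text \<open>The counting lemma by telescoping: the weights are exchanged one index pair at a time,
  and each exchange costs one cut-norm error.\<close>

lemma hom_sum_le:
  fixes f g :: "nat \<Rightarrow> nat \<Rightarrow> 'a \<Rightarrow> 'a \<Rightarrow> real"
  assumes fin: "finite V" "finite I" and E: "E \<subseteq> {(u, v). u \<in> I \<and> v \<in> I \<and> u < v}"
    and f: "\<And>u v x y. (u, v) \<in> E \<Longrightarrow> x \<in> V \<Longrightarrow> y \<in> V \<Longrightarrow> 0 \<le> f u v x y \<and> f u v x y \<le> 1"
    and g: "\<And>u v x y. (u, v) \<in> E \<Longrightarrow> x \<in> V \<Longrightarrow> y \<in> V \<Longrightarrow> 0 \<le> g u v x y \<and> g u v x y \<le> 1"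
    and cut: "\<And>u v A B. (u, v) \<in> E \<Longrightarrow> A \<subseteq> V \<Longrightarrow> B \<subseteq> V \<Longrightarrow> (\<Sum>x\<in>A. \<Sum>y\<in>B. f u v x y - g u v x y) \<le> C"
  shows "hom_sum V I E f \<le> hom_sum V I E g + real (card E) * C * real (card V) ^ (card I - 2)"
proof -
  have finE: "finite E" by (rule finite_subset[OF E], rule finite_subset[of _ "I \<times> I"]) (use fin in auto)
  \<comment> \<open>The hybrid in which the pairs of \<open>S\<close> already carry the new
    weight.\<close>
  define hyb where "hyb S = (\<lambda>u v. if (u, v) \<in> S then g u v else f u v)" for S
  have "hom_sum V I E f \<le> hom_sum V I E (hyb S) + real (card S) * C * real (card V) ^ (card I - 2)"
    if "finite S" "S \<subseteq> E" for S
    using that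
  proof (induction S)
    case empty then show ?case by (simp add: hyb_def)
  next
    case (insert p S)
    obtain u v where p: "p = (u, v)" by (cases p)
    have "hom_sum V I E (hyb S) \<le> hom_sum V I E (hyb (insert p S)) + C * real (card V) ^ (card I - 2)"
    proof (rule hom_sum_replace[OF fin E])
      show "(u, v) \<in> E" using insert p by simp
      show "0 \<le> hyb S u v x y \<and> hyb S u v x y \<le> 1" if "(u, v) \<in> E" "x \<in> V" "y \<in> V" for u v x y
        using f[OF that] g[OF that] by (simp add: hyb_def)
      show "(\<Sum>x\<in>A. \<Sum>y\<in>B. hyb S u v x y - hyb (insert p S) u v x y) \<le> C" if "A \<subseteq> V" "B \<subseteq> V" for A B
        using cut[of u v A B] that insert p by (simp add: hyb_def)
      show "hyb (insert p S) (fst q) (snd q) = hyb S (fst q) (snd q)" if "q \<in> E" "q \<noteq> (u, v)" for q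
        using that p by (cases q) (auto simp: hyb_def)
    qed
    then show ?case using insert by (simp add: algebra_simps)
  qed
  from this[OF finE] have "hom_sum V I E f \<le> hom_sum V I E (hyb E) + real (card E) * C * real (card V) ^ (card I - 2)"
    by simp
  moreover have "hom_sum V I E (hyb E) = hom_sum V I E g"
    unfolding hom_sum_def by (intro sum.cong prod.cong refl) (auto simp: hyb_def)
  ultimately show ?thesis by simp
qed

section \<open>Turan's theorem and supersaturation\<close>

text \<open>Induction through the neighbourhood \<open>N\<close> of a vertex of maximum degree
  \<open>\<Delta>\<close>: pairs not inside \<open>N\<close> lie in one of the
  \<open>n - \<Delta>\<close> rows or columns outside \<open>N\<close>, each with at most
  \<open>\<Delta>\<close> entries. If \<open>N\<close> were not dense enough for the induction
  hypothesis, a square would be negative. Loops of \<open>R\<close> are allowed, so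
  \<open>\<phi>\<close> need not be injective; the applications build \<open>i \<noteq> j\<close>
  into the relation.\<close>

lemma turan:
  fixes R :: "'a \<Rightarrow> 'a \<Rightarrow> bool"
  assumes "finite V" "\<And>x y. x \<in> V \<Longrightarrow> y \<in> V \<Longrightarrow> R x y \<Longrightarrow> R y x" "1 \<le> r"
    and "(1 - 1 / real r) * real (card V) ^ 2 < real (card {(x, y) \<in> V \<times> V. R x y})"
  shows "\<exists>\<phi>. \<phi> ` {..<Suc r} \<subseteq> V \<and> (\<forall>a b. a < b \<longrightarrow> b < Suc r \<longrightarrow> R (\<phi> a) (\<phi> b))"
  using assms(3,1,2,4)
proof (induction r arbitrary: V rule: dec_induct)
  case base
  have "{(x, y) \<in> V \<times> V. R x y} \<noteq> {}" using base(3) by (auto simp: card_gt_0_iff)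
  then obtain x y where "x \<in> V" "y \<in> V" "R x y" by auto
  then show ?case by (intro exI[of _ "\<lambda>i::nat. if i = 0 then x else y"]) auto
next
  case (step r)
  let ?e = "\<lambda>W. real (card {(x, y) \<in> W \<times> W. R x y})"
  note fin = step.prems(1) and sym = step.prems(2) and dens = step.prems(3)
  have "V \<noteq> {}" using dens by auto
  define d where "d x = card {y \<in> V. R x y}" for x
  define \<Delta> where "\<Delta> = Max (d ` V)"
  have "\<Delta> \<in> d ` V" unfolding \<Delta>_def using fin \<open>V \<noteq> {}\<close> by (intro Max_in) auto
  then obtain x where x: "x \<in> V" "d x = \<Delta>" by auto
  have d_le: "d y \<le> \<Delta>" if "y \<in> V" for y unfolding \<Delta>_def using fin that by simp
  define N where "N = {y \<in> V. R x y}"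
  have N: "N \<subseteq> V" "finite N" "card N = \<Delta>" using fin x by (auto simp: N_def d_def)
  define n where "n = card V"
  have \<Delta>n: "\<Delta> \<le> n" using N card_mono[OF fin N(1)] by (simp add: n_def)
  have row: "card {(y, z) \<in> (V - N) \<times> V. R y z} \<le> (n - \<Delta>) * \<Delta>"
  proof -
    have "{(y, z) \<in> (V - N) \<times> V. R y z} = (SIGMA y:V - N. {z \<in> V. R y z})" by auto
    then have "card {(y, z) \<in> (V - N) \<times> V. R y z} = (\<Sum>y\<in>V - N. d y)"
      using fin by (simp add: card_SigmaI d_def)
    also have "\<dots> \<le> (\<Sum>y\<in>V - N. \<Delta>)" by (rule sum_mono) (use d_le in auto)
    also have "\<dots> = (n - \<Delta>) * \<Delta>" using N by (simp add: card_Diff_subset n_def)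
    finally show ?thesis .
  qed
  have col: "card {(z, y) \<in> V \<times> (V - N). R z y} \<le> (n - \<Delta>) * \<Delta>"
  proof -
    have "{(z, y) \<in> V \<times> (V - N). R z y} = (\<lambda>(y, z). (z, y)) ` {(y, z) \<in> (V - N) \<times> V. R y z}"
      using sym by (auto simp: image_iff)
    moreover have "card ((\<lambda>(y, z). (z, y)) ` {(y, z) \<in> (V - N) \<times> V. R y z}) \<le> card {(y, z) \<in> (V - N) \<times> V. R y z}"
      by (rule card_image_le) (rule finite_subset[of _ "V \<times> V"], use fin in auto)
    ultimately show ?thesis using row by simp
  qed
  have "card {(y, z) \<in> V \<times> V. R y z} \<le> card ({(y, z) \<in> N \<times> N. R y z} \<union> ({(y, z) \<in> (V - N) \<times> V. R y z} \<union> {(z, y) \<in> V \<times> (V - N). R z y}))"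
    by (rule card_mono, rule finite_subset[of _ "V \<times> V"]) (use fin N(1) in auto)
  also have "\<dots> \<le> card {(y, z) \<in> N \<times> N. R y z} + (card {(y, z) \<in> (V - N) \<times> V. R y z} + card {(z, y) \<in> V \<times> (V - N). R z y})"
    by (meson add_left_mono card_Un_le order_trans)
  also have "\<dots> \<le> card {(y, z) \<in> N \<times> N. R y z} + 2 * ((n - \<Delta>) * \<Delta>)" using row col by simp
  finally have "?e V \<le> real (card {(y, z) \<in> N \<times> N. R y z} + 2 * ((n - \<Delta>) * \<Delta>))"
    by (rule of_nat_mono)
  then have "?e V \<le> ?e N + 2 * (real (n - \<Delta>) * real \<Delta>)"
    by (simp only: of_nat_add of_nat_mult of_nat_numeral)
  then have up: "?e V \<le> ?e N + 2 * (real n - real \<Delta>) * real \<Delta>"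
    unfolding of_nat_diff[OF \<Delta>n] by (simp only: mult.assoc)
  have "(1 - 1 / real r) * real (card N) ^ 2 < ?e N"
  proof (rule ccontr)
    assume "\<not> ?thesis"
    then have "?e N \<le> (1 - 1 / real r) * real \<Delta> ^ 2" using N by simp
    then have 1: "(1 - 1 / real (Suc r)) * real n ^ 2 < (1 - 1 / real r) * real \<Delta> ^ 2 + 2 * (real n - real \<Delta>) * real \<Delta>"
      using up dens by (simp add: n_def)
    \<comment> \<open>The inverse of the Turan density for \<open>Suc r\<close>; multiplied by
      \<open>q\<close>, the inequality says that the square of \<open>n - q \<Delta>\<close> is
      negative.\<close>
    define q where "q = 1 + 1 / real r"
    have q: "q > 0" "1 - 1 / real (Suc r) = 1 / q" using step.hyps by (auto simp: q_def field_simps)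
    have "1 / q * real n ^ 2 < 2 * real n * real \<Delta> - q * real \<Delta> ^ 2"
      using 1 unfolding q(2) by (simp add: q_def algebra_simps power2_eq_square)
    from mult_strict_left_mono[OF this q(1)]
    have "real n ^ 2 < 2 * real n * (q * real \<Delta>) - (q * real \<Delta>) ^ 2"
      using q(1) by (simp add: algebra_simps power2_eq_square)
    moreover have "0 \<le> (real n - q * real \<Delta>) ^ 2" by simp
    ultimately show False by (simp add: power2_diff)
  qed
  then obtain \<phi> where \<phi>: "\<phi> ` {..<Suc r} \<subseteq> N" "\<And>a b. a < b \<Longrightarrow> b < Suc r \<Longrightarrow> R (\<phi> a) (\<phi> b)"
    using step.IH[OF N(2)] sym N(1) by blast
  have "R (\<phi> a) x" if "a < Suc r" for a
  proof -
    have "\<phi> a \<in> N" using \<phi>(1) that by auto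
    then show ?thesis using sym[of x "\<phi> a"] x(1) by (auto simp: N_def)
  qed
  moreover have "\<phi> a \<in> V" if "a < Suc r" for a using \<phi>(1) that N(1) by blast
  ultimately show ?case using x \<phi>
    by (intro exI[of _ "\<phi>(Suc r := x)"]) (auto simp: less_Suc_eq)
qed

text \<open>\<open>sampling\<close> with Turan's theorem inside the sample. The constant depends on
  \<open>r\<close> and \<open>e\<close> only.\<close>

lemma turan_supersaturation:
  assumes "1 \<le> r" "0 < e"
  shows "\<exists>c>0. c \<le> 1 \<and> (\<forall>(V :: 'a set) R. finite V \<longrightarrow>
     (\<forall>x\<in>V. \<forall>y\<in>V. R x y \<longrightarrow> R y x) \<longrightarrow>
     (1 - 1 / real r + e) * real (card V) ^ 2 \<le> real (card {(x, y) \<in> V \<times> V. R x y}) \<longrightarrow>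
     c * real (card V) ^ Suc r
       \<le> real (card {y \<in> {..<Suc r} \<rightarrow>\<^sub>E V. \<forall>a b. a < b \<longrightarrow> b < Suc r \<longrightarrow> R (y a) (y b)}))"
proof -
  define a where "a = 1 - 1 / real r"
  have a: "0 \<le> a" using assms by (simp add: a_def field_simps)
  define k where "k = nat \<lceil>2 * (a + e) / e\<rceil> + 2"
  have "2 * (a + e) / e \<le> real k" unfolding k_def by linarith
  then have k: "2 * (a + e) \<le> e * real k" "2 \<le> k" using assms by (auto simp: k_def field_simps)
  define c where "c = min 1 (e / 2 / real k ^ Suc r)"
  have c: "0 < c" "c \<le> 1" "c \<le> e / 2 / real k ^ Suc r" using assms k by (auto simp: c_def)
  have "c * real (card V) ^ Suc r
       \<le> real (card {y \<in> {..<Suc r} \<rightarrow>\<^sub>E V. \<forall>a b. a < b \<longrightarrow> b < Suc r \<longrightarrow> R (y a) (y b)})"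
    if V: "finite V" and sym: "\<forall>x\<in>V. \<forall>y\<in>V. R x y \<longrightarrow> R y x"
      and dens: "(a + e) * real (card V) ^ 2 \<le> real (card {(x, y) \<in> V \<times> V. R x y})"
    for V :: "'a set" and R
  proof -
    have "c * real (card V) ^ Suc r \<le> e / 2 / real k ^ Suc r * real (card V) ^ Suc r"
      using c(3) by (intro mult_right_mono) auto
    also have "\<dots> \<le> real (card {y \<in> {..<Suc r} \<rightarrow>\<^sub>E V. \<forall>a b. a < b \<longrightarrow> b < Suc r \<longrightarrow> R (y a) (y b)})"
    proof (rule sampling[OF V a assms(2) _ k(2,1) _ dens])
      fix x assume x: "x \<in> {..<k} \<rightarrow>\<^sub>E V"
        and d: "a * real k ^ 2 < real (card {(i, j). i < k \<and> j < k \<and> i \<noteq> j \<and> R (x i) (x j)})"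
      \<comment> \<open>Excluding equal indices makes the clique found in the sample an injection of
        indices; the sampled vertices themselves may coincide.\<close>
      define R' where "R' i j \<longleftrightarrow> i \<noteq> j \<and> R (x i) (x j)" for i j
      have "{(i, j). i < k \<and> j < k \<and> i \<noteq> j \<and> R (x i) (x j)} = {(i, j) \<in> {..<k} \<times> {..<k}. R' i j}"
        by (auto simp: R'_def)
      then have d': "(1 - 1 / real r) * real (card {..<k}) ^ 2 < real (card {(i, j) \<in> {..<k} \<times> {..<k}. R' i j})"
        using d by (simp add: a_def)
      have sym': "R' j i" if "i \<in> {..<k}" "j \<in> {..<k}" "R' i j" for i j
        using that sym PiE_mem[OF x] unfolding R'_def by blast
      obtain \<phi> where \<phi>: "\<phi> ` {..<Suc r} \<subseteq> {..<k}" "\<And>a b. a < b \<Longrightarrow> b < Suc r \<Longrightarrow> R' (\<phi> a) (\<phi> b)"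
        using turan[OF _ sym' assms(1) d'] by auto
      have "inj_on \<phi> {..<Suc r}"
        by (rule linorder_inj_onI) (use \<phi>(2) in \<open>auto simp: R'_def\<close>)
      then show "\<exists>\<phi>. \<phi> ` {..<Suc r} \<subseteq> {..<k} \<and> inj_on \<phi> {..<Suc r} \<and>
          (\<forall>a b. a < b \<longrightarrow> b < Suc r \<longrightarrow> R (restrict (x \<circ> \<phi>) {..<Suc r} a) (restrict (x \<circ> \<phi>) {..<Suc r} b))"
        using \<phi> by (intro exI[of _ \<phi>]) (auto simp: R'_def)
    qed simp
    finally show ?thesis .
  qed
  then show ?thesis using c unfolding a_def by blast
qed

section \<open>Large blow-ups from many tuples\<close>

text \<open>Lists rather than functions, because the induction on the dimension splits off the last
  entry.\<close>

definition tuples :: "nat \<Rightarrow> 'a set \<Rightarrow> 'a list set" where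
  "tuples k V = {xs. set xs \<subseteq> V \<and> length xs = k}"

text \<open>A blow-up encoded as a set of tuples: the \<open>a\<close>-th class consists of the
  \<open>a\<close>-th entries. The relation is required between entries of different tuples as well,
  and the second clause makes each class exactly as large as \<open>E\<close>.\<close>

definition crossing :: "(nat \<Rightarrow> nat \<Rightarrow> 'a \<Rightarrow> 'a \<Rightarrow> bool) \<Rightarrow> nat \<Rightarrow> 'a list set \<Rightarrow> bool" where
  "crossing Q k E \<longleftrightarrow>
     (\<forall>e\<in>E. \<forall>e'\<in>E. \<forall>a b. a < b \<longrightarrow> b < k \<longrightarrow> Q a b (e ! a) (e' ! b)) \<and>
     (\<forall>e\<in>E. \<forall>e'\<in>E. e \<noteq> e' \<longrightarrow> (\<forall>a<k. e ! a \<noteq> e' ! a))"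

lemma inj_on_map_upt: "inj_on (\<lambda>y. map y [0..<k]) ({..<k} \<rightarrow>\<^sub>E V)"
proof (rule inj_onI)
  fix y z assume yz: "y \<in> {..<k} \<rightarrow>\<^sub>E V" "z \<in> {..<k} \<rightarrow>\<^sub>E V" "map y [0..<k] = map z [0..<k]"
  show "y = z"
  proof (rule PiE_ext[OF yz(1,2)])
    fix i assume "i \<in> {..<k}"
    then show "y i = z i" using arg_cong[OF yz(3), of "\<lambda>l. l ! i"] by simp
  qed
qed

lemma crossing_subset: "crossing Q k E \<Longrightarrow> E' \<subseteq> E \<Longrightarrow> crossing Q k E'"
  unfolding crossing_def by blast

lemma crossing_distinct:
  "crossing Q k E \<Longrightarrow> e \<in> E \<Longrightarrow> e' \<in> E \<Longrightarrow> a < k \<Longrightarrow> e ! a = e' ! a \<Longrightarrow> e = e'"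
  unfolding crossing_def by blast

lemma crossing_rel:
  "crossing Q k E \<Longrightarrow> e \<in> E \<Longrightarrow> e' \<in> E \<Longrightarrow> a < b \<Longrightarrow> b < k \<Longrightarrow> Q a b (e ! a) (e' ! b)"
  unfolding crossing_def by blast

lemma finite_tuples: "finite V \<Longrightarrow> finite (tuples k V)"
  and card_tuples: "finite V \<Longrightarrow> card (tuples k V) = card V ^ k"
  by (simp_all add: tuples_def finite_lists_length_eq card_lists_length_eq)

text \<open>
  Pigeonhole on neighbourhoods: only the $2^m$ subsets of the $m$ tuples found in dimension \<open>k\<close> can
  occur, so the number of common extensions drops by a factor of just $2^m$.
\<close>

lemma crossing_extend:
  fixes n k m :: nat and c :: real
  assumes V: "finite V" "card V = n" "0 < n" and X: "X \<subseteq> tuples (Suc k) V" and c: "0 < c"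
    and dens: "c * real n ^ Suc k \<le> real (card X)"
    and IH: "\<And>X'. X' \<subseteq> tuples k V \<Longrightarrow> X' \<subseteq> {e. \<exists>v. e @ [v] \<in> X} \<Longrightarrow> c / 2 * real n ^ k \<le> real (card X') \<Longrightarrow>
               \<exists>E\<subseteq>X'. crossing Q k E \<and> card E = m"
  shows "\<exists>N T. N \<subseteq> tuples k V \<and> crossing Q k N \<and> T \<subseteq> V \<and> c / 4 * real m \<le> real (card N)
     \<and> c / 4 * real n / 2 ^ m \<le> real (card T) \<and> (\<forall>e\<in>N. \<forall>v\<in>T. e @ [v] \<in> X)"
proof -
  define ext where "ext e = {v \<in> V. e @ [v] \<in> X}" for e
  \<comment> \<open>Prefixes with at least half the average number of extensions. The others account
    for at most half of \<open>X\<close>, so enough of these remain for \<open>IH\<close>.\<close>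
  define X' where "X' = {e \<in> tuples k V. c / 2 * real n \<le> real (card (ext e))}"
  have finE: "finite (ext e)" "card (ext e) \<le> n" for e
    using V card_mono[of V "ext e"] by (auto simp: ext_def)
  have finT: "finite (tuples k V)" using V by (simp add: finite_tuples)
  have Xeq: "X = (\<lambda>(e, v). e @ [v]) ` (SIGMA e:tuples k V. ext e)"
  proof
    show "X \<subseteq> (\<lambda>(e, v). e @ [v]) ` (SIGMA e:tuples k V. ext e)"
    proof
      fix x assume x: "x \<in> X"
      then have "x \<in> tuples (Suc k) V" using X by auto
      then have "x \<noteq> []" "set x \<subseteq> V" "length x = Suc k" by (auto simp: tuples_def)
      then have "butlast x \<in> tuples k V" "last x \<in> ext (butlast x)" "x = butlast x @ [last x]"
        using x by (auto simp: tuples_def ext_def dest: in_set_butlastD)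
      then show "x \<in> (\<lambda>(e, v). e @ [v]) ` (SIGMA e:tuples k V. ext e)" by (auto simp: image_iff)
    qed
  qed (auto simp: ext_def)
  have "card X = card (SIGMA e:tuples k V. ext e)"
    by (subst Xeq, rule card_image) (auto simp: inj_on_def)
  also have "\<dots> = (\<Sum>e\<in>tuples k V. card (ext e))" using finT finE by (simp add: card_SigmaI)
  finally have cX: "real (card X) = (\<Sum>e\<in>tuples k V. real (card (ext e)))" by simp
  also have "\<dots> \<le> (\<Sum>e\<in>tuples k V. c / 2 * real n + (if e \<in> X' then real n else 0))"
    by (rule sum_mono) (use finE(2) c in \<open>auto simp: X'_def add_increasing\<close>)
  also have "\<dots> = c / 2 * real n ^ Suc k + real (card X') * real n"
    using finT V by (simp add: sum.distrib card_tuples sum.If_cases Int_def X'_def conj_commute)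
  finally have "c / 2 * real n ^ k * real n \<le> real (card X') * real n"
    using dens by (simp add: algebra_simps)
  then have X': "c / 2 * real n ^ k \<le> real (card X')" using V by simp
  have "X' \<subseteq> {e. \<exists>v. e @ [v] \<in> X}"
  proof
    fix e assume "e \<in> X'"
    then have "c / 2 * real n \<le> real (card (ext e))" by (simp add: X'_def)
    moreover have "0 < c / 2 * real n" using c V by simp
    ultimately have "0 < card (ext e)" by linarith
    then show "e \<in> {e. \<exists>v. e @ [v] \<in> X}" by (auto simp: card_gt_0_iff ext_def)
  qed
  with IH[OF _ _ X'] obtain E where E: "E \<subseteq> X'" "crossing Q k E" "card E = m"
    by (auto simp: X'_def)
  have fE: "finite E" using finT E(1) by (auto simp: X'_def intro: finite_subset)
  define nb where "nb v = {e \<in> E. e @ [v] \<in> X}" for v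
  have fnb: "finite (nb v)" "card (nb v) \<le> m" for v
    using fE E(3) card_mono[of E "nb v"] by (auto simp: nb_def)
  have "c / 2 * real n * real m \<le> (\<Sum>e\<in>E. real (card (ext e)))"
  proof -
    have "(\<Sum>e\<in>E. c / 2 * real n) \<le> (\<Sum>e\<in>E. real (card (ext e)))"
      by (rule sum_mono) (use E(1) in \<open>auto simp: X'_def\<close>)
    then show ?thesis using E(3) by (simp add: mult_ac)
  qed
  also have "\<dots> = (\<Sum>v\<in>V. real (card (nb v)))"
  proof -
    have "(\<Sum>e\<in>E. card (ext e)) = (\<Sum>e\<in>E. \<Sum>v\<in>V. if e @ [v] \<in> X then 1 else 0)"
      using V by (simp add: ext_def sum.If_cases Int_def)
    also have "\<dots> = (\<Sum>v\<in>V. \<Sum>e\<in>E. if e @ [v] \<in> X then 1 else 0)" by (rule sum.swap)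
    also have "\<dots> = (\<Sum>v\<in>V. card (nb v))" using fE by (simp add: nb_def sum.If_cases Int_def)
    finally show ?thesis by (simp flip: of_nat_sum)
  qed
  finally have s1: "c / 2 * real n * real m \<le> (\<Sum>v\<in>V. real (card (nb v)))" .
  define Vs where "Vs = {v \<in> V. c / 4 * real m \<le> real (card (nb v))}"
  have fVs: "finite Vs" using V by (simp add: Vs_def)
  have Vs: "c / 4 * real n \<le> real (card Vs)"
  proof (cases "m = 0")
    case True
    then have "Vs = V" by (simp add: Vs_def)
    \<comment> \<open>For \<open>m = 0\<close> every vertex belongs to \<open>Vs\<close>, and what
      is needed reduces to the fact that a density is at most 1.\<close>
    moreover have "c \<le> 1"
    proof -
      have "card X \<le> card (tuples (Suc k) V)" using X V by (intro card_mono finite_tuples)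
      then have "real (card X) \<le> real n ^ Suc k" using V by (simp only: card_tuples of_nat_power[symmetric] of_nat_le_iff)
      then have "c * real n ^ Suc k \<le> 1 * real n ^ Suc k" using dens by linarith
      then show ?thesis using V by (simp del: power_Suc)
    qed
    ultimately show ?thesis using V by (simp add: mult_left_le_one_le)
  next
    case False
    have "(\<Sum>v\<in>V. real (card (nb v))) \<le> (\<Sum>v\<in>V. c / 4 * real m + (if v \<in> Vs then real m else 0))"
      by (rule sum_mono) (use fnb(2) c in \<open>auto simp: Vs_def add_increasing\<close>)
    also have "\<dots> = real n * (c / 4 * real m) + real (card Vs) * real m"
      using V by (simp add: sum.distrib sum.If_cases Int_def Vs_def conj_commute)
    finally have "c / 4 * real n * real m \<le> real (card Vs) * real m"
      using s1 by (simp add: algebra_simps)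
    then show ?thesis using False by simp
  qed
  have "\<exists>S\<in>Pow E. real (card Vs) / 2 ^ m \<le> real (card {v \<in> Vs. nb v = S})"
  proof (rule ccontr)
    assume "\<not> ?thesis"
    then have lt: "real (card {v \<in> Vs. nb v = S}) < real (card Vs) / 2 ^ m" if "S \<in> Pow E" for S
      using that by (auto simp: not_le)
    have "nb v \<subseteq> E" for v by (auto simp: nb_def)
    then have "Vs = (\<Union>S\<in>Pow E. {v \<in> Vs. nb v = S})" by blast
    then have "card Vs = card (\<Union>S\<in>Pow E. {v \<in> Vs. nb v = S})" by (rule arg_cong)
    also have "\<dots> = (\<Sum>S\<in>Pow E. card {v \<in> Vs. nb v = S})"
      by (rule card_UN_disjoint) (use fVs fE in auto)
    finally have "real (card Vs) = (\<Sum>S\<in>Pow E. real (card {v \<in> Vs. nb v = S}))" by simp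
    also have "\<dots> < (\<Sum>S\<in>Pow E. real (card Vs) / 2 ^ m)"
      by (rule sum_strict_mono) (use fE lt in auto)
    also have "\<dots> = real (card Vs)" using fE E(3) by (simp add: card_Pow)
    finally show False by simp
  qed
  then obtain S where S: "S \<subseteq> E" "real (card Vs) / 2 ^ m \<le> real (card {v \<in> Vs. nb v = S})" by auto
  let ?T = "{v \<in> Vs. nb v = S}"
  have "c / 4 * real n / 2 ^ m \<le> real (card Vs) / 2 ^ m" using Vs by (rule divide_right_mono) simp
  with S have T: "c / 4 * real n / 2 ^ m \<le> real (card ?T)" by linarith
  moreover have "0 < c / 4 * real n / 2 ^ m" using c V by simp
  ultimately have "0 < card ?T" by linarith
  \<comment> \<open>Any member of \<open>?T\<close> has neighbourhood \<open>S\<close> and lies in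
    \<open>Vs\<close>, which is what bounds \<open>card S\<close> from below.\<close>
  then obtain v where v: "v \<in> ?T" by (auto simp: card_gt_0_iff)
  show ?thesis
  proof (intro exI conjI)
    show "S \<subseteq> tuples k V" using S(1) E(1) by (auto simp: X'_def)
    show "crossing Q k S" using E(2) S(1) by (rule crossing_subset)
    show "?T \<subseteq> V" by (auto simp: Vs_def)
    show "c / 4 * real m \<le> real (card S)" using v by (auto simp: Vs_def)
    show "\<forall>e\<in>S. \<forall>v\<in>?T. e @ [v] \<in> X" by (auto simp: nb_def)
  qed (use T in auto)
qed

text \<open>Every tuple \<open>e\<close> receives a new last entry \<open>g e\<close> of its own.
  The relation between \<open>e\<close> and the new entry of another tuple \<open>e'\<close> is read
  off the tuple \<open>e @ [g e']\<close>, which is in \<open>X\<close> because all elements of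
  \<open>T\<close> extend all elements of \<open>N\<close>.\<close>

lemma crossing_append:
  assumes N: "N \<subseteq> tuples k V" "crossing Q k N" and T: "finite N" "finite T" "m \<le> card N" "m \<le> card T"
    and ext: "\<And>e v. e \<in> N \<Longrightarrow> v \<in> T \<Longrightarrow> e @ [v] \<in> X"
    and X: "\<And>x a b. x \<in> X \<Longrightarrow> a < b \<Longrightarrow> b < Suc k \<Longrightarrow> Q a b (x ! a) (x ! b)"
  shows "\<exists>E\<subseteq>X. crossing Q (Suc k) E \<and> card E = m"
proof -
  obtain N' where N': "N' \<subseteq> N" "card N' = m" using T obtain_subset_with_card_n by metis
  have fN': "finite N'" using N' T finite_subset by auto
  obtain g where g: "inj_on g N'" "g ` N' \<subseteq> T"
    using T N' fN' card_le_inj[of N' T] by auto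
  have len: "length e = k" if "e \<in> N'" for e using that N' N by (auto simp: tuples_def)
  let ?E = "(\<lambda>e. e @ [g e]) ` N'"
  have "?E \<subseteq> X" using ext N' g by (auto simp: image_subset_iff subset_iff)
  moreover have "crossing Q (Suc k) ?E"
    unfolding crossing_def
  proof (intro conjI ballI allI impI)
    fix x y a b assume xy: "x \<in> ?E" "y \<in> ?E" and ab: "a < b" "b < Suc k"
    obtain e e' where e: "e \<in> N'" "x = e @ [g e]" "e' \<in> N'" "y = e' @ [g e']" using xy by auto
    show "Q a b (x ! a) (y ! b)"
    proof (cases "b = k")
      case True
      have "e @ [g e'] \<in> X" using e g N' ext by (auto simp: image_subset_iff subset_iff)
      from X[OF this ab] show ?thesis using e True ab len by (simp add: nth_append)
    next
      case False
      then have "b < k" using ab by simp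
      then have "Q a b (e ! a) (e' ! b)" using N(2) N' e ab unfolding crossing_def by blast
      then show ?thesis using e False ab len by (simp add: nth_append)
    qed
  next
    fix x y a assume xy: "x \<in> ?E" "y \<in> ?E" "x \<noteq> y" and a: "a < Suc k"
    obtain e e' where e: "e \<in> N'" "x = e @ [g e]" "e' \<in> N'" "y = e' @ [g e']" using xy by auto
    then have ne: "e \<noteq> e'" using xy by auto
    show "x ! a \<noteq> y ! a"
    proof (cases "a = k")
      case True
      then show ?thesis using e len ne g by (auto simp: nth_append inj_on_def)
    next
      case False
      then have "a < k" using a by simp
      then have "e ! a \<noteq> e' ! a" using N(2) N' e ne unfolding crossing_def by blast
      then show ?thesis using e \<open>a < k\<close> len by (simp add: nth_append)
    qed
  qed
  moreover have "card ?E = m" using N' by (subst card_image) (auto simp: inj_on_def)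
  ultimately show ?thesis by blast
qed

text \<open>Turns the pigeonhole loss \<open>2 ^ m\<close> at logarithmic \<open>m\<close> into a
  power of n.\<close>

lemma two_power_floor_ln:
  assumes "1 \<le> n" "0 \<le> \<alpha>"
  shows "2 ^ nat \<lfloor>\<alpha> * ln (real n)\<rfloor> \<le> real n powr (\<alpha> * ln 2)"
proof -
  have "0 \<le> \<alpha> * ln (real n)" using assms by simp
  then have m: "real (nat \<lfloor>\<alpha> * ln (real n)\<rfloor>) \<le> \<alpha> * ln (real n)" by linarith
  have "2 ^ nat \<lfloor>\<alpha> * ln (real n)\<rfloor> = (2::real) powr real (nat \<lfloor>\<alpha> * ln (real n)\<rfloor>)"
    by (simp add: powr_realpow)
  also have "\<dots> \<le> 2 powr (\<alpha> * ln (real n))" using m by (intro powr_mono) auto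
  also have "\<dots> = real n powr (\<alpha> * ln 2)" using assms by (simp add: powr_def mult_ac)
  finally show ?thesis .
qed

text \<open>The asymptotic form of \<open>crossing_extend\<close> at \<open>m\<close> of order
  \<open>\<alpha> * ln n\<close>. The common source of two uses: the induction on the dimension cuts
  \<open>T\<close> down to logarithmic size, the final step keeps it of size a power of n.\<close>

lemma many_tuples_extend:
  fixes c \<alpha> :: real
  assumes c: "0 < c" and \<alpha>: "0 < \<alpha>"
    and ev: "\<forall>\<^sub>F n in sequentially. \<forall>(V :: 'a set) X Q. finite V \<longrightarrow> card V = n \<longrightarrow>
     X \<subseteq> tuples k V \<longrightarrow> (\<forall>x\<in>X. \<forall>a b. a < b \<longrightarrow> b < k \<longrightarrow> Q a b (x ! a) (x ! b)) \<longrightarrow>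
     c / 2 * real n ^ k \<le> real (card X) \<longrightarrow>
     (\<exists>E\<subseteq>X. crossing Q k E \<and> card E = nat \<lfloor>\<alpha> * ln (real n)\<rfloor>)"
  shows "\<forall>\<^sub>F n in sequentially. \<forall>(V :: 'a set) X Q. finite V \<longrightarrow> card V = n \<longrightarrow>
     X \<subseteq> tuples (Suc k) V \<longrightarrow> (\<forall>x\<in>X. \<forall>a b. a < b \<longrightarrow> b < Suc k \<longrightarrow> Q a b (x ! a) (x ! b)) \<longrightarrow>
     c * real n ^ Suc k \<le> real (card X) \<longrightarrow>
     (\<exists>N T. N \<subseteq> tuples k V \<and> crossing Q k N \<and> T \<subseteq> V \<and>
        c / 8 * \<alpha> * ln (real n) \<le> real (card N) \<and>
        c / 4 * real n powr (1 - \<alpha> * ln 2) \<le> real (card T) \<and> (\<forall>e\<in>N. \<forall>v\<in>T. e @ [v] \<in> X))"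
proof -
  have e1: "\<forall>\<^sub>F n in sequentially. 2 \<le> \<alpha> * ln (real n)" using \<alpha> by real_asymp
  show ?thesis
    using ev e1 eventually_ge_at_top[of 1]
  proof eventually_elim
    case (elim n)
    show ?case
    proof (intro allI impI)
      fix V :: "'a set" and X Q
      assume V: "finite V" "card V = n" and X: "X \<subseteq> tuples (Suc k) V"
        and Q: "\<forall>x\<in>X. \<forall>a b. a < b \<longrightarrow> b < Suc k \<longrightarrow> Q a b (x ! a) (x ! b)"
        and dens: "c * real n ^ Suc k \<le> real (card X)"
      define m where "m = nat \<lfloor>\<alpha> * ln (real n)\<rfloor>"
      have "\<exists>N T. N \<subseteq> tuples k V \<and> crossing Q k N \<and> T \<subseteq> V \<and> c / 4 * real m \<le> real (card N)
          \<and> c / 4 * real n / 2 ^ m \<le> real (card T) \<and> (\<forall>e\<in>N. \<forall>v\<in>T. e @ [v] \<in> X)"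
      proof (rule crossing_extend[OF V _ X c dens])
        fix X' assume X': "X' \<subseteq> tuples k V" "X' \<subseteq> {e. \<exists>v. e @ [v] \<in> X}" "c / 2 * real n ^ k \<le> real (card X')"
        have "Q a b (x ! a) (x ! b)" if "x \<in> X'" "a < b" "b < k" for x a b
        proof -
          obtain v where "x @ [v] \<in> X" using X' \<open>x \<in> X'\<close> by auto
          moreover have "length x = k" using X' \<open>x \<in> X'\<close> by (auto simp: tuples_def)
          ultimately show ?thesis using Q[rule_format, of "x @ [v]" a b] that by (simp add: nth_append)
        qed
        then show "\<exists>E\<subseteq>X'. crossing Q k E \<and> card E = m"
          unfolding m_def by (intro elim(1)[rule_format, OF V X'(1) _ X'(3)]) auto
      qed (use elim in simp)
      then obtain N T where N: "N \<subseteq> tuples k V" "crossing Q k N" "T \<subseteq> V" "c / 4 * real m \<le> real (card N)"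
        "c / 4 * real n / 2 ^ m \<le> real (card T)" "\<forall>e\<in>N. \<forall>v\<in>T. e @ [v] \<in> X" by blast
      \<comment> \<open>Since \<open>\<alpha> * ln n\<close> is at least 2, rounding down loses at
        most a factor 2; hence 8 in place of 4.\<close>
      have "c / 8 * \<alpha> * ln (real n) = c / 4 * (\<alpha> * ln (real n) / 2)" by simp
      also have "\<dots> \<le> c / 4 * real m"
      proof (rule mult_left_mono)
        show "\<alpha> * ln (real n) / 2 \<le> real m" using elim(2) unfolding m_def by linarith
      qed (use c in simp)
      also have "\<dots> \<le> real (card N)" by (rule N(4))
      finally have N': "c / 8 * \<alpha> * ln (real n) \<le> real (card N)" .
      have "c / 4 * real n powr (1 - \<alpha> * ln 2) = c / 4 * real n / real n powr (\<alpha> * ln 2)"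
        using elim by (simp add: powr_diff)
      also have "\<dots> \<le> c / 4 * real n / 2 ^ m"
        using two_power_floor_ln[of n \<alpha>] elim \<alpha> c unfolding m_def
        by (intro divide_left_mono) auto
      also have "\<dots> \<le> real (card T)" by (rule N(5))
      finally have "c / 4 * real n powr (1 - \<alpha> * ln 2) \<le> real (card T)" .
      then show "\<exists>N T. N \<subseteq> tuples k V \<and> crossing Q k N \<and> T \<subseteq> V \<and>
        c / 8 * \<alpha> * ln (real n) \<le> real (card N) \<and>
        c / 4 * real n powr (1 - \<alpha> * ln 2) \<le> real (card T) \<and> (\<forall>e\<in>N. \<forall>v\<in>T. e @ [v] \<in> X)"
        using N N' by blast
    qed
  qed
qed

text \<open>Each new dimension halves the density and multiplies \<open>\<alpha>\<close> by
  \<open>c / 8\<close>, so the induction has to run over all \<open>c\<close>. The upper bound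
  \<open>d\<close> on \<open>\<alpha>\<close> lets the next step control the exponent
  \<open>1 - \<alpha> * ln 2\<close>.\<close>

lemma many_tuples_crossing:
  assumes "1 \<le> k" "0 < c" "c \<le> 1" "0 < d"
  shows "\<exists>\<alpha>>0. \<alpha> \<le> d \<and> (\<forall>\<^sub>F n in sequentially. \<forall>(V :: 'a set) X Q. finite V \<longrightarrow> card V = n \<longrightarrow>
     X \<subseteq> tuples k V \<longrightarrow> (\<forall>x\<in>X. \<forall>a b. a < b \<longrightarrow> b < k \<longrightarrow> Q a b (x ! a) (x ! b)) \<longrightarrow>
     c * real n ^ k \<le> real (card X) \<longrightarrow>
     (\<exists>E\<subseteq>X. crossing Q k E \<and> card E = nat \<lfloor>\<alpha> * ln (real n)\<rfloor>))"
  using assms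
proof (induction k arbitrary: c d rule: dec_induct)
  case base
  define \<alpha> where "\<alpha> = min c d"
  have \<alpha>: "0 < \<alpha>" "\<alpha> \<le> d" "\<alpha> \<le> c" using base by (auto simp: \<alpha>_def)
  have *: "\<exists>E\<subseteq>X. crossing Q 1 E \<and> card E = nat \<lfloor>\<alpha> * ln (real n)\<rfloor>"
    if n: "1 \<le> n" and V: "finite V" "card V = n" and X: "X \<subseteq> tuples 1 V" "c * real n ^ 1 \<le> real (card X)"
    for n :: nat and V :: "'a set" and X Q
  proof -
    have "ln (real n) \<le> real n" using n ln_le_minus_one[of "real n"] by simp
    then have "\<alpha> * ln (real n) \<le> c * real n" using \<alpha> base n by (intro mult_mono) auto
    also have "\<dots> \<le> real (card X)" using X by simp
    finally have "nat \<lfloor>\<alpha> * ln (real n)\<rfloor> \<le> card X" by linarith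
    then obtain E where E: "E \<subseteq> X" "card E = nat \<lfloor>\<alpha> * ln (real n)\<rfloor>" by (metis obtain_subset_with_card_n)
    have "crossing Q 1 E" unfolding crossing_def
    proof (intro conjI ballI allI impI)
      fix e e' and a :: nat assume e: "e \<in> E" "e' \<in> E" "e \<noteq> e'" "a < 1"
      then have "length e = 1" "length e' = 1" using X E by (auto simp: tuples_def)
      then show "e ! a \<noteq> e' ! a" using e by (auto simp: length_Suc_conv)
    qed auto
    then show ?thesis using E by blast
  qed
  have "\<forall>\<^sub>F n in sequentially. \<forall>(V :: 'a set) X Q. finite V \<longrightarrow> card V = n \<longrightarrow>
     X \<subseteq> tuples 1 V \<longrightarrow> (\<forall>x\<in>X. \<forall>a b. a < b \<longrightarrow> b < 1 \<longrightarrow> Q a b (x ! a) (x ! b)) \<longrightarrow>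
     c * real n ^ 1 \<le> real (card X) \<longrightarrow>
     (\<exists>E\<subseteq>X. crossing Q 1 E \<and> card E = nat \<lfloor>\<alpha> * ln (real n)\<rfloor>)"
    using eventually_ge_at_top[of 1]
  proof eventually_elim
    case (elim n)
    show ?case by (intro allI impI) (rule *[OF elim])
  qed
  then show ?case using \<alpha>(1,2) by blast
next
  case (step k)
  obtain \<alpha>0 where \<alpha>0: "0 < \<alpha>0" "\<alpha>0 \<le> min d (1/2)"
    and ev: "\<forall>\<^sub>F n in sequentially. \<forall>(V :: 'a set) X Q. finite V \<longrightarrow> card V = n \<longrightarrow>
     X \<subseteq> tuples k V \<longrightarrow> (\<forall>x\<in>X. \<forall>a b. a < b \<longrightarrow> b < k \<longrightarrow> Q a b (x ! a) (x ! b)) \<longrightarrow>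
     c / 2 * real n ^ k \<le> real (card X) \<longrightarrow>
     (\<exists>E\<subseteq>X. crossing Q k E \<and> card E = nat \<lfloor>\<alpha>0 * ln (real n)\<rfloor>)"
    using step.IH[of "c / 2" "min d (1/2)"] step.prems by auto
  define \<alpha> where "\<alpha> = c / 8 * \<alpha>0"
  have \<alpha>: "0 < \<alpha>" "\<alpha> \<le> d"
    using step.prems \<alpha>0 mult_mono[of "c / 8" 1 \<alpha>0 d] by (auto simp: \<alpha>_def)
  have c: "0 < c" using step.prems by simp
  \<comment> \<open>So at least a constant times the square root of n common extensions remain, more
    than the logarithmic number needed.\<close>
  have t: "\<alpha>0 * ln 2 \<le> 1 / 2"
    using \<alpha>0 mult_mono[of \<alpha>0 "1 / 2" "ln 2" 1] ln_2_less_1 by simp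
  have e: "\<forall>\<^sub>F n in sequentially. \<alpha> * ln (real n) \<le> c / 4 * real n powr (1 / 2)"
    using \<alpha>(1) c by real_asymp
  have "\<forall>\<^sub>F n in sequentially. \<forall>(V :: 'a set) X Q. finite V \<longrightarrow> card V = n \<longrightarrow>
     X \<subseteq> tuples (Suc k) V \<longrightarrow> (\<forall>x\<in>X. \<forall>a b. a < b \<longrightarrow> b < Suc k \<longrightarrow> Q a b (x ! a) (x ! b)) \<longrightarrow>
     c * real n ^ Suc k \<le> real (card X) \<longrightarrow>
     (\<exists>E\<subseteq>X. crossing Q (Suc k) E \<and> card E = nat \<lfloor>\<alpha> * ln (real n)\<rfloor>)"
    using many_tuples_extend[OF c \<alpha>0(1) ev] e eventually_ge_at_top[of 1]
  proof eventually_elim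
    case (elim n)
    show ?case
    proof (intro allI impI)
      fix V :: "'a set" and X Q
      assume V: "finite V" "card V = n" and X: "X \<subseteq> tuples (Suc k) V"
        and Q: "\<forall>x\<in>X. \<forall>a b. a < b \<longrightarrow> b < Suc k \<longrightarrow> Q a b (x ! a) (x ! b)"
        and dens: "c * real n ^ Suc k \<le> real (card X)"
      obtain N T where N: "N \<subseteq> tuples k V" "crossing Q k N" "T \<subseteq> V" "\<alpha> * ln (real n) \<le> real (card N)"
        "c / 4 * real n powr (1 - \<alpha>0 * ln 2) \<le> real (card T)" "\<forall>e\<in>N. \<forall>v\<in>T. e @ [v] \<in> X"
        using elim(1)[rule_format, OF V X _ dens, of Q] Q unfolding \<alpha>_def by blast
      have "c / 4 * real n powr (1 / 2) \<le> c / 4 * real n powr (1 - \<alpha>0 * ln 2)"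
        using t elim(3) c by (intro mult_left_mono powr_mono) auto
      then have mT: "nat \<lfloor>\<alpha> * ln (real n)\<rfloor> \<le> card T" using N(5) elim(2) by linarith
      have mN: "nat \<lfloor>\<alpha> * ln (real n)\<rfloor> \<le> card N" using N(4) by linarith
      show "\<exists>E\<subseteq>X. crossing Q (Suc k) E \<and> card E = nat \<lfloor>\<alpha> * ln (real n)\<rfloor>"
      proof (rule crossing_append[OF N(1,2) _ _ mN mT])
        show "finite N" using N(1) V finite_tuples finite_subset by blast
        show "finite T" using N(3) V finite_subset by blast
      qed (use N(6) Q in auto)
    qed
  qed
  then show ?case using \<alpha> by blast
qed

text \<open>The origin of the exponent \<open>1 - sqrt \<delta>\<close>. With
  \<open>\<delta> = c / 8 * \<alpha>0\<close> and \<open>\<alpha>0 \<le> c / 8\<close> one has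
  \<open>\<alpha>0 \<le> sqrt \<delta>\<close>, while the last class keeps about n to the power
  \<open>1 - \<alpha>0 * ln 2\<close>. As \<open>ln 2 < 1\<close>, the latter exponent is strictly
  larger than \<open>1 - \<alpha>0\<close>, which absorbs the factor \<open>c / 4\<close>.\<close>

lemma many_tuples_blowup:
  assumes "1 \<le> k" "0 < c" "c \<le> 1"
  shows "\<exists>\<delta>>0. \<forall>\<^sub>F n in sequentially. \<forall>(V :: 'a set) X Q. finite V \<longrightarrow> card V = n \<longrightarrow>
     X \<subseteq> tuples (Suc k) V \<longrightarrow> (\<forall>x\<in>X. \<forall>a b. a < b \<longrightarrow> b < Suc k \<longrightarrow> Q a b (x ! a) (x ! b)) \<longrightarrow>
     c * real n ^ Suc k \<le> real (card X) \<longrightarrow>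
     (\<exists>N T. N \<subseteq> tuples k V \<and> crossing Q k N \<and> T \<subseteq> V \<and> card N = nat \<lfloor>\<delta> * ln (real n)\<rfloor> \<and>
        card T = nat \<lceil>real n powr (1 - sqrt \<delta>)\<rceil> \<and> (\<forall>e\<in>N. \<forall>v\<in>T. e @ [v] \<in> X))"
proof -
  note c = assms(2)
  obtain \<alpha>0 where \<alpha>0: "0 < \<alpha>0" "\<alpha>0 \<le> c / 8"
    and ev: "\<forall>\<^sub>F n in sequentially. \<forall>(V :: 'a set) X Q. finite V \<longrightarrow> card V = n \<longrightarrow>
     X \<subseteq> tuples k V \<longrightarrow> (\<forall>x\<in>X. \<forall>a b. a < b \<longrightarrow> b < k \<longrightarrow> Q a b (x ! a) (x ! b)) \<longrightarrow>
     c / 2 * real n ^ k \<le> real (card X) \<longrightarrow>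
     (\<exists>E\<subseteq>X. crossing Q k E \<and> card E = nat \<lfloor>\<alpha>0 * ln (real n)\<rfloor>)"
    using many_tuples_crossing[of k "c / 2" "c / 8"] assms by auto
  define \<delta> where "\<delta> = c / 8 * \<alpha>0"
  have \<delta>: "0 < \<delta>" using c \<alpha>0 by (simp add: \<delta>_def)
  have "\<alpha>0 ^ 2 \<le> \<delta>" using \<alpha>0 by (simp add: \<delta>_def power2_eq_square)
  then have sq: "\<alpha>0 \<le> sqrt \<delta>" using real_le_rsqrt by blast
  define t where "t = \<alpha>0 * ln 2"
  have t: "0 < t" "t < \<alpha>0" using \<alpha>0 ln_2_less_1 by (auto simp: t_def)
  have \<alpha>1: "\<alpha>0 < 1" using \<alpha>0 assms by simp
  \<comment> \<open>The summand 1 pays for rounding up.\<close>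
  have e: "\<forall>\<^sub>F n in sequentially. real n powr (1 - \<alpha>0) + 1 \<le> c / 4 * real n powr (1 - t)"
    using \<alpha>1 t c by real_asymp
  have "\<forall>\<^sub>F n in sequentially. \<forall>(V :: 'a set) X Q. finite V \<longrightarrow> card V = n \<longrightarrow>
     X \<subseteq> tuples (Suc k) V \<longrightarrow> (\<forall>x\<in>X. \<forall>a b. a < b \<longrightarrow> b < Suc k \<longrightarrow> Q a b (x ! a) (x ! b)) \<longrightarrow>
     c * real n ^ Suc k \<le> real (card X) \<longrightarrow>
     (\<exists>N T. N \<subseteq> tuples k V \<and> crossing Q k N \<and> T \<subseteq> V \<and> card N = nat \<lfloor>\<delta> * ln (real n)\<rfloor> \<and>
        card T = nat \<lceil>real n powr (1 - sqrt \<delta>)\<rceil> \<and> (\<forall>e\<in>N. \<forall>v\<in>T. e @ [v] \<in> X))"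
    using many_tuples_extend[OF c \<alpha>0(1) ev] e eventually_ge_at_top[of 1]
  proof eventually_elim
    case (elim n)
    show ?case
    proof (intro allI impI)
      fix V :: "'a set" and X Q
      assume V: "finite V" "card V = n" and X: "X \<subseteq> tuples (Suc k) V"
        and Q: "\<forall>x\<in>X. \<forall>a b. a < b \<longrightarrow> b < Suc k \<longrightarrow> Q a b (x ! a) (x ! b)"
        and dens: "c * real n ^ Suc k \<le> real (card X)"
      obtain N T where N: "N \<subseteq> tuples k V" "crossing Q k N" "T \<subseteq> V" "\<delta> * ln (real n) \<le> real (card N)"
        "c / 4 * real n powr (1 - t) \<le> real (card T)" "\<forall>e\<in>N. \<forall>v\<in>T. e @ [v] \<in> X"
        using elim(1)[rule_format, OF V X _ dens, of Q] Q unfolding \<delta>_def t_def by blast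
      have mN: "nat \<lfloor>\<delta> * ln (real n)\<rfloor> \<le> card N" using N(4) by linarith
      have "real n powr (1 - sqrt \<delta>) \<le> real n powr (1 - \<alpha>0)" using elim(3) sq by (intro powr_mono) auto
      then have mT: "nat \<lceil>real n powr (1 - sqrt \<delta>)\<rceil> \<le> card T" using N(5) elim(2) by linarith
      obtain N' where N': "N' \<subseteq> N" "card N' = nat \<lfloor>\<delta> * ln (real n)\<rfloor>" using mN by (metis obtain_subset_with_card_n)
      obtain T' where T': "T' \<subseteq> T" "card T' = nat \<lceil>real n powr (1 - sqrt \<delta>)\<rceil>" using mT by (metis obtain_subset_with_card_n)
      have "crossing Q k N'" using N(2) N'(1) by (rule crossing_subset)
      then show "\<exists>N T. N \<subseteq> tuples k V \<and> crossing Q k N \<and> T \<subseteq> V \<and> card N = nat \<lfloor>\<delta> * ln (real n)\<rfloor> \<and>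
        card T = nat \<lceil>real n powr (1 - sqrt \<delta>)\<rceil> \<and> (\<forall>e\<in>N. \<forall>v\<in>T. e @ [v] \<in> X)"
        using N(1,3,6) N' T' by (intro exI[of _ N'] exI[of _ T']) blast
    qed
  qed
  then show ?thesis using \<delta> by blast
qed

section \<open>Turan, Erdos-Stone and Ramsey inside a sample\<close>

text \<open>Supersaturation yields many \<open>Suc r\<close>-cliques of free pairs,
  \<open>many_tuples_crossing\<close> turns them into classes of size about
  \<open>\<alpha> * ln k\<close> with only free pairs in between, and for large \<open>k\<close>
  this exceeds the Ramsey number of \<open>h\<close>. Inside a class nothing is known beforehand,
  hence the Ramsey step. Everything is phrased for indices below \<open>k\<close>, since it is
  applied to a sample.\<close>

lemma template_contains_blocks:
  assumes r: "1 \<le> r" and e: "0 < e"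
  shows "\<forall>\<^sub>F k in sequentially. \<forall>One Zero :: nat \<Rightarrow> nat \<Rightarrow> bool.
     (\<forall>i j. One i j \<longrightarrow> One j i) \<longrightarrow> (\<forall>i j. Zero i j \<longrightarrow> Zero j i) \<longrightarrow>
     (\<forall>i j. One i j \<or> Zero i j) \<longrightarrow>
     (1 - 1 / real r + e) * real k ^ 2 \<le> real (card {(i, j). i < k \<and> j < k \<and> i \<noteq> j \<and> One i j \<and> Zero i j}) \<longrightarrow>
     (\<exists>B. (\<forall>a<Suc r. B a \<subseteq> {..<k} \<and> card (B a) = h \<and>
              ((\<forall>i\<in>B a. \<forall>j\<in>B a. i \<noteq> j \<longrightarrow> One i j) \<or> (\<forall>i\<in>B a. \<forall>j\<in>B a. i \<noteq> j \<longrightarrow> Zero i j))) \<and>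
          (\<forall>a b. a < Suc r \<longrightarrow> b < Suc r \<longrightarrow> a \<noteq> b \<longrightarrow> 
              (\<forall>i\<in>B a. \<forall>j\<in>B b. i \<noteq> j \<and> One i j \<and> Zero i j)))"
proof -
  obtain c where c: "0 < c" "c \<le> 1" and sup: "\<And>(V :: nat set) R. finite V \<Longrightarrow>
     (\<forall>x\<in>V. \<forall>y\<in>V. R x y \<longrightarrow> R y x) \<Longrightarrow>
     (1 - 1 / real r + e) * real (card V) ^ 2 \<le> real (card {(x, y) \<in> V \<times> V. R x y}) \<Longrightarrow>
     c * real (card V) ^ Suc r
       \<le> real (card {y \<in> {..<Suc r} \<rightarrow>\<^sub>E V. \<forall>a b. a < b \<longrightarrow> b < Suc r \<longrightarrow> R (y a) (y b)})"
    using turan_supersaturation[OF r e, where 'a = nat] by blast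
  obtain \<alpha> where \<alpha>: "0 < \<alpha>" and ev: "\<forall>\<^sub>F n in sequentially. \<forall>(V :: nat set) X Q. finite V \<longrightarrow> card V = n \<longrightarrow>
     X \<subseteq> tuples (Suc r) V \<longrightarrow> (\<forall>x\<in>X. \<forall>a b. a < b \<longrightarrow> b < Suc r \<longrightarrow> Q a b (x ! a) (x ! b)) \<longrightarrow>
     c * real n ^ Suc r \<le> real (card X) \<longrightarrow>
     (\<exists>E\<subseteq>X. crossing Q (Suc r) E \<and> card E = nat \<lfloor>\<alpha> * ln (real n)\<rfloor>)"
    using many_tuples_crossing[of "Suc r" c 1] c by auto
  obtain M :: nat where M: "\<And>(V :: nat set) E. finite V \<Longrightarrow> M \<le> card V \<Longrightarrow>
      \<exists>R\<subseteq>V. card R = h \<and> clique R E \<or> card R = h \<and> indep R E"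
    using ramsey2[of h h, where 'a = nat] by metis
  have e1: "\<forall>\<^sub>F n in sequentially. real M \<le> \<alpha> * ln (real n)" using \<alpha> by real_asymp
  show ?thesis using ev e1
  proof eventually_elim
    case (elim k)
    show ?case
    proof (intro allI impI)
      fix One Zero :: "nat \<Rightarrow> nat \<Rightarrow> bool"
      assume s1: "\<forall>i j. One i j \<longrightarrow> One j i" and s2: "\<forall>i j. Zero i j \<longrightarrow> Zero j i"
        and or: "\<forall>i j. One i j \<or> Zero i j"
        and dens: "(1 - 1 / real r + e) * real k ^ 2 \<le> real (card {(i, j). i < k \<and> j < k \<and> i \<noteq> j \<and> One i j \<and> Zero i j})"
      define R where "R i j \<longleftrightarrow> i \<noteq> j \<and> One i j \<and> Zero i j" for i j
      define Y where "Y = {y \<in> {..<Suc r} \<rightarrow>\<^sub>E {..<k}. \<forall>a b. a < b \<longrightarrow> b < Suc r \<longrightarrow> R (y a) (y b)}"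
      have "{(i, j). i < k \<and> j < k \<and> i \<noteq> j \<and> One i j \<and> Zero i j} = {(i, j) \<in> {..<k} \<times> {..<k}. R i j}"
        by (auto simp: R_def)
      then have Y: "c * real k ^ Suc r \<le> real (card Y)"
        using sup[of "{..<k}" R] dens s1 s2 by (auto simp: R_def Y_def)
      define L where "L y = map y [0..<Suc r]" for y :: "nat \<Rightarrow> nat"
      have L_nth: "L y ! a = y a" if "a < Suc r" for y a using that by (simp add: L_def del: upt_Suc)
      have inj: "inj_on L Y"
        unfolding L_def Y_def by (rule inj_on_subset[OF inj_on_map_upt]) blast
      have LT: "L ` Y \<subseteq> tuples (Suc r) {..<k}" by (auto simp: tuples_def L_def Y_def PiE_iff)
      have LQ: "\<forall>x\<in>L ` Y. \<forall>a b. a < b \<longrightarrow> b < Suc r \<longrightarrow> R (x ! a) (x ! b)"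
        using L_nth by (auto simp: Y_def)
      have "\<exists>E\<subseteq>L ` Y. crossing (\<lambda>_ _. R) (Suc r) E \<and> card E = nat \<lfloor>\<alpha> * ln (real k)\<rfloor>"
        using elim(1)[rule_format, of "{..<k}" "L ` Y" "\<lambda>_ _. R"] LT LQ Y card_image[OF inj] by simp
      then obtain E where E: "E \<subseteq> L ` Y" "crossing (\<lambda>_ _. R) (Suc r) E" "card E = nat \<lfloor>\<alpha> * ln (real k)\<rfloor>" by blast
      have cE: "M \<le> card E" using E(3) elim(2) by linarith
      have fE: "finite E" using finite_subset[OF E(1)[THEN subset_trans[OF _ LT]]] by (simp add: finite_tuples)
      define G where "G a = (\<lambda>e. e ! a) ` E" for a
      have G: "finite (G a)" "M \<le> card (G a)" if "a < Suc r" for a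
      proof -
        have "inj_on (\<lambda>e. e ! a) E" using crossing_distinct[OF E(2) _ _ that] by (auto intro!: inj_onI)
        then show "finite (G a)" "M \<le> card (G a)" using cE fE by (auto simp: G_def card_image)
      qed
      have Gk: "G a \<subseteq> {..<k}" if "a < Suc r" for a
        using E(1) LT that by (fastforce simp: G_def tuples_def subset_iff)
      have "\<exists>B. a < Suc r \<longrightarrow> B \<subseteq> G a \<and> card B = h \<and>
          ((\<forall>i\<in>B. \<forall>j\<in>B. i \<noteq> j \<longrightarrow> One i j) \<or> (\<forall>i\<in>B. \<forall>j\<in>B. i \<noteq> j \<longrightarrow> Zero i j))" for a
      proof (cases "a < Suc r")
        case True
        \<comment> \<open>Ramsey is applied to the graph of \<open>One\<close>; a set independent in
          it is a \<open>Zero\<close> block, because every pair is \<open>One\<close> or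
          \<open>Zero\<close>.\<close>
        from M[OF G[OF True], of "{{i, j} |i j. One i j}"] obtain B where B: "B \<subseteq> G a" "card B = h"
          "clique B {{i, j} |i j. One i j} \<or> indep B {{i, j} |i j. One i j}" by blast
        have "{i, j} \<in> {{i, j} |i j. One i j} \<longleftrightarrow> One i j" for i j
          unfolding mem_Collect_eq doubleton_eq_iff using s1 by blast
        then have "(\<forall>i\<in>B. \<forall>j\<in>B. i \<noteq> j \<longrightarrow> One i j) \<or> (\<forall>i\<in>B. \<forall>j\<in>B. i \<noteq> j \<longrightarrow> \<not> One i j)"
          using B(3) unfolding clique_def indep_def by simp
        then show ?thesis using B(1,2) or by blast
      qed auto
      then obtain B where B: "\<And>a. a < Suc r \<Longrightarrow> B a \<subseteq> G a \<and> card (B a) = h \<and>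
          ((\<forall>i\<in>B a. \<forall>j\<in>B a. i \<noteq> j \<longrightarrow> One i j) \<or> (\<forall>i\<in>B a. \<forall>j\<in>B a. i \<noteq> j \<longrightarrow> Zero i j))"
        by metis
      have cross: "R i j" if ab: "a < b" "b < Suc r" and ij: "i \<in> B a" "j \<in> B b" for a b i j
      proof -
        have "i \<in> G a" "j \<in> G b" using B[of a] B[of b] ab ij by auto
        then show ?thesis using crossing_rel[OF E(2) _ _ ab] by (auto simp: G_def)
      qed
      have "i \<noteq> j \<and> One i j \<and> Zero i j" if "a < Suc r" "b < Suc r" "a \<noteq> b" "i \<in> B a" "j \<in> B b" for a b i j
      proof (cases "a < b")
        case True
        then show ?thesis using cross[of a b i j] that unfolding R_def by blast
      next
        case False
        then have "b < a" using that by simp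
        then show ?thesis using cross[of b a j i] that s1 s2 unfolding R_def by blast
      qed
      then show "\<exists>B. (\<forall>a<Suc r. B a \<subseteq> {..<k} \<and> card (B a) = h \<and>
              ((\<forall>i\<in>B a. \<forall>j\<in>B a. i \<noteq> j \<longrightarrow> One i j) \<or> (\<forall>i\<in>B a. \<forall>j\<in>B a. i \<noteq> j \<longrightarrow> Zero i j))) \<and>
          (\<forall>a b. a < Suc r \<longrightarrow> b < Suc r \<longrightarrow> a \<noteq> b \<longrightarrow> 
              (\<forall>i\<in>B a. \<forall>j\<in>B b. i \<noteq> j \<and> One i j \<and> Zero i j))"
        using B Gk by (intro exI[of _ B]) (meson subset_trans)
    qed
  qed
qed

section \<open>The coloring number\<close>

text \<open>Replaces digraph isomorphisms by embeddings, the form used below. The isomorphism runs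
  from the induced subgraph to H, so the embedding is its inverse.\<close>

lemma contains_induced_iff:
  fixes G :: "'a pair_pre_digraph" and H :: "'b pair_pre_digraph"
  assumes G: "pair_graph G" and H: "pair_graph H"
  shows "contains_induced G H \<longleftrightarrow>
    (\<exists>\<phi>. inj_on \<phi> (pverts H) \<and> \<phi> ` pverts H \<subseteq> pverts G \<and>
      (\<forall>u\<in>pverts H. \<forall>v\<in>pverts H. (\<phi> u, \<phi> v) \<in> parcs G \<longleftrightarrow> (u, v) \<in> parcs H))"
    (is "?L \<longleftrightarrow> ?R")
proof
  assume ?L
  then obtain F :: "'a pair_pre_digraph" and f
    where ind: "induced_subgraph (with_proj F) (with_proj G)"
      and iso: "pre_digraph.digraph_isomorphism (with_proj F) f" "with_proj H = app_iso f (with_proj F)"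
    unfolding contains_induced_def digraph_iso_def by blast
  define g where "g = iso_verts f"
  have F: "pverts F \<subseteq> pverts G" "parcs F = {e \<in> parcs G. fst e \<in> pverts F \<and> snd e \<in> pverts F}"
    using ind by (auto simp: induced_subgraph_def subgraph_def)
  have inj: "inj_on g (pverts F)"
    and arcs: "\<And>a. a \<in> parcs F \<Longrightarrow> g (fst a) = iso_tail f (iso_arcs f a) \<and> g (snd a) = iso_head f (iso_arcs f a)"
    using iso(1) unfolding pre_digraph.digraph_isomorphism_def g_def by auto
  have "verts (with_proj H) = verts (app_iso f (with_proj F))" "arcs (with_proj H) = arcs (app_iso f (with_proj F))"
    "tail (with_proj H) = tail (app_iso f (with_proj F))" "head (with_proj H) = head (app_iso f (with_proj F))"
    unfolding iso(2) by simp_all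
  then have Hv: "pverts H = g ` pverts F" and Ha: "parcs H = iso_arcs f ` parcs F"
    and ts: "iso_tail f = fst" "iso_head f = snd" by (simp_all add: g_def)
  have iso_arcs: "iso_arcs f a = (g (fst a), g (snd a))" if "a \<in> parcs F" for a
    using arcs[OF that] by (simp add: ts prod_eq_iff)
  define \<phi> where "\<phi> = the_inv_into (pverts F) g"
  have \<phi>: "\<phi> (g x) = x" if "x \<in> pverts F" for x
    unfolding \<phi>_def by (rule the_inv_into_f_f[OF inj that])
  have adj: "(x, y) \<in> parcs G \<longleftrightarrow> (g x, g y) \<in> parcs H" if xy: "x \<in> pverts F" "y \<in> pverts F" for x y
  proof
    assume "(x, y) \<in> parcs G"
    then have "(x, y) \<in> parcs F" using xy unfolding F(2) by simp
    then show "(g x, g y) \<in> parcs H" using iso_arcs[of "(x, y)"] unfolding Ha by (intro image_eqI[of _ _ "(x, y)"]) auto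
  next
    assume "(g x, g y) \<in> parcs H"
    then obtain a where a: "a \<in> parcs F" "(g x, g y) = iso_arcs f a" unfolding Ha by auto
    have "a \<in> parcs G" "fst a \<in> pverts F" "snd a \<in> pverts F" using a(1) unfolding F(2) by auto
    moreover have "g x = g (fst a)" "g y = g (snd a)" using a iso_arcs[OF a(1)] by auto
    ultimately have "x = fst a" "y = snd a" using inj xy by (auto dest: inj_onD)
    then show "(x, y) \<in> parcs G" using \<open>a \<in> parcs G\<close> by simp
  qed
  show ?R
  proof (intro exI[of _ \<phi>] conjI ballI)
    show "inj_on \<phi> (pverts H)" unfolding Hv by (auto simp: inj_on_def \<phi>)
    show "\<phi> ` pverts H \<subseteq> pverts G" unfolding Hv using F(1) by (auto simp: \<phi>)
    show "(\<phi> u, \<phi> v) \<in> parcs G \<longleftrightarrow> (u, v) \<in> parcs H" if "u \<in> pverts H" "v \<in> pverts H" for u v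
      using that adj unfolding Hv by (auto simp: \<phi>)
  qed
next
  assume ?R
  then obtain \<phi> where \<phi>: "inj_on \<phi> (pverts H)" "\<phi> ` pverts H \<subseteq> pverts G"
    "\<And>u v. u \<in> pverts H \<Longrightarrow> v \<in> pverts H \<Longrightarrow> (\<phi> u, \<phi> v) \<in> parcs G \<longleftrightarrow> (u, v) \<in> parcs H" by blast
  interpret G: pair_graph G by fact
  interpret H: pair_graph H by fact
  define F where "F = \<lparr>pverts = \<phi> ` pverts H, parcs = {e \<in> parcs G. fst e \<in> \<phi> ` pverts H \<and> snd e \<in> \<phi> ` pverts H}\<rparr>"
  have Fv: "pverts F = \<phi> ` pverts H" by (simp add: F_def)
  have Fa: "parcs F = {e \<in> parcs G. fst e \<in> \<phi> ` pverts H \<and> snd e \<in> \<phi> ` pverts H}" by (simp add: F_def)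
  have wfF: "wf_digraph (with_proj F)" by unfold_locales (auto simp: Fv Fa)
  have "induced_subgraph (with_proj F) (with_proj G)"
    unfolding induced_subgraph_def subgraph_def compatible_def
    using wfF G.wf_digraph_axioms \<phi>(2) by (auto simp: Fv Fa)
  moreover have "digraph_iso (with_proj F) (with_proj H)"
  proof -
    define \<psi> where "\<psi> = the_inv_into (pverts H) \<phi>"
    have \<psi>: "\<psi> (\<phi> u) = u" if "u \<in> pverts H" for u
      unfolding \<psi>_def by (rule the_inv_into_f_f[OF \<phi>(1) that])
    define f where "f = \<lparr>iso_verts = \<psi>, iso_arcs = map_prod \<psi> \<psi>, iso_head = snd, iso_tail = fst\<rparr>"
    have "parcs H = map_prod \<psi> \<psi> ` parcs F"
    proof
      show "parcs H \<subseteq> map_prod \<psi> \<psi> ` parcs F"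
      proof
        fix e assume e: "e \<in> parcs H"
        obtain u v where uv: "e = (u, v)" by (cases e)
        have V: "u \<in> pverts H" "v \<in> pverts H" using e H.wellformed' unfolding uv by blast+
        then have "(\<phi> u, \<phi> v) \<in> parcs F" using \<phi>(3) e unfolding uv Fa by simp
        moreover have "e = map_prod \<psi> \<psi> (\<phi> u, \<phi> v)" using V \<psi> by (simp add: uv)
        ultimately show "e \<in> map_prod \<psi> \<psi> ` parcs F" by (rule rev_image_eqI)
      qed
      show "map_prod \<psi> \<psi> ` parcs F \<subseteq> parcs H"
        using \<phi>(3) \<psi> unfolding Fa by auto
    qed
    moreover have "pverts H = \<psi> ` pverts F" unfolding Fv using \<psi> by force
    ultimately have "with_proj H = app_iso f (with_proj F)"
      unfolding with_proj_def app_iso_def f_def by simp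
    moreover have "pre_digraph.digraph_isomorphism (with_proj F) f"
      unfolding pre_digraph.digraph_isomorphism_def
    proof (intro conjI)
      have inj: "inj_on \<psi> (pverts F)" unfolding Fv by (auto simp: inj_on_def \<psi>)
      then show "inj_on (iso_verts f) (verts (with_proj F))" by (simp add: f_def)
      have "parcs F \<subseteq> pverts F \<times> pverts F" by (auto simp: Fa Fv)
      then show "inj_on (iso_arcs f) (arcs (with_proj F))"
        using inj by (simp add: f_def) (rule inj_on_subset[OF map_prod_inj_on[OF inj inj]])
    qed (auto simp: f_def wfF)
    ultimately show ?thesis unfolding digraph_iso_def by blast
  qed
  ultimately show ?L unfolding contains_induced_def by blast
qed

lemma contains_induced_refl: "pair_graph H \<Longrightarrow> contains_induced H H"
  by (subst contains_induced_iff) (auto intro!: exI[of _ id])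

text \<open>\<open>Max\<close> is informative only on a finite nonempty set. Finiteness: as soon as
  there are at least \<open>h\<close> parts, H itself belongs to every class of the family.
  Nonemptiness: if 1 did not qualify, H would be an induced subgraph of a complete and of an
  edgeless graph, impossible with two vertices.\<close>

lemma coloring_number_induced_free:
  fixes H :: "nat pair_pre_digraph"
  assumes H: "pair_graph H" "pverts H = {1..h}" "2 \<le> h"
  defines "r \<equiv> coloring_number (induced_free H)"
  shows "1 \<le> r" "\<exists>s\<le>r. clique_indep_class r s \<subseteq> induced_free H"
    "\<And>s. s \<le> Suc r \<Longrightarrow> \<not> clique_indep_class (Suc r) s \<subseteq> induced_free H"
proof -
  interpret H: pair_graph H by fact
  define S where "S = {r. \<exists>s\<le>r. clique_indep_class r s \<subseteq> induced_free H}"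
  have "r < h" if rS: "r \<in> S" for r
  proof (rule ccontr)
    assume hr: "\<not> r < h"
    obtain s where s: "s \<le> r" "clique_indep_class r s \<subseteq> induced_free H" using rS by (auto simp: S_def)
    \<comment> \<open>Singletons while H has vertices left, empty parts afterwards; both are cliques
      and independent sets at once, so the value of \<open>s\<close> is irrelevant.\<close>
    define V where "V i = {Suc i} \<inter> {1..h}" for i
    have "(\<Union>i<r. V i) = {1..h}"
    proof
      show "{1..h} \<subseteq> (\<Union>i<r. V i)"
      proof
        fix x assume "x \<in> {1..h}"
        then have "x \<in> V (x - 1)" "x - 1 < r" using hr by (auto simp: V_def)
        then show "x \<in> (\<Union>i<r. V i)" by blast
      qed
    qed (auto simp: V_def)
    moreover have "disjoint_family_on V {..<r}" by (auto simp: disjoint_family_on_def V_def)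
    moreover have "clique_in H (V i)" "independent_in H (V i)" for i
      using H.no_loops' by (auto simp: clique_in_def independent_in_def V_def)
    ultimately have "H \<in> clique_indep_class r s"
      unfolding clique_indep_class_def using H by blast
    then show False using s contains_induced_refl[OF H(1)] by (auto simp: induced_free_def)
  qed
  then have finS: "finite S" by (meson finite_nat_set_iff_bounded)
  have "1 \<in> S"
  proof (rule ccontr)
    assume "1 \<notin> S"
    then have n: "\<exists>G. G \<in> clique_indep_class 1 s \<and> contains_induced G H" if "s \<le> 1" for s
    proof -
      have "\<not> clique_indep_class 1 s \<subseteq> induced_free H" using that \<open>1 \<notin> S\<close> by (simp add: S_def)
      then obtain G where "G \<in> clique_indep_class 1 s" "G \<notin> induced_free H" by blast
      moreover from this have "pair_graph G" by (simp add: clique_indep_class_def)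
      ultimately show ?thesis by (auto simp: induced_free_def)
    qed
    \<comment> \<open>The case \<open>s = 1\<close> (cliques) forces the edge between 1 and 2, the
      case \<open>s = 0\<close> (edgeless graphs) excludes it.\<close>
    have V12: "1 \<in> pverts H" "2 \<in> pverts H" using H by auto
    have 1: "(1, 2) \<in> parcs H"
    proof -
      obtain G where G: "G \<in> clique_indep_class 1 1" "contains_induced G H" using n[of 1] by auto
      then have pg: "pair_graph G" and cl: "clique_in G (pverts G)" by (auto simp: clique_indep_class_def lessThan_Suc)
      from G(2) contains_induced_iff[OF pg H(1)] obtain \<phi> where \<phi>: "inj_on \<phi> (pverts H)" "\<phi> ` pverts H \<subseteq> pverts G"
        "\<forall>u\<in>pverts H. \<forall>v\<in>pverts H. (\<phi> u, \<phi> v) \<in> parcs G \<longleftrightarrow> (u, v) \<in> parcs H" by blast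
      have "\<phi> 1 \<noteq> \<phi> 2" using inj_onD[OF \<phi>(1) _ V12] by auto
      then have "(\<phi> 1, \<phi> 2) \<in> parcs G" using cl \<phi>(2) V12 unfolding clique_in_def by blast
      then show ?thesis using \<phi>(3) V12 by blast
    qed
    obtain G where G: "G \<in> clique_indep_class 1 0" "contains_induced G H" using n[of 0] by auto
    then have pg: "pair_graph G" and cl: "independent_in G (pverts G)" by (auto simp: clique_indep_class_def lessThan_Suc)
    from G(2) contains_induced_iff[OF pg H(1)] obtain \<phi> where \<phi>: "\<phi> ` pverts H \<subseteq> pverts G"
      "\<forall>u\<in>pverts H. \<forall>v\<in>pverts H. (\<phi> u, \<phi> v) \<in> parcs G \<longleftrightarrow> (u, v) \<in> parcs H" by blast
    have "(\<phi> 1, \<phi> 2) \<notin> parcs G" using cl \<phi>(1) V12 unfolding independent_in_def by blast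
    then show False using \<phi>(2) V12 1 by blast
  qed
  have r: "r = Max S" by (simp add: r_def coloring_number_def S_def)
  have "r \<in> S" unfolding r by (rule Max_in[OF finS]) (use \<open>1 \<in> S\<close> in auto)
  then show "\<exists>s\<le>r. clique_indep_class r s \<subseteq> induced_free H" by (simp add: S_def)
  show "1 \<le> r" unfolding r using finS \<open>1 \<in> S\<close> by (rule Max_ge)
  have "Suc r \<notin> S" using Max_ge[OF finS, of "Suc r"] unfolding r by auto
  then show "\<And>s. s \<le> Suc r \<Longrightarrow> \<not> clique_indep_class (Suc r) s \<subseteq> induced_free H" by (auto simp: S_def)
qed

text \<open>A member of the class that contains H hands its partition down to H along the embedding;
  \<open>\<kappa>\<close> is the resulting colouring.\<close>

lemma not_induced_free_split:
  fixes H :: "nat pair_pre_digraph"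
  assumes H: "pair_graph H" and n: "\<not> clique_indep_class t s \<subseteq> induced_free H"
  shows "\<exists>\<kappa>. (\<forall>u\<in>pverts H. \<kappa> u < t) \<and>
    (\<forall>u\<in>pverts H. \<forall>v\<in>pverts H. u \<noteq> v \<longrightarrow> \<kappa> u = \<kappa> v \<longrightarrow> ((u, v) \<in> parcs H \<longleftrightarrow> \<kappa> u < s))"
proof -
  obtain G where G: "G \<in> clique_indep_class t s" "contains_induced G H"
    using n by (auto simp: induced_free_def clique_indep_class_def)
  then obtain V where pg: "pair_graph G" and V: "disjoint_family_on V {..<t}" "(\<Union>i<t. V i) = pverts G"
    "\<forall>i<s. clique_in G (V i)" "\<forall>i\<in>{s..<t}. independent_in G (V i)"
    by (auto simp: clique_indep_class_def)
  from G(2) contains_induced_iff[OF pg H] obtain \<phi> where \<phi>: "inj_on \<phi> (pverts H)" "\<phi> ` pverts H \<subseteq> pverts G"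
    "\<forall>u\<in>pverts H. \<forall>v\<in>pverts H. (\<phi> u, \<phi> v) \<in> parcs G \<longleftrightarrow> (u, v) \<in> parcs H" by blast
  have "\<exists>i. i < t \<and> \<phi> u \<in> V i" if "u \<in> pverts H" for u
    using V(2) \<phi>(2) that by blast
  then obtain \<kappa> where \<kappa>: "\<And>u. u \<in> pverts H \<Longrightarrow> \<kappa> u < t \<and> \<phi> u \<in> V (\<kappa> u)" by metis
  have "(u, v) \<in> parcs H \<longleftrightarrow> \<kappa> u < s" if uv: "u \<in> pverts H" "v \<in> pverts H" "u \<noteq> v" "\<kappa> u = \<kappa> v" for u v
  proof -
    have ne: "\<phi> u \<noteq> \<phi> v" using \<phi>(1) uv by (auto dest: inj_onD)
    have mem: "\<phi> u \<in> V (\<kappa> u)" "\<phi> v \<in> V (\<kappa> u)" using \<kappa>[of u] \<kappa>[of v] uv by auto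
    have "(\<phi> u, \<phi> v) \<in> parcs G \<longleftrightarrow> \<kappa> u < s"
    proof (cases "\<kappa> u < s")
      case True
      then have "clique_in G (V (\<kappa> u))" using V(3) by blast
      then show ?thesis using True ne mem unfolding clique_in_def by blast
    next
      case False
      then have "independent_in G (V (\<kappa> u))" using V(4) \<kappa>[OF uv(1)] by auto
      then show ?thesis using False mem unfolding independent_in_def by blast
    qed
    then show ?thesis using \<phi>(3) uv by blast
  qed
  then show ?thesis using \<kappa> by (intro exI[of _ \<kappa>]) blast
qed

text \<open>How many of the \<open>Suc r\<close> blocks turn out compatible with cliques is decided
  by Ramsey's theorem and cannot be prescribed. This is why H must split into \<open>s\<close>
  cliques and \<open>Suc r - s\<close> independent sets for every \<open>s\<close>, which is what
  the maximality of the coloring number provides.\<close>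

lemma template_contains_pattern:
  fixes H :: "nat pair_pre_digraph"
  assumes H: "pair_graph H" "pverts H = {1..h}" and r: "1 \<le> r" and e: "0 < e"
    and n: "\<And>s. s \<le> Suc r \<Longrightarrow> \<not> clique_indep_class (Suc r) s \<subseteq> induced_free H"
  shows "\<forall>\<^sub>F k in sequentially. \<forall>One Zero :: nat \<Rightarrow> nat \<Rightarrow> bool.
     (\<forall>i j. One i j \<longrightarrow> One j i) \<longrightarrow> (\<forall>i j. Zero i j \<longrightarrow> Zero j i) \<longrightarrow>
     (\<forall>i j. One i j \<or> Zero i j) \<longrightarrow>
     (1 - 1 / real r + e) * real k ^ 2 \<le> real (card {(i, j). i < k \<and> j < k \<and> i \<noteq> j \<and> One i j \<and> Zero i j}) \<longrightarrow>
     (\<exists>\<phi>. \<phi> ` {..<h} \<subseteq> {..<k} \<and> inj_on \<phi> {..<h} \<and>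
        (\<forall>u<h. \<forall>v<h. u \<noteq> v \<longrightarrow>
          (if (Suc u, Suc v) \<in> parcs H then One (\<phi> u) (\<phi> v) else Zero (\<phi> u) (\<phi> v))))"
  using template_contains_blocks[OF r e, of h]
proof eventually_elim
  case (elim k)
  show ?case
  proof (intro allI impI)
    fix One Zero :: "nat \<Rightarrow> nat \<Rightarrow> bool"
    assume s1: "\<forall>i j. One i j \<longrightarrow> One j i" and s2: "\<forall>i j. Zero i j \<longrightarrow> Zero j i"
      and or: "\<forall>i j. One i j \<or> Zero i j"
      and dens: "(1 - 1 / real r + e) * real k ^ 2 \<le> real (card {(i, j). i < k \<and> j < k \<and> i \<noteq> j \<and> One i j \<and> Zero i j})"
    have "\<exists>B. (\<forall>a<Suc r. B a \<subseteq> {..<k} \<and> card (B a) = h \<and>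
              ((\<forall>i\<in>B a. \<forall>j\<in>B a. i \<noteq> j \<longrightarrow> One i j) \<or> (\<forall>i\<in>B a. \<forall>j\<in>B a. i \<noteq> j \<longrightarrow> Zero i j))) \<and>
          (\<forall>a b. a < Suc r \<longrightarrow> b < Suc r \<longrightarrow> a \<noteq> b \<longrightarrow>
              (\<forall>i\<in>B a. \<forall>j\<in>B b. i \<noteq> j \<and> One i j \<and> Zero i j))"
      by (rule elim[THEN spec, THEN spec, THEN mp, THEN mp, THEN mp, THEN mp, OF s1 s2 or dens])
    then obtain B where B0: "(\<forall>a<Suc r. B a \<subseteq> {..<k} \<and> card (B a) = h \<and>
              ((\<forall>i\<in>B a. \<forall>j\<in>B a. i \<noteq> j \<longrightarrow> One i j) \<or> (\<forall>i\<in>B a. \<forall>j\<in>B a. i \<noteq> j \<longrightarrow> Zero i j))) \<and>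
          (\<forall>a b. a < Suc r \<longrightarrow> b < Suc r \<longrightarrow> a \<noteq> b \<longrightarrow>
              (\<forall>i\<in>B a. \<forall>j\<in>B b. i \<noteq> j \<and> One i j \<and> Zero i j))"
      by (rule exE)
    have B: "B a \<subseteq> {..<k}" "card (B a) = h"
      "(\<forall>i\<in>B a. \<forall>j\<in>B a. i \<noteq> j \<longrightarrow> One i j) \<or> (\<forall>i\<in>B a. \<forall>j\<in>B a. i \<noteq> j \<longrightarrow> Zero i j)"
      if "a < Suc r" for a
      using conjunct1[OF B0] that by blast+
    have cross: "i \<noteq> j \<and> One i j \<and> Zero i j"
      if "a < Suc r" "b < Suc r" "a \<noteq> b" "i \<in> B a" "j \<in> B b" for a b i j
      using conjunct2[OF B0] that by blast
    define A where "A = {a. a < Suc r \<and> (\<forall>i\<in>B a. \<forall>j\<in>B a. i \<noteq> j \<longrightarrow> One i j)}"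
    have A: "A \<subseteq> {..<Suc r}" by (auto simp: A_def)
    define s where "s = card A"
    have s: "s \<le> Suc r" using card_mono[OF _ A] by (simp add: s_def)
    have finA: "finite A" using A finite_subset by blast
    obtain f where f: "bij_betw f {..<s} A"
      using finite_same_card_bij[of "{..<s}" A] finA by (auto simp: s_def)
    obtain g where g: "bij_betw g {s..<Suc r} ({..<Suc r} - A)"
      using finite_same_card_bij[of "{s..<Suc r}" "{..<Suc r} - A"] finA A
      by (auto simp: s_def card_Diff_subset)
    \<comment> \<open>Renumbers the blocks so that the clique blocks come first, as the colouring
      \<open>\<kappa>\<close> expects.\<close>
    define \<pi> where "\<pi> i = (if i < s then f i else g i)" for i
    have \<pi>lt: "\<pi> i < Suc r" if "i < Suc r" for i
      using bij_betwE[OF f] bij_betwE[OF g] A that by (auto simp: \<pi>_def)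
    have \<pi>A: "\<pi> i \<in> A \<longleftrightarrow> i < s" if "i < Suc r" for i
      using bij_betwE[OF f] bij_betwE[OF g] that by (auto simp: \<pi>_def)
    have \<pi>inj: "i = j" if "\<pi> i = \<pi> j" "i < Suc r" "j < Suc r" for i j
    proof -
      have ij: "i < s \<longleftrightarrow> j < s" using \<pi>A[OF that(2)] \<pi>A[OF that(3)] that(1) by simp
      show ?thesis
        using that ij bij_betw_imp_inj_on[OF f] bij_betw_imp_inj_on[OF g]
        by (cases "i < s") (auto simp: \<pi>_def dest: inj_onD)
    qed
    obtain \<kappa> where \<kappa>: "\<forall>u\<in>pverts H. \<kappa> u < Suc r"
      "\<forall>u\<in>pverts H. \<forall>v\<in>pverts H. u \<noteq> v \<longrightarrow> \<kappa> u = \<kappa> v \<longrightarrow> ((u, v) \<in> parcs H \<longleftrightarrow> \<kappa> u < s)"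
      using not_induced_free_split[OF H(1) n[OF s]] by blast
    have "\<exists>b. a < Suc r \<longrightarrow> bij_betw b {..<h} (B a)" for a
    proof (cases "a < Suc r")
      case True
      then have "finite (B a)" "card (B a) = h" using B[OF True] by (auto intro: finite_subset)
      then show ?thesis using finite_same_card_bij[of "{..<h}" "B a"] by auto
    qed auto
    then obtain b where b: "\<And>a. a < Suc r \<Longrightarrow> bij_betw (b a) {..<h} (B a)" by metis
    define bl where "bl u = \<pi> (\<kappa> (Suc u))" for u
    have bl: "bl u < Suc r" if "u < h" for u
      unfolding bl_def using \<kappa>(1) H(2) that by (intro \<pi>lt) auto
    \<comment> \<open>Every block has \<open>h\<close> elements, so vertex \<open>u\<close> simply
      takes the \<open>u\<close>-th one, whatever the sizes of the colour classes.\<close>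
    define \<phi> where "\<phi> u = b (bl u) u" for u
    have \<phi>B: "\<phi> u \<in> B (bl u)" if "u < h" for u
      unfolding \<phi>_def using bij_betwE[OF b[OF bl[OF that]]] that by auto
    have ne: "\<phi> u \<noteq> \<phi> v" if uv: "u < h" "v < h" "u \<noteq> v" for u v
    proof (cases "bl u = bl v")
      case True
      then show ?thesis unfolding \<phi>_def
        using inj_onD[OF bij_betw_imp_inj_on[OF b[OF bl[OF uv(1)]]], of u v] uv by auto
    next
      case False
      then show ?thesis using cross[OF bl bl False \<phi>B \<phi>B] uv by blast
    qed
    have "if (Suc u, Suc v) \<in> parcs H then One (\<phi> u) (\<phi> v) else Zero (\<phi> u) (\<phi> v)"
      if uv: "u < h" "v < h" "u \<noteq> v" for u v
    proof (cases "bl u = bl v")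
      case False
      then show ?thesis using cross[OF bl bl False \<phi>B \<phi>B] uv by simp
    next
      case True
      have V: "Suc u \<in> pverts H" "Suc v \<in> pverts H" using uv H(2) by auto
      have lt: "\<kappa> (Suc u) < Suc r" "\<kappa> (Suc v) < Suc r" using \<kappa>(1) V by auto
      have "\<kappa> (Suc u) = \<kappa> (Suc v)" using \<pi>inj[OF _ lt] True by (simp add: bl_def)
      then have "(Suc u, Suc v) \<in> parcs H \<longleftrightarrow> \<kappa> (Suc u) < s" using \<kappa>(2) V uv by auto
      also have "\<dots> \<longleftrightarrow> bl u \<in> A" using \<pi>A[OF lt(1)] by (simp add: bl_def)
      finally have edge: "(Suc u, Suc v) \<in> parcs H \<longleftrightarrow> bl u \<in> A" .
      have mem: "\<phi> u \<in> B (bl u)" "\<phi> v \<in> B (bl u)" "\<phi> u \<noteq> \<phi> v" using \<phi>B[OF uv(1)] \<phi>B[OF uv(2)] True ne[OF uv] by simp_all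
      show ?thesis
      proof (cases "bl u \<in> A")
        case True
        then show ?thesis using edge mem unfolding A_def by auto
      next
        case False
        then have "\<forall>i\<in>B (bl u). \<forall>j\<in>B (bl u). i \<noteq> j \<longrightarrow> Zero i j"
          using B(3)[OF bl[OF uv(1)]] bl[OF uv(1)] unfolding A_def by blast
        then show ?thesis using edge mem False by auto
      qed
    qed
    moreover have "inj_on \<phi> {..<h}" using ne by (auto simp: inj_on_def)
    moreover have "\<phi> ` {..<h} \<subseteq> {..<k}" using \<phi>B B(1) bl by blast
    ultimately show "\<exists>\<phi>. \<phi> ` {..<h} \<subseteq> {..<k} \<and> inj_on \<phi> {..<h} \<and>
        (\<forall>u<h. \<forall>v<h. u \<noteq> v \<longrightarrow>
          (if (Suc u, Suc v) \<in> parcs H then One (\<phi> u) (\<phi> v) else Zero (\<phi> u) (\<phi> v)))" by blast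
  qed
qed

section \<open>Type-free graphs and induced freeness\<close>

lemma finite_type_free_graphs: "finite (type_free_graphs n H p q)"
proof (rule finite_imageD)
  have "parcs G \<subseteq> {1..n} \<times> {1..n}" if "G \<in> type_free_graphs n H p q" for G
  proof -
    interpret pair_graph G using that by (simp add: type_free_graphs_def)
    have "pverts G = {1..n}" using that by (simp add: type_free_graphs_def)
    then show ?thesis using wellformed' by auto
  qed
  then have "parcs ` type_free_graphs n H p q \<subseteq> Pow ({1..n} \<times> {1..n})" by blast
  then show "finite (parcs ` type_free_graphs n H p q)" by (rule finite_subset) simp
  show "inj_on parcs (type_free_graphs n H p q)"
    by (rule inj_onI) (auto simp: type_free_graphs_def intro: pair_pre_digraph.equality)
qed

text \<open>With both part sizes positive, one vertex from each part of a blow-up of H spans an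
  induced copy of H.\<close>

lemma type_free_of_induced_free:
  fixes H :: "nat pair_pre_digraph"
  assumes H: "pair_graph H" and G: "pair_graph G" "pverts G = {1..n}" "G \<in> induced_free H"
    and pq: "1 \<le> p" "1 \<le> q"
  shows "G \<in> type_free_graphs n H p q"
proof (rule ccontr)
  assume "G \<notin> type_free_graphs n H p q"
  then obtain F :: "nat pair_pre_digraph" where ind: "induced_subgraph (with_proj F) (with_proj G)"
    and ty: "of_type H (\<lambda>u. if u = card (pverts H) then q else p) F"
    using G by (auto simp: type_free_graphs_def)
  interpret G: pair_graph G by fact
  interpret H: pair_graph H by fact
  have F: "pverts F \<subseteq> pverts G" "parcs F = {e \<in> parcs G. fst e \<in> pverts F \<and> snd e \<in> pverts F}"
    using ind by (auto simp: induced_subgraph_def subgraph_def)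
  obtain W where W: "disjoint_family_on W (pverts H)" "(\<Union>u\<in>pverts H. W u) = pverts F"
    "\<forall>u\<in>pverts H. card (W u) = (if u = card (pverts H) then q else p)"
    "\<forall>u\<in>pverts H. \<forall>v\<in>pverts H. u \<noteq> v \<longrightarrow> (\<forall>x\<in>W u. \<forall>y\<in>W v. (x, y) \<in> parcs F \<longleftrightarrow> (u, v) \<in> parcs H)"
    using ty unfolding of_type_def by blast
  have "W u \<noteq> {}" if "u \<in> pverts H" for u
  proof
    assume "W u = {}"
    then have "card (W u) = 0" by simp
    then show False using W(3) that pq by (auto split: if_splits)
  qed
  then have \<phi>: "(SOME x. x \<in> W u) \<in> W u" if "u \<in> pverts H" for u
    using that by (simp add: some_in_eq)
  define \<phi> where "\<phi> u = (SOME x. x \<in> W u)" for u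
  note \<phi> = \<phi>[folded \<phi>_def]
  have \<phi>F: "\<phi> u \<in> pverts F" if "u \<in> pverts H" for u using \<phi> W(2) that by blast
  have "inj_on \<phi> (pverts H)"
  proof (rule inj_onI, rule ccontr)
    fix u v assume uv: "u \<in> pverts H" "v \<in> pverts H" "\<phi> u = \<phi> v" "u \<noteq> v"
    then have "W u \<inter> W v = {}" using W(1) by (auto simp: disjoint_family_on_def)
    then show False using \<phi>[OF uv(1)] \<phi>[OF uv(2)] uv(3) by auto
  qed
  moreover have "\<phi> ` pverts H \<subseteq> pverts G" using \<phi>F F(1) by blast
  moreover have "(\<phi> u, \<phi> v) \<in> parcs G \<longleftrightarrow> (u, v) \<in> parcs H" if uv: "u \<in> pverts H" "v \<in> pverts H" for u v
  proof (cases "u = v")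
    case True then show ?thesis using G.no_loops' H.no_loops' by blast
  next
    case False
    have "(\<phi> u, \<phi> v) \<in> parcs F \<longleftrightarrow> (u, v) \<in> parcs H"
      by (rule W(4)[rule_format, OF uv False \<phi>[OF uv(1)] \<phi>[OF uv(2)]])
    then show ?thesis using F(2) \<phi>F uv by auto
  qed
  ultimately have "contains_induced G H" using contains_induced_iff[OF G(1) H] by blast
  then show False using G(3) by (simp add: induced_free_def)
qed

section \<open>The lower bound\<close>

text \<open>The lower bound of the theorem has no error term, so the parts must be balanced well
  enough for every n. For residue classes this is visible vertex by vertex: at most
  \<open>(y - 1) div r\<close> smaller numbers are congruent to \<open>y\<close>.\<close>

lemma card_same_residue_pairs:
  assumes r: "1 \<le> r"
  shows "real (card {(x, y). 1 \<le> x \<and> x < y \<and> y \<le> n \<and> x mod r = y mod r}) \<le> real (n choose 2) / real r"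
proof -
  have one: "card {x. 1 \<le> x \<and> x < y \<and> x mod r = y mod r} \<le> (y - 1) div r" for y :: nat
  proof -
    let ?A = "{x. 1 \<le> x \<and> x < y \<and> x mod r = y mod r}"
    have eq: "(y - x) div r * r = y - x" if "x \<in> ?A" for x
    proof -
      have "r dvd y - x" using that mod_eq_dvd_iff_nat[of x y r] by auto
      then show ?thesis by simp
    qed
    have "inj_on (\<lambda>x. (y - x) div r) ?A"
    proof (rule inj_onI)
      fix x x' assume x: "x \<in> ?A" "x' \<in> ?A" "(y - x) div r = (y - x') div r"
      then have "y - x = y - x'" using eq by metis
      then show "x = x'" using x by auto
    qed
    moreover have "(\<lambda>x. (y - x) div r) ` ?A \<subseteq> {1..(y - 1) div r}"
    proof (rule image_subsetI)
      fix x assume x: "x \<in> ?A"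
      have "(y - x) div r \<le> (y - 1) div r" using x by (intro div_le_mono) auto
      moreover have "(y - x) div r \<noteq> 0" using eq[OF x] x by (intro notI) simp
      ultimately show "(y - x) div r \<in> {1..(y - 1) div r}" by simp
    qed
    ultimately show ?thesis using card_inj_on_le[of _ ?A "{1..(y - 1) div r}"] by simp
  qed
  have "{(x, y). 1 \<le> x \<and> x < y \<and> y \<le> n \<and> x mod r = y mod r}
      = (\<lambda>(y, x). (x, y)) ` (SIGMA y:{1..n}. {x. 1 \<le> x \<and> x < y \<and> x mod r = y mod r})"
    by (auto simp: image_iff)
  then have "card {(x, y). 1 \<le> x \<and> x < y \<and> y \<le> n \<and> x mod r = y mod r}
      = card (SIGMA y:{1..n}. {x. 1 \<le> x \<and> x < y \<and> x mod r = y mod r})"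
    by (simp only:) (rule card_image, auto simp: inj_on_def)
  also have "\<dots> = (\<Sum>y=1..n. card {x. 1 \<le> x \<and> x < y \<and> x mod r = y mod r})" by (rule card_SigmaI) auto
  finally have "real (card {(x, y). 1 \<le> x \<and> x < y \<and> y \<le> n \<and> x mod r = y mod r})
      = (\<Sum>y=1..n. real (card {x. 1 \<le> x \<and> x < y \<and> x mod r = y mod r}))" by simp
  also have "\<dots> \<le> (\<Sum>y=1..n. (real y - 1) / real r)"
  proof (rule sum_mono)
    fix y assume "y \<in> {1..n}"
    have "real (card {x. 1 \<le> x \<and> x < y \<and> x mod r = y mod r}) \<le> real ((y - 1) div r)" using one by simp
    also have "\<dots> \<le> real (y - 1) / real r" by (rule of_nat_div_le_of_nat)
    finally show "real (card {x. 1 \<le> x \<and> x < y \<and> x mod r = y mod r}) \<le> (real y - 1) / real r"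
      using \<open>y \<in> {1..n}\<close> by (simp add: of_nat_diff)
  qed
  also have "\<dots> = (\<Sum>y=1..n. real y - 1) / real r" by (rule sum_divide_distrib[symmetric])
  also have "(\<Sum>y=1..n. real y - 1) = real (n choose 2)"
  proof (induction n)
    case (Suc n)
    then show ?case by (simp add: numeral_2_eq_2)
  qed simp
  finally show ?thesis .
qed

lemma card_pairs_less: "card {(x, y). 1 \<le> x \<and> x < y \<and> y \<le> n} = n choose 2"
proof -
  have "{(x, y). 1 \<le> x \<and> x < y \<and> y \<le> n} = (\<lambda>(y, x). (x, y)) ` (SIGMA y:{1..n}. {1..<y})"
    by (auto simp: image_iff)
  then have "card {(x, y). 1 \<le> x \<and> x < y \<and> y \<le> n} = card (SIGMA y:{1..n}. {1..<y})"
    by (simp only:) (rule card_image, auto simp: inj_on_def)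
  also have "\<dots> = (\<Sum>y=1..n. y - 1)" by (subst card_SigmaI) auto
  also have "\<dots> = n choose 2" by (induction n) (auto simp: numeral_2_eq_2)
  finally show ?thesis .
qed

lemma type_free_graphs_lower:
  fixes H :: "nat pair_pre_digraph"
  assumes H: "pair_graph H" and r: "1 \<le> r" and s: "s \<le> r" "clique_indep_class r s \<subseteq> induced_free H"
    and pq: "1 \<le> p" "1 \<le> q"
  shows "(1 - 1 / real r) * real (n choose 2) \<le> log 2 (real (card (type_free_graphs n H p q)))"
proof -
  define All where "All = {(x, y). 1 \<le> x \<and> x < y \<and> y \<le> n}"
  define Same where "Same = {(x, y). 1 \<le> x \<and> x < y \<and> y \<le> n \<and> x mod r = y mod r}"
  define C where "C = {(x, y). 1 \<le> x \<and> x < y \<and> y \<le> n \<and> x mod r \<noteq> y mod r}"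
  have finAll: "finite All" by (rule finite_subset[of _ "{1..n} \<times> {1..n}"]) (auto simp: All_def)
  have sub: "Same \<subseteq> All" "C \<subseteq> All" "C = All - Same" by (auto simp: All_def Same_def C_def)
  have finC: "finite C" using sub finAll finite_subset by blast
  have "real (card C) = real (n choose 2) - real (card Same)"
    unfolding sub(3) using sub(1) finAll card_pairs_less[of n] card_mono[OF finAll sub(1)]
    by (subst card_Diff_subset) (auto simp: of_nat_diff All_def intro: finite_subset)
  then have cC: "(1 - 1 / real r) * real (n choose 2) \<le> real (card C)"
    using card_same_residue_pairs[OF r, of n] by (simp add: Same_def algebra_simps)
  define gr where "gr S = \<lparr>pverts = {1..n}, parcs = {(x, y). x \<in> {1..n} \<and> y \<in> {1..n} \<and> x \<noteq> y \<and>
     (if x mod r = y mod r then x mod r < s else (x, y) \<in> S \<or> (y, x) \<in> S)}\<rparr>" for S :: "(nat \<times> nat) set"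
  have gr: "gr S \<in> type_free_graphs n H p q" for S
  proof -
    have fin: "finite (parcs (gr S))"
      by (rule finite_subset[of _ "{1..n} \<times> {1..n}"]) (auto simp: gr_def)
    have "(y, x) \<in> parcs (gr S)" if "(x, y) \<in> parcs (gr S)" for x y
      using that by (cases "x mod r = y mod r") (auto simp: gr_def)
    then have "symmetric (with_proj (gr S))" unfolding symmetric_def by (auto intro: symI)
    then have pg: "pair_graph (gr S)"
      by unfold_locales (use fin in \<open>auto simp: gr_def\<close>)
    have "gr S \<in> clique_indep_class r s"
      unfolding clique_indep_class_def
    proof (intro CollectI conjI exI[of _ "\<lambda>i. {x \<in> {1..n}. x mod r = i}"] pg)
      show "disjoint_family_on (\<lambda>i. {x \<in> {1..n}. x mod r = i}) {..<r}" by (auto simp: disjoint_family_on_def)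
      show "(\<Union>i<r. {x \<in> {1..n}. x mod r = i}) = pverts (gr S)" using r by (auto simp: gr_def)
      show "\<forall>i<s. clique_in (gr S) {x \<in> {1..n}. x mod r = i}" by (auto simp: clique_in_def gr_def)
      show "\<forall>i\<in>{s..<r}. independent_in (gr S) {x \<in> {1..n}. x mod r = i}" by (auto simp: independent_in_def gr_def)
    qed
    then have "gr S \<in> induced_free H" using s by blast
    then show ?thesis by (intro type_free_of_induced_free[OF H pg _ _ pq]) (simp_all add: gr_def)
  qed
  \<comment> \<open>\<open>C\<close> holds each pair in one order only, so the symmetrised graph
    determines \<open>S\<close>.\<close>
  have rec: "S = {(x, y) \<in> C. (x, y) \<in> parcs (gr S)}" if "S \<subseteq> C" for S
  proof -
    have "(x, y) \<in> S \<longleftrightarrow> (x, y) \<in> parcs (gr S)" if xy: "(x, y) \<in> C" for x y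
    proof -
      have "(y, x) \<notin> S" using \<open>S \<subseteq> C\<close> xy by (auto simp: C_def)
      then show ?thesis using xy by (auto simp: gr_def C_def)
    qed
    then show ?thesis using that by auto
  qed
  have inj: "inj_on gr (Pow C)"
  proof (rule inj_onI)
    fix S S' assume S: "S \<in> Pow C" "S' \<in> Pow C" "gr S = gr S'"
    have "S = {(x, y) \<in> C. (x, y) \<in> parcs (gr S)}" using S(1) by (intro rec) simp
    also have "\<dots> = S'" unfolding S(3) using S(2) by (intro rec[symmetric]) simp
    finally show "S = S'" .
  qed
  have "card (Pow C) \<le> card (type_free_graphs n H p q)"
    by (rule card_inj_on_le[OF inj _ finite_type_free_graphs]) (use gr in blast)
  then have "real (2 ^ card C) \<le> real (card (type_free_graphs n H p q))"
    unfolding card_Pow[OF finC] by (rule of_nat_mono)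
  then have le: "(2::real) ^ card C \<le> real (card (type_free_graphs n H p q))" by simp
  have "real (card C) = log 2 (2 ^ card C)" by (simp add: log_nat_power)
  also have "\<dots> \<le> log 2 (real (card (type_free_graphs n H p q)))"
    using le by (subst log_le_cancel_iff) (auto intro: less_le_trans[of 0 "2 ^ card C"])
  finally show ?thesis using cC by linarith
qed

section \<open>Weak regularity\<close>

text \<open>The conditional expectation of \<open>f\<close> given the label \<open>l\<close> on the
  uniform space \<open>\<Omega>\<close>. With labels in place of partitions, refinement is a
  factorisation of \<open>l\<close>. For a label that does not occur in \<open>\<Omega>\<close> the
  value is 0 by division by zero.\<close>

definition fibre_avg :: "'a set \<Rightarrow> ('a \<Rightarrow> 'l) \<Rightarrow> ('a \<Rightarrow> real) \<Rightarrow> 'a \<Rightarrow> real" where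
  "fibre_avg \<Omega> l f w = (\<Sum>w'\<in>{w'\<in>\<Omega>. l w' = l w}. f w') / real (card {w'\<in>\<Omega>. l w' = l w})"

lemma fibre_avg_cong: "l w = l w' \<Longrightarrow> fibre_avg \<Omega> l f w = fibre_avg \<Omega> l f w'"
  by (simp add: fibre_avg_def)

text \<open>The defining property of a conditional expectation, tested against functions
  \<open>g\<close> of the label.\<close>

lemma sum_fibre_avg:
  assumes fin: "finite \<Omega>" and g: "\<And>w w'. w \<in> \<Omega> \<Longrightarrow> w' \<in> \<Omega> \<Longrightarrow> l w = l w' \<Longrightarrow> g w = g w'"
  shows "(\<Sum>w\<in>\<Omega>. fibre_avg \<Omega> l f w * g w) = (\<Sum>w\<in>\<Omega>. f w * g w)"
proof -
  have "(\<Sum>w\<in>\<Omega>. fibre_avg \<Omega> l f w * g w)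
      = (\<Sum>z\<in>l ` \<Omega>. \<Sum>w\<in>{w\<in>\<Omega>. l w = z}. fibre_avg \<Omega> l f w * g w)"
    by (rule sum.image_gen[OF fin])
  also have "\<dots> = (\<Sum>z\<in>l ` \<Omega>. \<Sum>w\<in>{w\<in>\<Omega>. l w = z}. f w * g w)"
  proof (rule sum.cong[OF refl])
    fix z assume "z \<in> l ` \<Omega>"
    then obtain w0 where w0: "w0 \<in> \<Omega>" "l w0 = z" by auto
    let ?F = "{w\<in>\<Omega>. l w = z}"
    have "card ?F \<noteq> 0" using fin w0 by auto
    have "(\<Sum>w\<in>?F. fibre_avg \<Omega> l f w * g w) = (\<Sum>w\<in>?F. (\<Sum>w'\<in>?F. f w') / real (card ?F) * g w0)"
    proof (rule sum.cong[OF refl])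
      fix w assume w: "w \<in> ?F"
      then have "g w = g w0" using g[of w w0] w0 by auto
      then show "fibre_avg \<Omega> l f w * g w = (\<Sum>w'\<in>?F. f w') / real (card ?F) * g w0"
        using w by (simp add: fibre_avg_def)
    qed
    also have "\<dots> = (\<Sum>w'\<in>?F. f w') * g w0" using \<open>card ?F \<noteq> 0\<close> by simp
    also have "\<dots> = (\<Sum>w'\<in>?F. f w' * g w')"
      unfolding sum_distrib_right
    proof (rule sum.cong[OF refl])
      fix w' assume "w' \<in> ?F"
      then show "f w' * g w0 = f w' * g w'" using g[of w' w0] w0 by simp
    qed
    finally show "(\<Sum>w\<in>?F. fibre_avg \<Omega> l f w * g w) = (\<Sum>w\<in>?F. f w * g w)" .
  qed
  also have "\<dots> = (\<Sum>w\<in>\<Omega>. f w * g w)" by (rule sum.image_gen[OF fin, symmetric])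
  finally show ?thesis .
qed

lemma fibre_avg_bounds:
  assumes "\<And>w. w \<in> \<Omega> \<Longrightarrow> 0 \<le> f w \<and> f w \<le> (1::real)"
  shows "0 \<le> fibre_avg \<Omega> l f w" "fibre_avg \<Omega> l f w \<le> 1"
proof -
  let ?F = "{w'\<in>\<Omega>. l w' = l w}"
  show "0 \<le> fibre_avg \<Omega> l f w"
    unfolding fibre_avg_def using assms by (intro divide_nonneg_nonneg sum_nonneg) auto
  have "(\<Sum>w'\<in>?F. f w') \<le> (\<Sum>w'\<in>?F. 1)" by (rule sum_mono) (use assms in auto)
  then show "fibre_avg \<Omega> l f w \<le> 1"
    unfolding fibre_avg_def by (cases "card ?F = 0") (auto simp: divide_le_eq_1)
qed

text \<open>Pythagoras: the difference \<open>D\<close> of the two averages is orthogonal to the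
  coarse one, so the energy grows by the squared norm of \<open>D\<close>. Since the finer labels
  decide membership in \<open>S\<close>, the sum of \<open>D\<close> over \<open>S\<close> equals
  the large discrepancy of \<open>f\<close>.\<close>

lemma energy_increment:
  assumes fin: "finite \<Omega>" and ref: "\<And>w. l w = \<pi> (l' w)"
    and S: "S \<subseteq> \<Omega>" and Sm: "\<And>w w'. w \<in> \<Omega> \<Longrightarrow> w' \<in> \<Omega> \<Longrightarrow> l' w = l' w' \<Longrightarrow> w \<in> S \<longleftrightarrow> w' \<in> S"
    and big: "\<eta> * real (card \<Omega>) < \<bar>\<Sum>w\<in>S. f w - fibre_avg \<Omega> l f w\<bar>" and \<eta>: "0 < \<eta>"
  shows "(\<Sum>w\<in>\<Omega>. fibre_avg \<Omega> l f w ^ 2) + \<eta> ^ 2 * real (card \<Omega>) \<le> (\<Sum>w\<in>\<Omega>. fibre_avg \<Omega> l' f w ^ 2)"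
proof -
  let ?a = "fibre_avg \<Omega> l f" and ?b = "fibre_avg \<Omega> l' f"
  define D where "D w = ?b w - ?a w" for w
  have a_l': "?a w = ?a w'" if "l' w = l' w'" for w w' using ref that by (intro fibre_avg_cong) simp
  have "(\<Sum>w\<in>\<Omega>. ?b w * ?a w) = (\<Sum>w\<in>\<Omega>. f w * ?a w)"
    by (rule sum_fibre_avg[OF fin a_l'])
  moreover have "(\<Sum>w\<in>\<Omega>. ?a w * ?a w) = (\<Sum>w\<in>\<Omega>. f w * ?a w)"
    by (rule sum_fibre_avg[OF fin fibre_avg_cong])
  ultimately have orth: "(\<Sum>w\<in>\<Omega>. ?b w * ?a w) = (\<Sum>w\<in>\<Omega>. ?a w * ?a w)" by simp
  have "(\<Sum>w\<in>\<Omega>. D w ^ 2) = (\<Sum>w\<in>\<Omega>. ?b w ^ 2) + (\<Sum>w\<in>\<Omega>. ?a w ^ 2) - 2 * (\<Sum>w\<in>\<Omega>. ?b w * ?a w)"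
    by (simp add: D_def power2_diff sum.distrib sum_subtractf sum_distrib_left mult.assoc)
  then have D2: "(\<Sum>w\<in>\<Omega>. D w ^ 2) = (\<Sum>w\<in>\<Omega>. ?b w ^ 2) - (\<Sum>w\<in>\<Omega>. ?a w ^ 2)"
    unfolding orth by (simp add: power2_eq_square)
  have ind: "(\<Sum>w\<in>\<Omega>. h w * (if w \<in> S then 1 else 0)) = (\<Sum>w\<in>S. h w)" for h :: "'a \<Rightarrow> real"
    using fin S by (simp add: sum.inter_restrict[symmetric] if_distrib Int_absorb1 cong: if_cong)
  have "(\<Sum>w\<in>\<Omega>. ?b w * (if w \<in> S then 1 else 0)) = (\<Sum>w\<in>\<Omega>. f w * (if w \<in> S then 1 else 0))"
  proof (rule sum_fibre_avg[OF fin])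
    show "(if w \<in> S then 1 else (0::real)) = (if w' \<in> S then 1 else 0)"
      if "w \<in> \<Omega>" "w' \<in> \<Omega>" "l' w = l' w'" for w w'
      using Sm[OF that] by simp
  qed
  then have sumS: "(\<Sum>w\<in>S. f w - ?a w) = (\<Sum>w\<in>S. D w)" unfolding ind by (simp add: D_def sum_subtractf)
  \<comment> \<open>The sign of the discrepancy. Summing
    \<open>0 \<le> (s * D w - \<eta>) ^ 2\<close> over \<open>S\<close> replaces the Cauchy-Schwarz
    inequality.\<close>
  define s :: real where "s = (if (\<Sum>w\<in>S. D w) \<ge> 0 then 1 else -1)"
  have s: "s * s = 1" "\<bar>\<Sum>w\<in>S. D w\<bar> = s * (\<Sum>w\<in>S. D w)" by (auto simp: s_def)
  have "\<eta> ^ 2 * real (card \<Omega>) \<le> 2 * \<eta> * (\<eta> * real (card \<Omega>)) - \<eta> ^ 2 * real (card S)"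
    using mult_left_mono[of "real (card S)" "real (card \<Omega>)" "\<eta> ^ 2"] card_mono[OF fin S]
    by (simp add: power2_eq_square mult.assoc)
  also have "\<dots> \<le> 2 * \<eta> * (s * (\<Sum>w\<in>S. D w)) - \<eta> ^ 2 * real (card S)"
    using big \<eta> unfolding sumS s(2) by (intro diff_right_mono mult_left_mono) auto
  also have "\<dots> = (\<Sum>w\<in>S. 2 * \<eta> * s * D w - \<eta> ^ 2)"
    by (simp add: sum_subtractf sum_distrib_left mult_ac)
  also have "\<dots> \<le> (\<Sum>w\<in>S. D w ^ 2)"
  proof (rule sum_mono)
    fix w
    have "0 \<le> (s * D w - \<eta>) ^ 2" by simp
    also have "\<dots> = (s * s) * D w ^ 2 - 2 * \<eta> * s * D w + \<eta> ^ 2" by (simp add: power2_eq_square algebra_simps)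
    finally show "2 * \<eta> * s * D w - \<eta> ^ 2 \<le> D w ^ 2" using s(1) by simp
  qed
  also have "\<dots> \<le> (\<Sum>w\<in>\<Omega>. D w ^ 2)" by (rule sum_mono2) (use fin S in auto)
  finally show ?thesis using D2 by simp
qed

text \<open>The fibres of \<open>map_prod c c\<close> are the rectangles of two classes, so this is
  the function of block densities. Diagonal pairs take part in the averages.\<close>

definition step_fun :: "'a set \<Rightarrow> ('a \<Rightarrow> nat) \<Rightarrow> ('a \<Rightarrow> 'a \<Rightarrow> real) \<Rightarrow> 'a \<Rightarrow> 'a \<Rightarrow> real" where
  "step_fun V c f x y = fibre_avg (V \<times> V) (map_prod c c) (case_prod f) (x, y)"

lemma step_fun_sym:
  assumes "\<And>x y. x \<in> V \<Longrightarrow> y \<in> V \<Longrightarrow> f x y = f y x"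
  shows "step_fun V c f x y = step_fun V c f y x"
proof -
  let ?F = "\<lambda>x y. {w \<in> V \<times> V. map_prod c c w = map_prod c c (x, y)}"
  have bij: "bij_betw prod.swap (?F x y) (?F y x)"
    by (rule bij_betw_byWitness[where f' = prod.swap]) auto
  have "(\<Sum>w\<in>?F x y. case_prod f w) = (\<Sum>w\<in>?F x y. case_prod f (prod.swap w))"
    by (intro sum.cong refl) (use assms in auto)
  also have "\<dots> = (\<Sum>w\<in>?F y x. case_prod f w)" by (rule sum.reindex_bij_betw[OF bij])
  finally show ?thesis
    unfolding step_fun_def fibre_avg_def using bij_betw_same_card[OF bij] by simp
qed

lemma step_fun_bounds:
  assumes "\<And>x y. x \<in> V \<Longrightarrow> y \<in> V \<Longrightarrow> 0 \<le> f x y \<and> f x y \<le> 1"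
  shows "0 \<le> step_fun V c f x y" "step_fun V c f x y \<le> 1"
  unfolding step_fun_def by (rule fibre_avg_bounds; use assms in auto)+

text \<open>Frieze-Kannan by energy increment: a rectangle with large discrepancy raises the energy
  by \<open>\<eta> ^ 2\<close> relative to the total \<open>card V ^ 2\<close>, which bounds the
  number of rounds by \<open>K\<close>. Each round cuts every class by two sets and so multiplies
  the number of classes by 4.\<close>

lemma weak_regularity:
  fixes f :: "'a \<Rightarrow> 'a \<Rightarrow> real"
  assumes fin: "finite V" and f: "\<And>x y. x \<in> V \<Longrightarrow> y \<in> V \<Longrightarrow> 0 \<le> f x y \<and> f x y \<le> 1"
    and \<eta>: "0 < \<eta>" and K: "1 / \<eta> ^ 2 < real K"
  shows "\<exists>c. (\<forall>x. c x < 4 ^ K) \<and>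
    (\<forall>A B. A \<subseteq> V \<longrightarrow> B \<subseteq> V \<longrightarrow> \<bar>\<Sum>x\<in>A. \<Sum>y\<in>B. f x y - step_fun V c f x y\<bar> \<le> \<eta> * real (card V) ^ 2)"
proof (cases "V = {}")
  case True then show ?thesis by (intro exI[of _ "\<lambda>_. 0"]) auto
next
  case False
  let ?\<Omega> = "V \<times> V"
  define l where "l c = map_prod c c" for c :: "'a \<Rightarrow> nat"
  define en where "en c = (\<Sum>w\<in>?\<Omega>. fibre_avg ?\<Omega> (l c) (case_prod f) w ^ 2)" for c
  define good where "good c \<longleftrightarrow> (\<forall>A B. A \<subseteq> V \<longrightarrow> B \<subseteq> V \<longrightarrow> \<bar>\<Sum>x\<in>A. \<Sum>y\<in>B. f x y - step_fun V c f x y\<bar> \<le> \<eta> * real (card V) ^ 2)" for c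
  have fin2: "finite ?\<Omega>" using fin by simp
  have card: "real (card ?\<Omega>) = real (card V) ^ 2" by (simp add: card_cartesian_product power2_eq_square)
  have "(\<exists>c. (\<forall>x. c x < 4 ^ k) \<and> good c) \<or> (\<exists>c. (\<forall>x. c x < 4 ^ k) \<and> real k * \<eta> ^ 2 * real (card V) ^ 2 \<le> en c)" for k
  proof (induction k)
    case 0
    show ?case by (rule disjI2, rule exI[of _ "\<lambda>_. 0"]) (auto simp: en_def sum_nonneg)
  next
    case (Suc k)
    then consider c where "\<forall>x. c x < 4 ^ k" "good c"
      | c where "\<forall>x. c x < 4 ^ k" "\<not> good c" "real k * \<eta> ^ 2 * real (card V) ^ 2 \<le> en c" by blast
    then show ?case
    proof cases
      case 1
      have "c x < 4 ^ Suc k" for x using 1(1)[rule_format, of x] by (rule less_le_trans) simp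
      then show ?thesis using 1 by blast
    next
      case 2
      obtain A B where AB: "A \<subseteq> V" "B \<subseteq> V"
        "\<eta> * real (card V) ^ 2 < \<bar>\<Sum>x\<in>A. \<Sum>y\<in>B. f x y - step_fun V c f x y\<bar>"
        using 2(2) unfolding good_def by (auto simp: not_le)
      \<comment> \<open>The two lowest binary digits of the new label record membership in
        \<open>A\<close> and \<open>B\<close>; \<open>div 4\<close> recovers the old label.\<close>
      define c' where "c' x = 4 * c x + (if x \<in> A then 2 else 0) + (if x \<in> B then 1 else 0)" for x
      have A: "x \<in> A \<longleftrightarrow> c' x div 2 mod 2 = 1" and B: "x \<in> B \<longleftrightarrow> c' x mod 2 = 1"
        and c_div: "c x = c' x div 4" for x
        unfolding c'_def by (cases "x \<in> A"; cases "x \<in> B"; simp; presburger)+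
      have lt: "c' x < 4 ^ Suc k" for x using 2(1)[rule_format, of x] unfolding c'_def by auto
      have "en c + \<eta> ^ 2 * real (card ?\<Omega>) \<le> en c'"
        unfolding en_def
      proof (rule energy_increment[OF fin2, where S = "A \<times> B" and \<pi> = "map_prod (\<lambda>z. z div 4) (\<lambda>z. z div 4)"])
        show "l c w = map_prod (\<lambda>z. z div 4) (\<lambda>z. z div 4) (l c' w)" for w
          by (cases w) (simp add: l_def flip: c_div)
        show "A \<times> B \<subseteq> ?\<Omega>" using AB by auto
        show "w \<in> A \<times> B \<longleftrightarrow> w' \<in> A \<times> B" if "l c' w = l c' w'" for w w'
          using that by (cases w, cases w') (simp add: l_def A B)
        have "(\<Sum>w\<in>A \<times> B. case_prod f w - fibre_avg ?\<Omega> (l c) (case_prod f) w)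
            = (\<Sum>x\<in>A. \<Sum>y\<in>B. f x y - step_fun V c f x y)"
          by (simp add: sum.cartesian_product step_fun_def l_def split_def)
        then show "\<eta> * real (card ?\<Omega>) < \<bar>\<Sum>w\<in>A \<times> B. case_prod f w - fibre_avg ?\<Omega> (l c) (case_prod f) w\<bar>"
          using AB(3) card by simp
      qed (rule \<eta>)
      then have "real (Suc k) * \<eta> ^ 2 * real (card V) ^ 2 \<le> en c'"
        using 2(3) unfolding card by (simp add: algebra_simps)
      then show ?thesis using lt by blast
    qed
  qed
  \<comment> \<open>So after \<open>K\<close> rounds the second alternative is impossible.\<close>
  moreover have "en c < real K * \<eta> ^ 2 * real (card V) ^ 2" for c
  proof -
    have "en c \<le> (\<Sum>w\<in>?\<Omega>. 1)" unfolding en_def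
    proof (rule sum_mono)
      fix w
      have "0 \<le> fibre_avg ?\<Omega> (l c) (case_prod f) w" "fibre_avg ?\<Omega> (l c) (case_prod f) w \<le> 1"
        by (rule fibre_avg_bounds; use f in auto)+
      then show "fibre_avg ?\<Omega> (l c) (case_prod f) w ^ 2 \<le> 1" by (rule power_le_one)
    qed
    also have "\<dots> = 1 * real (card V) ^ 2" using card by simp
    also have "\<dots> < real K * \<eta> ^ 2 * real (card V) ^ 2"
    proof (rule mult_strict_right_mono)
      show "1 < real K * \<eta> ^ 2" using K \<eta> by (simp add: field_simps)
      show "0 < real (card V) ^ 2" using False fin by (simp add: card_gt_0_iff)
    qed
    finally show ?thesis .
  qed
  ultimately show ?thesis unfolding good_def by (meson not_le)
qed

text \<open>On a union of class rectangles \<open>f\<close> and its step function have the same sum,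
  an exact identity without cut-norm error. It limits how often a graph can disobey its
  template.\<close>

lemma step_fun_sum_rect:
  assumes fin: "finite V"
    and \<alpha>: "\<And>w. w \<in> V \<times> V \<Longrightarrow> p w \<Longrightarrow> step_fun V c f (fst w) (snd w) \<le> \<gamma>"
    and p: "\<And>w w'. map_prod c c w = map_prod c c w' \<Longrightarrow> p w = p w'" and \<gamma>: "0 \<le> \<gamma>"
  shows "(\<Sum>w\<in>{w\<in>V \<times> V. p w}. case_prod f w) \<le> \<gamma> * real (card V) ^ 2"
proof -
  let ?\<Omega> = "V \<times> V"
  have fin2: "finite ?\<Omega>" using fin by simp
  have "(\<Sum>w\<in>{w\<in>?\<Omega>. p w}. case_prod f w) = (\<Sum>w\<in>?\<Omega>. case_prod f w * (if p w then 1 else 0))"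
    using fin2 by (simp add: sum.inter_filter if_distrib cong: if_cong)
  also have "\<dots> = (\<Sum>w\<in>?\<Omega>. fibre_avg ?\<Omega> (map_prod c c) (case_prod f) w * (if p w then 1 else 0))"
  proof (rule sum_fibre_avg[OF fin2, symmetric])
    show "(if p w then 1 else (0::real)) = (if p w' then 1 else 0)"
      if "map_prod c c w = map_prod c c w'" for w w'
      using p[OF that] by simp
  qed
  also have "\<dots> \<le> (\<Sum>w\<in>?\<Omega>. \<gamma>)"
  proof (rule sum_mono)
    fix w assume "w \<in> ?\<Omega>"
    then show "fibre_avg ?\<Omega> (map_prod c c) (case_prod f) w * (if p w then 1 else 0) \<le> \<gamma>"
      using \<alpha>[of w] \<gamma> by (auto simp: step_fun_def)
  qed
  also have "\<dots> = \<gamma> * real (card V) ^ 2" by (simp add: card_cartesian_product power2_eq_square)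
  finally show ?thesis .
qed

section \<open>Templates of type-free graphs\<close>

text \<open>Index \<open>u\<close> of a tuple corresponds to the vertex \<open>Suc u\<close> of $H$.\<close>

definition pattern_weight :: "nat pair_pre_digraph \<Rightarrow> ('a \<Rightarrow> 'a \<Rightarrow> real) \<Rightarrow> nat \<Rightarrow> nat \<Rightarrow> 'a \<Rightarrow> 'a \<Rightarrow> real" where
  "pattern_weight H W u v x y = (if (Suc u, Suc v) \<in> parcs H then W x y else 1 - W x y)"

definition index_pairs :: "nat \<Rightarrow> (nat \<times> nat) set" where
  "index_pairs h = {(u, v). u < v \<and> v < h}"

lemma finite_index_pairs: "finite (index_pairs h)"
  by (rule finite_subset[of _ "{..<h} \<times> {..<h}"]) (auto simp: index_pairs_def)

text \<open>The sample size \<open>k\<close> is fixed before \<open>V\<close> and \<open>W\<close>,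
  so the constant is the same for every symmetric \<open>W\<close>, however many steps it
  has.\<close>

lemma dense_template_hom_sum:
  fixes H :: "nat pair_pre_digraph"
  assumes H: "pair_graph H" "pverts H = {1..h}" "0 < h" and r: "1 \<le> r"
    and n: "\<And>s. s \<le> Suc r \<Longrightarrow> \<not> clique_indep_class (Suc r) s \<subseteq> induced_free H"
    and \<gamma>: "0 < \<gamma>" "\<gamma> \<le> 1 / 2" and \<rho>: "0 < \<rho>"
  shows "\<exists>c>0. \<forall>(V :: 'a set) W. finite V \<longrightarrow> (\<forall>x y. W x y = W y x) \<longrightarrow> (\<forall>x y. 0 \<le> W x y \<and> W x y \<le> 1) \<longrightarrow>
     (1 - 1 / real r + \<rho>) * real (card V) ^ 2 \<le> real (card {(x, y) \<in> V \<times> V. \<gamma> \<le> W x y \<and> W x y \<le> 1 - \<gamma>}) \<longrightarrow>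
     c * real (card V) ^ h \<le> hom_sum V {..<h} (index_pairs h) (pattern_weight H W)"
proof -
  \<comment> \<open>One half of \<open>\<rho>\<close> keeps the sample above the Turan density, the
    other half is spent in \<open>sampling\<close>.\<close>
  define e where "e = \<rho> / 2"
  define a where "a = 1 - 1 / real r + e"
  have e: "0 < e" using \<rho> by (simp add: e_def)
  have "1 / real r \<le> 1" using r by simp
  then have a: "0 \<le> a" using e unfolding a_def by linarith
  have "\<forall>\<^sub>F k in sequentially. 2 * (a + e) \<le> e * real k" using e by real_asymp
  from eventually_happens'[OF sequentially_bot eventually_conj[OF template_contains_pattern[OF H(1,2) r e n]
      eventually_conj[OF this eventually_ge_at_top[of 2]]]]
  obtain k where k': "(\<forall>One Zero :: nat \<Rightarrow> nat \<Rightarrow> bool.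
     (\<forall>i j. One i j \<longrightarrow> One j i) \<longrightarrow> (\<forall>i j. Zero i j \<longrightarrow> Zero j i) \<longrightarrow>
     (\<forall>i j. One i j \<or> Zero i j) \<longrightarrow>
     (1 - 1 / real r + e) * real k ^ 2 \<le> real (card {(i, j). i < k \<and> j < k \<and> i \<noteq> j \<and> One i j \<and> Zero i j}) \<longrightarrow>
     (\<exists>\<phi>. \<phi> ` {..<h} \<subseteq> {..<k} \<and> inj_on \<phi> {..<h} \<and>
        (\<forall>u<h. \<forall>v<h. u \<noteq> v \<longrightarrow>
          (if (Suc u, Suc v) \<in> parcs H then One (\<phi> u) (\<phi> v) else Zero (\<phi> u) (\<phi> v))))) \<and> 2 * (a + e) \<le> e * real k \<and> 2 \<le> k"
    by (rule exE)
  note k = conjunct1[OF conjunct2[OF k']] conjunct2[OF conjunct2[OF k']]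
  note pat = conjunct1[OF k']
  \<comment> \<open>The proportion of good tuples times the least weight of one: each of its factors
    is at least \<open>\<gamma>\<close>.\<close>
  define c where "c = e / 2 / real k ^ h * \<gamma> ^ card (index_pairs h)"
  have c: "0 < c" using e k \<gamma> by (simp add: c_def)
  have "c * real (card V) ^ h \<le> hom_sum V {..<h} (index_pairs h) (pattern_weight H W)"
    if V: "finite V" and sym: "\<And>x y. W x y = W y x" and W: "\<And>x y. 0 \<le> W x y \<and> W x y \<le> 1"
      and dens: "(1 - 1 / real r + \<rho>) * real (card V) ^ 2 \<le> real (card {(x, y) \<in> V \<times> V. \<gamma> \<le> W x y \<and> W x y \<le> 1 - \<gamma>})"
    for V :: "'a set" and W
  proof -
    define P where "P y \<longleftrightarrow> (\<forall>u<h. \<forall>v<h. u \<noteq> v \<longrightarrow>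
          (if (Suc u, Suc v) \<in> parcs H then \<gamma> \<le> W (y u) (y v) else W (y u) (y v) \<le> 1 - \<gamma>))" for y :: "nat \<Rightarrow> 'a"
    let ?Y = "{y \<in> {..<h} \<rightarrow>\<^sub>E V. P y}"
    have cnt: "e / 2 / real k ^ h * real (card V) ^ h \<le> real (card ?Y)"
    proof (rule sampling[OF V a e H(3) k(2,1)])
      show "(a + e) * real (card V) ^ 2 \<le> real (card {(x, y) \<in> V \<times> V. \<gamma> \<le> W x y \<and> W x y \<le> 1 - \<gamma>})"
      proof -
        have "a + e = 1 - 1 / real r + \<rho>" by (simp add: a_def e_def)
        then show ?thesis using dens by (simp only:)
      qed
      fix x assume x: "x \<in> {..<k} \<rightarrow>\<^sub>E V"
        and d: "a * real k ^ 2 < real (card {(i, j). i < k \<and> j < k \<and> i \<noteq> j \<and> \<gamma> \<le> W (x i) (x j) \<and> W (x i) (x j) \<le> 1 - \<gamma>})"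
      define One where "One i j \<longleftrightarrow> \<gamma> \<le> W (x i) (x j)" for i j
      define Zero where "Zero i j \<longleftrightarrow> W (x i) (x j) \<le> 1 - \<gamma>" for i j
      have 1: "\<forall>i j. One i j \<longrightarrow> One j i" and 2: "\<forall>i j. Zero i j \<longrightarrow> Zero j i"
        unfolding One_def Zero_def by (metis sym)+
      have 3: "\<forall>i j. One i j \<or> Zero i j" using \<gamma> unfolding One_def Zero_def by (intro allI) linarith
      have 4: "(1 - 1 / real r + e) * real k ^ 2 \<le> real (card {(i, j). i < k \<and> j < k \<and> i \<noteq> j \<and> One i j \<and> Zero i j})"
        using d unfolding One_def Zero_def a_def by simp
      have "\<exists>\<phi>. \<phi> ` {..<h} \<subseteq> {..<k} \<and> inj_on \<phi> {..<h} \<and>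
        (\<forall>u<h. \<forall>v<h. u \<noteq> v \<longrightarrow>
          (if (Suc u, Suc v) \<in> parcs H then One (\<phi> u) (\<phi> v) else Zero (\<phi> u) (\<phi> v)))"
        by (rule pat[THEN spec, THEN spec, THEN mp, THEN mp, THEN mp, THEN mp, OF 1 2 3 4])
      then obtain \<phi> where \<phi>: "\<phi> ` {..<h} \<subseteq> {..<k}" "inj_on \<phi> {..<h}"
        "\<forall>u<h. \<forall>v<h. u \<noteq> v \<longrightarrow>
          (if (Suc u, Suc v) \<in> parcs H then One (\<phi> u) (\<phi> v) else Zero (\<phi> u) (\<phi> v))"
        by blast
      have "P (restrict (x \<circ> \<phi>) {..<h})"
        using \<phi>(3) unfolding P_def One_def Zero_def by simp
      then show "\<exists>\<phi>. \<phi> ` {..<h} \<subseteq> {..<k} \<and> inj_on \<phi> {..<h} \<and> P (restrict (x \<circ> \<phi>) {..<h})"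
        using \<phi> by blast
    qed
    have "c * real (card V) ^ h = e / 2 / real k ^ h * real (card V) ^ h * \<gamma> ^ card (index_pairs h)"
      by (simp add: c_def)
    also have "\<dots> \<le> real (card ?Y) * \<gamma> ^ card (index_pairs h)"
      by (rule mult_right_mono[OF cnt]) (use \<gamma> in simp)
    also have "\<dots> = (\<Sum>y\<in>?Y. \<Prod>p\<in>index_pairs h. \<gamma>)" by simp
    also have "\<dots> \<le> (\<Sum>y\<in>?Y. \<Prod>(u, v)\<in>index_pairs h. pattern_weight H W u v (y u) (y v))"
    proof (intro sum_mono prod_mono)
      fix y p assume y: "y \<in> ?Y" and p: "p \<in> index_pairs h"
      obtain u v where uv: "p = (u, v)" "u < v" "v < h" using p by (auto simp: index_pairs_def)
      have "P y" using y by simp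
      then have "if (Suc u, Suc v) \<in> parcs H then \<gamma> \<le> W (y u) (y v) else W (y u) (y v) \<le> 1 - \<gamma>"
        using uv unfolding P_def by simp
      then show "0 \<le> \<gamma> \<and> \<gamma> \<le> (case p of (u, v) \<Rightarrow> pattern_weight H W u v (y u) (y v))"
        using \<gamma> unfolding uv(1) pattern_weight_def by (auto split: if_splits)
    qed
    also have "\<dots> \<le> hom_sum V {..<h} (index_pairs h) (pattern_weight H W)"
      unfolding hom_sum_def
    proof (rule sum_mono2)
      show "finite ({..<h} \<rightarrow>\<^sub>E V)" using V by (simp add: finite_PiE)
      show "0 \<le> (\<Prod>(u, v)\<in>index_pairs h. pattern_weight H W u v (y u) (y v))" for y
        by (rule prod_nonneg) (use W in \<open>auto simp: pattern_weight_def\<close>)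
    qed auto
    finally show ?thesis .
  qed
  then show ?thesis using c by blast
qed

text \<open>The columns of \<open>N\<close> become the small parts and \<open>T\<close> the part of
  the last vertex. The clause \<open>x \<noteq> y\<close> in \<open>Q\<close> makes the parts
  disjoint, and \<open>crossing\<close> gives every column the size of \<open>N\<close>. Pairs
  inside one part are unconstrained on both sides.\<close>

lemma blowup_not_type_free:
  fixes H G :: "nat pair_pre_digraph"
  assumes H: "pair_graph H" "pverts H = {1..Suc k}" and G: "pair_graph G" "pverts G = {1..n}"
    and Q: "\<And>a b x y. Q a b x y \<longleftrightarrow> x \<noteq> y \<and> ((Suc a, Suc b) \<in> parcs H \<longleftrightarrow> (x, y) \<in> parcs G)"
    and N: "N \<subseteq> tuples k {1..n}" "crossing Q k N" and T: "T \<subseteq> {1..n}"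
    and NT: "\<And>e v a. e \<in> N \<Longrightarrow> v \<in> T \<Longrightarrow> a < k \<Longrightarrow> Q a k (e ! a) v"
  shows "G \<notin> type_free_graphs n H (card N) (card T)"
proof -
  interpret G: pair_graph G by fact
  interpret H: pair_graph H by fact
  define W where "W u = (if u = Suc k then T else (\<lambda>e. e ! (u - 1)) ` N)" for u
  have less: "x \<noteq> y \<and> ((u, v) \<in> parcs H \<longleftrightarrow> (x, y) \<in> parcs G)"
    if uv: "1 \<le> u" "u < v" "v \<le> Suc k" and xy: "x \<in> W u" "y \<in> W v" for u v x y
  proof -
    obtain e where e: "e \<in> N" "x = e ! (u - 1)" using uv xy by (auto simp: W_def)
    have S: "Suc (u - 1) = u" "Suc (v - 1) = v" using uv by auto
    have "Q (u - 1) (v - 1) x y"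
    proof (cases "v = Suc k")
      case True
      then show ?thesis using NT[OF e(1), of y "u - 1"] xy uv e by (auto simp: W_def)
    next
      case False
      then obtain e' where "e' \<in> N" "y = e' ! (v - 1)" using xy by (auto simp: W_def)
      then show ?thesis using crossing_rel[OF N(2) e(1), of e' "u - 1" "v - 1"] e uv False by auto
    qed
    then show ?thesis unfolding Q S by simp
  qed
  \<comment> \<open>\<open>Q\<close> speaks about increasing indices only; the other order follows
    from the symmetry of both graphs.\<close>
  have both: "x \<noteq> y \<and> ((x, y) \<in> parcs G \<longleftrightarrow> (u, v) \<in> parcs H)"
    if uv: "u \<in> pverts H" "v \<in> pverts H" "u \<noteq> v" and xy: "x \<in> W u" "y \<in> W v" for u v x y
  proof (cases "u < v")
    case True
    then show ?thesis using less[of u v x y] uv xy H(2) by auto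
  next
    case False
    then have "y \<noteq> x \<and> ((v, u) \<in> parcs H \<longleftrightarrow> (y, x) \<in> parcs G)" using less[of v u y x] uv xy H(2) by auto
    moreover have "(v, u) \<in> parcs H \<longleftrightarrow> (u, v) \<in> parcs H" using H.arcs_symmetric by blast
    moreover have "(y, x) \<in> parcs G \<longleftrightarrow> (x, y) \<in> parcs G" using G.arcs_symmetric by blast
    ultimately show ?thesis by blast
  qed
  have Wsub: "W u \<subseteq> {1..n}" if "u \<in> pverts H" for u
  proof (cases "u = Suc k")
    case True then show ?thesis using T by (simp add: W_def)
  next
    case False
    then have "u - 1 < k" using that H(2) by auto
    then show ?thesis using N(1) False unfolding W_def tuples_def
      by (auto simp: subset_iff dest!: nth_mem)
  qed
  have Wcard: "card (W u) = (if u = card (pverts H) then card T else card N)" if "u \<in> pverts H" for u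
  proof (cases "u = Suc k")
    case True then show ?thesis using H(2) by (simp add: W_def)
  next
    case False
    then have "u - 1 < k" using that H(2) by auto
    then have "inj_on (\<lambda>e. e ! (u - 1)) N" using crossing_distinct[OF N(2)] by (auto intro!: inj_onI)
    then show ?thesis using False H(2) by (simp add: W_def card_image)
  qed
  define U where "U = (\<Union>u\<in>pverts H. W u)"
  have U: "U \<subseteq> {1..n}" using Wsub by (auto simp: U_def)
  define F where "F = \<lparr>pverts = U, parcs = {e \<in> parcs G. fst e \<in> U \<and> snd e \<in> U}\<rparr>"
  have F: "pverts F = U" "parcs F = {e \<in> parcs G. fst e \<in> U \<and> snd e \<in> U}" by (simp_all add: F_def)
  have "symmetric (with_proj F)" unfolding symmetric_def using G.arcs_symmetric by (auto simp: F intro!: symI)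
  moreover have "finite U" using U finite_subset by blast
  moreover have "finite (parcs F)" unfolding F using G.pair_finite_arcs by simp
  ultimately have pF: "pair_graph F"
    by unfold_locales (auto simp: F dest: G.pair_no_loops)
  have "wf_digraph (with_proj F)" using pF by (simp add: wf_digraph_wp_iff pair_graph_def pair_digraph_def pair_fin_digraph_def)
  then have "induced_subgraph (with_proj F) (with_proj G)"
    unfolding induced_subgraph_def subgraph_def compatible_def
    using G.wf_digraph_axioms U G(2) by (auto simp: F)
  moreover have "of_type H (\<lambda>u. if u = card (pverts H) then card T else card N) F"
    unfolding of_type_def
  proof (intro conjI exI[of _ W] ballI impI pF)
    show "disjoint_family_on W (pverts H)" using both unfolding disjoint_family_on_def by blast
    show "(\<Union>u\<in>pverts H. W u) = pverts F" by (simp add: F U_def)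
    show "card (W u) = (if u = card (pverts H) then card T else card N)" if "u \<in> pverts H" for u
      by (rule Wcard[OF that])
    show "(x, y) \<in> parcs F \<longleftrightarrow> (u, v) \<in> parcs H"
      if "u \<in> pverts H" "v \<in> pverts H" "u \<noteq> v" "x \<in> W u" "y \<in> W v" for u v x y
    proof -
      have "x \<in> U" "y \<in> U" using that by (auto simp: U_def)
      then show ?thesis using both[OF that] by (simp add: F)
    qed
  qed
  ultimately show ?thesis by (auto simp: type_free_graphs_def)
qed

definition adj :: "'a pair_pre_digraph \<Rightarrow> 'a \<Rightarrow> 'a \<Rightarrow> real" where
  "adj G x y = (if (x, y) \<in> parcs G then 1 else 0)"

lemma hom_sum_adj:
  assumes V: "finite V"
  shows "hom_sum V {..<h} (index_pairs h) (pattern_weight H (adj G)) =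
    real (card {y \<in> {..<h} \<rightarrow>\<^sub>E V. \<forall>u v. u < v \<longrightarrow> v < h \<longrightarrow> ((Suc u, Suc v) \<in> parcs H \<longleftrightarrow> (y u, y v) \<in> parcs G)})"
proof -
  have "(\<Prod>(u, v)\<in>index_pairs h. pattern_weight H (adj G) u v (y u) (y v))
     = (if \<forall>u v. u < v \<longrightarrow> v < h \<longrightarrow> ((Suc u, Suc v) \<in> parcs H \<longleftrightarrow> (y u, y v) \<in> parcs G) then 1 else 0)" for y
  proof (cases "\<forall>u v. u < v \<longrightarrow> v < h \<longrightarrow> ((Suc u, Suc v) \<in> parcs H \<longleftrightarrow> (y u, y v) \<in> parcs G)")
    case True
    have "(\<Prod>(u, v)\<in>index_pairs h. pattern_weight H (adj G) u v (y u) (y v)) = 1"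
    proof (rule prod.neutral, rule ballI)
      fix p assume "p \<in> index_pairs h"
      then obtain u v where uv: "p = (u, v)" "u < v" "v < h" by (auto simp: index_pairs_def)
      then have "(Suc u, Suc v) \<in> parcs H \<longleftrightarrow> (y u, y v) \<in> parcs G" using True by blast
      then show "(case p of (u, v) \<Rightarrow> pattern_weight H (adj G) u v (y u) (y v)) = 1"
        unfolding uv(1) by (simp add: pattern_weight_def adj_def)
    qed
    then show ?thesis using True by simp
  next
    case False
    then obtain u v where uv: "u < v" "v < h" "(Suc u, Suc v) \<in> parcs H \<longleftrightarrow> (y u, y v) \<notin> parcs G" by blast
    have "(\<Prod>(u, v)\<in>index_pairs h. pattern_weight H (adj G) u v (y u) (y v)) = 0"
    proof (rule prod_zero[OF finite_index_pairs], rule bexI[of _ "(u, v)"])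
      show "(case (u, v) of (u, v) \<Rightarrow> pattern_weight H (adj G) u v (y u) (y v)) = 0"
        using uv(3) by (auto simp: pattern_weight_def adj_def)
      show "(u, v) \<in> index_pairs h" using uv by (simp add: index_pairs_def)
    qed
    then show ?thesis using False by (simp only: if_False)
  qed
  then show ?thesis using V by (simp add: hom_sum_def finite_PiE sum.If_cases Int_def)
qed

text \<open>A repeated vertex passes for a non-edge of H, since G has no loops. Such tuples are of
  lower order and can be discarded.\<close>

lemma card_non_injective:
  assumes V: "finite V" and h: "2 \<le> h"
  shows "card {y \<in> {..<h} \<rightarrow>\<^sub>E V. \<not> inj_on y {..<h}} \<le> card (index_pairs h) * card V ^ (h - 1)"
proof -
  have "{y \<in> {..<h} \<rightarrow>\<^sub>E V. \<not> inj_on y {..<h}}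
     \<subseteq> (\<Union>p\<in>index_pairs h. {y \<in> {..<h} \<rightarrow>\<^sub>E V. y (fst p) = y (snd p)})"
  proof
    fix y assume y: "y \<in> {y \<in> {..<h} \<rightarrow>\<^sub>E V. \<not> inj_on y {..<h}}"
    then obtain u v where uv: "u < h" "v < h" "u \<noteq> v" "y u = y v" by (auto simp: inj_on_def)
    then have "(min u v, max u v) \<in> index_pairs h" "y (min u v) = y (max u v)"
      by (auto simp: index_pairs_def min_def max_def)
    then show "y \<in> (\<Union>p\<in>index_pairs h. {y \<in> {..<h} \<rightarrow>\<^sub>E V. y (fst p) = y (snd p)})" using y by force
  qed
  then have "card {y \<in> {..<h} \<rightarrow>\<^sub>E V. \<not> inj_on y {..<h}}
     \<le> card (\<Union>p\<in>index_pairs h. {y \<in> {..<h} \<rightarrow>\<^sub>E V. y (fst p) = y (snd p)})"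
    by (rule card_mono[rotated]) (use V in \<open>auto intro!: finite_UN_I finite_index_pairs simp: finite_PiE\<close>)
  also have "\<dots> \<le> (\<Sum>p\<in>index_pairs h. card {y \<in> {..<h} \<rightarrow>\<^sub>E V. y (fst p) = y (snd p)})"
    by (rule card_UN_le[OF finite_index_pairs])
  also have "\<dots> = (\<Sum>p\<in>index_pairs h. card V ^ (h - 1))"
  proof (rule sum.cong[OF refl])
    fix p assume p: "p \<in> index_pairs h"
    have "{(x, y) \<in> V \<times> V. x = y} = (\<lambda>x. (x, x)) ` V" by auto
    then have "card {(x, y) \<in> V \<times> V. x = y} = card V" by (simp add: card_image inj_on_def)
    then have "card {y \<in> {..<h} \<rightarrow>\<^sub>E V. y (fst p) = y (snd p)} = card V ^ (h - 2) * card V"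
      using sum_PiE_two_coordinates[of "{..<h}" "fst p" "snd p" V "(=)"] p V by (auto simp: index_pairs_def)
    also have "\<dots> = card V ^ Suc (h - 2)" by simp
    also have "Suc (h - 2) = h - 1" using h by simp
    finally show "card {y \<in> {..<h} \<rightarrow>\<^sub>E V. y (fst p) = y (snd p)} = card V ^ (h - 1)" .
  qed
  finally show ?thesis by simp
qed

text \<open>By contradiction, with the budget \<open>c0\<close>: half of it is lost in the passage
  from the template to G, a quarter on tuples with repeated vertices, and the last quarter is the
  density of genuine copies handed to \<open>many_tuples_blowup\<close>.\<close>

lemma type_free_sparse_template:
  fixes H :: "nat pair_pre_digraph"
  assumes H: "pair_graph H" "pverts H = {1..h}" "2 \<le> h" and r: "1 \<le> r"
    and n: "\<And>s. s \<le> Suc r \<Longrightarrow> \<not> clique_indep_class (Suc r) s \<subseteq> induced_free H"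
    and \<gamma>: "0 < \<gamma>" "\<gamma> \<le> 1 / 2" and \<rho>: "0 < \<rho>"
  shows "\<exists>K::nat. \<exists>\<delta>>0. \<forall>\<^sub>F n in sequentially.
     \<forall>G\<in>type_free_graphs n H (nat \<lfloor>\<delta> * ln (real n)\<rfloor>) (nat \<lceil>real n powr (1 - sqrt \<delta>)\<rceil>).
       \<exists>c. (\<forall>x. c x < K) \<and>
         real (card {(x, y) \<in> {1..n} \<times> {1..n}. \<gamma> \<le> step_fun {1..n} c (adj G) x y \<and> step_fun {1..n} c (adj G) x y \<le> 1 - \<gamma>})
           \<le> (1 - 1 / real r + \<rho>) * real n ^ 2"
proof -
  have h0: "0 < h" using H by simp
  obtain c0 where c0: "0 < c0" and dense: "\<forall>(V :: nat set) W. finite V \<longrightarrow> (\<forall>x y. W x y = W y x) \<longrightarrow> (\<forall>x y. 0 \<le> W x y \<and> W x y \<le> 1) \<longrightarrow>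
     (1 - 1 / real r + \<rho>) * real (card V) ^ 2 \<le> real (card {(x, y) \<in> V \<times> V. \<gamma> \<le> W x y \<and> W x y \<le> 1 - \<gamma>}) \<longrightarrow>
     c0 * real (card V) ^ h \<le> hom_sum V {..<h} (index_pairs h) (pattern_weight H W)"
    using dense_template_hom_sum[OF H(1,2) h0 r n \<gamma> \<rho>, where 'a = nat] by blast
  define m where "m = card (index_pairs h)"
  define \<eta> where "\<eta> = c0 / (2 * (real m + 1))"
  have \<eta>: "0 < \<eta>" "real m * \<eta> \<le> c0 / 2" using c0 by (auto simp: \<eta>_def field_simps)
  \<comment> \<open>\<open>K\<close> bounds the rounds of \<open>weak_regularity\<close>; the
    witness for the number of classes in the conclusion is \<open>4 ^ K\<close>.\<close>
  obtain K where K: "1 / \<eta> ^ 2 < real K" using reals_Archimedean2 by blast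
  define c where "c = min (c0 / 4) 1"
  have c: "0 < c" "c \<le> 1" "c \<le> c0 / 4" using c0 by (auto simp: c_def)
  define k where "k = h - 1"
  have k: "1 \<le> k" "h = Suc k" using H(3) by (auto simp: k_def)
  obtain \<delta> where \<delta>: "0 < \<delta>" and ev: "\<forall>\<^sub>F n in sequentially. \<forall>(V :: nat set) X Q. finite V \<longrightarrow> card V = n \<longrightarrow>
     X \<subseteq> tuples (Suc k) V \<longrightarrow> (\<forall>x\<in>X. \<forall>a b. a < b \<longrightarrow> b < Suc k \<longrightarrow> Q a b (x ! a) (x ! b)) \<longrightarrow>
     c * real n ^ Suc k \<le> real (card X) \<longrightarrow>
     (\<exists>N T. N \<subseteq> tuples k V \<and> crossing Q k N \<and> T \<subseteq> V \<and> card N = nat \<lfloor>\<delta> * ln (real n)\<rfloor> \<and>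
        card T = nat \<lceil>real n powr (1 - sqrt \<delta>)\<rceil> \<and> (\<forall>e\<in>N. \<forall>v\<in>T. e @ [v] \<in> X))"
    using many_tuples_blowup[OF k(1) c(1,2), where 'a = nat] by blast
  have e1: "\<forall>\<^sub>F n in sequentially. real m \<le> c0 / 4 * real n" using c0 by real_asymp
  have "\<forall>\<^sub>F n in sequentially.
     \<forall>G\<in>type_free_graphs n H (nat \<lfloor>\<delta> * ln (real n)\<rfloor>) (nat \<lceil>real n powr (1 - sqrt \<delta>)\<rceil>).
       \<exists>c. (\<forall>x. c x < 4 ^ K) \<and>
         real (card {(x, y) \<in> {1..n} \<times> {1..n}. \<gamma> \<le> step_fun {1..n} c (adj G) x y \<and> step_fun {1..n} c (adj G) x y \<le> 1 - \<gamma>})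
           \<le> (1 - 1 / real r + \<rho>) * real n ^ 2"
    using ev e1
  proof eventually_elim
    case (elim n)
    show ?case
    proof
      fix G assume Gt: "G \<in> type_free_graphs n H (nat \<lfloor>\<delta> * ln (real n)\<rfloor>) (nat \<lceil>real n powr (1 - sqrt \<delta>)\<rceil>)"
      then have G: "pair_graph G" "pverts G = {1..n}" by (auto simp: type_free_graphs_def)
      interpret G: pair_graph G by fact
      define V where "V = {1..n}"
      have V: "finite V" "card V = n" by (auto simp: V_def)
      have A01: "0 \<le> adj G x y \<and> adj G x y \<le> 1" for x y by (simp add: adj_def)
      have "(x, y) \<in> parcs G \<longleftrightarrow> (y, x) \<in> parcs G" for x y using G.arcs_symmetric by blast
      then have Asym: "adj G x y = adj G y x" for x y by (simp add: adj_def)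
      have "\<exists>c. (\<forall>x. c x < 4 ^ K) \<and> (\<forall>A B. A \<subseteq> V \<longrightarrow> B \<subseteq> V \<longrightarrow>
          \<bar>\<Sum>x\<in>A. \<Sum>y\<in>B. adj G x y - step_fun V c (adj G) x y\<bar> \<le> \<eta> * real (card V) ^ 2)"
        by (rule weak_regularity[OF V(1) _ \<eta>(1) K]) (rule A01)
      then obtain col where wr: "(\<forall>x. col x < 4 ^ K) \<and> (\<forall>A B. A \<subseteq> V \<longrightarrow> B \<subseteq> V \<longrightarrow>
          \<bar>\<Sum>x\<in>A. \<Sum>y\<in>B. adj G x y - step_fun V col (adj G) x y\<bar> \<le> \<eta> * real (card V) ^ 2)"
        by (rule exE)
      note col = conjunct1[OF wr]
      have cut: "\<bar>\<Sum>x\<in>A. \<Sum>y\<in>B. adj G x y - step_fun V col (adj G) x y\<bar> \<le> \<eta> * real n ^ 2"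
        if "A \<subseteq> V" "B \<subseteq> V" for A B
        using wr that unfolding V(2) by simp
      define W where "W = step_fun V col (adj G)"
      have W01: "0 \<le> W x y \<and> W x y \<le> 1" for x y
        unfolding W_def using step_fun_bounds[of V "adj G" col x y] A01 by blast
      have Wsym: "W x y = W y x" for x y unfolding W_def by (rule step_fun_sym) (rule Asym)
      show "\<exists>c. (\<forall>x. c x < 4 ^ K) \<and>
         real (card {(x, y) \<in> {1..n} \<times> {1..n}. \<gamma> \<le> step_fun {1..n} c (adj G) x y \<and> step_fun {1..n} c (adj G) x y \<le> 1 - \<gamma>})
           \<le> (1 - 1 / real r + \<rho>) * real n ^ 2"
      proof (intro exI[of _ col] conjI col, rule ccontr)
        assume "\<not> real (card {(x, y) \<in> {1..n} \<times> {1..n}. \<gamma> \<le> step_fun {1..n} col (adj G) x y \<and> step_fun {1..n} col (adj G) x y \<le> 1 - \<gamma>})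
           \<le> (1 - 1 / real r + \<rho>) * real n ^ 2"
        then have "(1 - 1 / real r + \<rho>) * real (card V) ^ 2 \<le> real (card {(x, y) \<in> V \<times> V. \<gamma> \<le> W x y \<and> W x y \<le> 1 - \<gamma>})"
          unfolding W_def V(2) by (simp add: V_def)
        then have "c0 * real (card V) ^ h \<le> hom_sum V {..<h} (index_pairs h) (pattern_weight H W)"
          using Wsym W01 by (intro dense[THEN spec, THEN spec, THEN mp, THEN mp, THEN mp, THEN mp] V(1)) blast+
        also have "\<dots> \<le> hom_sum V {..<h} (index_pairs h) (pattern_weight H (adj G))
            + real (card (index_pairs h)) * (\<eta> * real n ^ 2) * real (card V) ^ (card {..<h} - 2)"
        proof (rule hom_sum_le[OF V(1)])
          show "index_pairs h \<subseteq> {(u, v). u \<in> {..<h} \<and> v \<in> {..<h} \<and> u < v}" by (auto simp: index_pairs_def)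
          show "0 \<le> pattern_weight H W u v x y \<and> pattern_weight H W u v x y \<le> 1" for u v x y
            using W01[of x y] by (simp add: pattern_weight_def)
          show "0 \<le> pattern_weight H (adj G) u v x y \<and> pattern_weight H (adj G) u v x y \<le> 1" for u v x y
            using A01[of x y] by (simp add: pattern_weight_def)
          show "(\<Sum>x\<in>A. \<Sum>y\<in>B. pattern_weight H W u v x y - pattern_weight H (adj G) u v x y) \<le> \<eta> * real n ^ 2"
            if "A \<subseteq> V" "B \<subseteq> V" for u v A B
          proof -
            define S where "S = (\<Sum>x\<in>A. \<Sum>y\<in>B. adj G x y - W x y)"
            have "\<bar>S\<bar> \<le> \<eta> * real n ^ 2" unfolding S_def W_def by (rule cut[OF that])
            moreover have "(\<Sum>x\<in>A. \<Sum>y\<in>B. pattern_weight H W u v x y - pattern_weight H (adj G) u v x y)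
                = (if (Suc u, Suc v) \<in> parcs H then - S else S)"
              unfolding S_def by (simp add: pattern_weight_def sum_negf[symmetric])
            ultimately show ?thesis by (auto split: if_splits)
          qed
        qed simp
        also have "real (card (index_pairs h)) * (\<eta> * real n ^ 2) * real (card V) ^ (card {..<h} - 2)
            = real m * \<eta> * real n ^ h"
        proof -
          have "real n ^ 2 * real n ^ (h - 2) = real n ^ (2 + (h - 2))" by (rule power_add[symmetric])
          then have "real n ^ 2 * real n ^ (h - 2) = real n ^ h" unfolding le_add_diff_inverse[OF H(3)] .
          then show ?thesis unfolding V(2) m_def card_lessThan by (metis mult.assoc)
        qed
        also have "\<dots> \<le> c0 / 2 * real n ^ h" using \<eta>(2) by (rule mult_right_mono) simp
        finally have 1: "c0 / 2 * real n ^ h \<le> hom_sum V {..<h} (index_pairs h) (pattern_weight H (adj G))"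
          unfolding V(2) by simp
        define Y where "Y = {y \<in> {..<h} \<rightarrow>\<^sub>E V. \<forall>u v. u < v \<longrightarrow> v < h \<longrightarrow> ((Suc u, Suc v) \<in> parcs H \<longleftrightarrow> (y u, y v) \<in> parcs G)}"
        define Yi where "Yi = {y \<in> Y. inj_on y {..<h}}"
        have finP: "finite ({..<h} \<rightarrow>\<^sub>E V)" using V by (simp add: finite_PiE)
        have "card Y \<le> card (Yi \<union> {y \<in> {..<h} \<rightarrow>\<^sub>E V. \<not> inj_on y {..<h}})"
          by (rule card_mono) (use finP in \<open>auto simp: Y_def Yi_def\<close>)
        also have "\<dots> \<le> card Yi + card {y \<in> {..<h} \<rightarrow>\<^sub>E V. \<not> inj_on y {..<h}}" by (rule card_Un_le)
        also have "\<dots> \<le> card Yi + m * n ^ (h - 1)"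
          using card_non_injective[OF V(1) H(3)] by (simp add: V(2) m_def)
        finally have "real (card Y) \<le> real (card Yi + m * n ^ (h - 1))" by (rule of_nat_mono)
        then have "real (card Y) \<le> real (card Yi) + real m * real n ^ k" by (simp add: k_def)
        also have "real m * real n ^ k \<le> c0 / 4 * real n * real n ^ k"
          using elim(2) by (rule mult_right_mono) simp
        finally have "real (card Y) \<le> real (card Yi) + c0 / 4 * real n ^ h" by (simp add: k(2))
        then have 2: "c0 / 4 * real n ^ h \<le> real (card Yi)"
          using 1 unfolding hom_sum_adj[OF V(1)] Y_def by simp
        define L where "L y = map y [0..<h]" for y :: "nat \<Rightarrow> nat"
        have L_nth: "L y ! a = y a" if "a < h" for y a using that by (simp add: L_def)
        have injL: "inj_on L Yi"
          unfolding L_def Yi_def Y_def by (rule inj_on_subset[OF inj_on_map_upt]) blast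
        define Q where "Q a b x y \<longleftrightarrow> x \<noteq> y \<and> ((Suc a, Suc b) \<in> parcs H \<longleftrightarrow> (x, y) \<in> parcs G)" for a b x y
        have LT: "L ` Yi \<subseteq> tuples (Suc k) V" by (auto simp: tuples_def L_def Yi_def Y_def PiE_iff k(2))
        have LQ: "\<forall>x\<in>L ` Yi. \<forall>a b. a < b \<longrightarrow> b < Suc k \<longrightarrow> Q a b (x ! a) (x ! b)"
        proof (intro ballI allI impI)
          fix x a b assume x: "x \<in> L ` Yi" and ab: "a < b" "b < Suc k"
          obtain y where y: "y \<in> Yi" "x = L y" using x by auto
          have "y a \<noteq> y b" using y(1) ab k(2) by (auto simp: Yi_def dest: inj_onD)
          moreover have "(Suc a, Suc b) \<in> parcs H \<longleftrightarrow> (y a, y b) \<in> parcs G"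
            using y(1) ab k(2) by (auto simp: Yi_def Y_def)
          ultimately show "Q a b (x ! a) (x ! b)" using L_nth[of a y] L_nth[of b y] ab k(2) by (simp add: y Q_def)
        qed
        have Lc: "c * real n ^ Suc k \<le> real (card (L ` Yi))"
        proof -
          have "c * real n ^ Suc k \<le> c0 / 4 * real n ^ Suc k" using c(3) by (rule mult_right_mono) simp
          also have "\<dots> \<le> real (card (L ` Yi))" using 2 unfolding card_image[OF injL] k(2) .
          finally show ?thesis .
        qed
        obtain N T where N: "N \<subseteq> tuples k V" "crossing Q k N" "T \<subseteq> V" "card N = nat \<lfloor>\<delta> * ln (real n)\<rfloor>"
          "card T = nat \<lceil>real n powr (1 - sqrt \<delta>)\<rceil>" "\<forall>e\<in>N. \<forall>v\<in>T. e @ [v] \<in> L ` Yi"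
          using elim(1)[THEN spec, THEN spec, THEN spec, THEN mp, THEN mp, THEN mp, THEN mp, THEN mp, OF V LT LQ Lc]
          by (elim exE conjE) (rule that)
        have "G \<notin> type_free_graphs n H (card N) (card T)"
        proof (rule blowup_not_type_free[OF H(1) _ G Q_def])
          show "pverts H = {1..Suc k}" using H(2) k(2) by simp
          show "N \<subseteq> tuples k {1..n}" "T \<subseteq> {1..n}" using N unfolding V_def by auto
          show "crossing Q k N" by (rule N(2))
          fix e v a assume e: "e \<in> N" "v \<in> T" "a < k"
          then have "e @ [v] \<in> L ` Yi" "length e = k" using N(1,6) by (auto simp: tuples_def)
          then show "Q a k (e ! a) v" using LQ[rule_format, of "e @ [v]" a k] e(3) by (simp add: nth_append)
        qed
        then show False using Gt N by simp
      qed
    qed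
  qed
  then show ?thesis using \<delta> by blast
qed

section \<open>Counting graphs with a sparse template\<close>

text \<open>A generating-function bound in place of binary entropy: as \<open>x \<le> 1\<close>,
  each set counted has \<open>x ^ b \<le> x ^ card D\<close>, and the sum of
  \<open>x ^ card D\<close> over all subsets is a binomial expansion.\<close>

lemma card_small_subsets:
  fixes x :: real
  assumes A: "finite A" and x: "0 < x" "x \<le> 1"
  shows "real (card {D. D \<subseteq> A \<and> card D \<le> b}) * x ^ b \<le> (1 + x) ^ card A"
proof -
  have "real (card {D. D \<subseteq> A \<and> card D \<le> b}) * x ^ b = (\<Sum>D\<in>{D. D \<subseteq> A \<and> card D \<le> b}. x ^ b)" by simp
  also have "\<dots> \<le> (\<Sum>D\<in>{D. D \<subseteq> A \<and> card D \<le> b}. x ^ card D)"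
    by (rule sum_mono) (use x in \<open>auto intro: power_decreasing\<close>)
  also have "\<dots> \<le> (\<Sum>D\<in>Pow A. x ^ card D)"
    by (rule sum_mono2) (use A x in auto)
  also have "\<dots> = (\<Sum>D\<in>Pow A. (\<Prod>a\<in>D. x) * (\<Prod>a\<in>A - D. 1))" by simp
  also have "\<dots> = (\<Prod>a\<in>A. x + 1)" by (rule prod_add[OF A, symmetric])
  also have "\<dots> = (1 + x) ^ card A" by (simp add: add.commute)
  finally show ?thesis .
qed

text \<open>\<open>S\<close> is determined by its free part together with the set of places where it
  violates the template.\<close>

lemma card_near_template:
  assumes A: "finite A" and ZO: "Z \<subseteq> A" "O' \<subseteq> A" "Z \<inter> O' = {}"
  shows "card {S. S \<subseteq> A \<and> card ((S \<inter> Z) \<union> (O' - S)) \<le> b}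
    \<le> 2 ^ card (A - Z - O') * card {D. D \<subseteq> A \<and> card D \<le> b}"
proof -
  let ?f = "\<lambda>S. (S - Z - O', (S \<inter> Z) \<union> (O' - S))"
  have inj: "inj_on ?f {S. S \<subseteq> A \<and> card ((S \<inter> Z) \<union> (O' - S)) \<le> b}"
  proof (rule inj_onI)
    fix S S' assume eq: "?f S = ?f S'"
    \<comment> \<open>The inverse map: a violation means presence on \<open>Z\<close> and absence on
      \<open>O'\<close>.\<close>
    define g where "g p = fst p \<union> (snd p \<inter> Z) \<union> (O' - snd p)" for p
    have rec: "g (?f T) = T" for T using ZO(3) by (auto simp: g_def)
    show "S = S'" using arg_cong[OF eq, of g] unfolding rec .
  qed
  have "card {S. S \<subseteq> A \<and> card ((S \<inter> Z) \<union> (O' - S)) \<le> b}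
    \<le> card (Pow (A - Z - O') \<times> {D. D \<subseteq> A \<and> card D \<le> b})"
  proof (rule card_inj_on_le[OF inj])
    show "?f ` {S. S \<subseteq> A \<and> card ((S \<inter> Z) \<union> (O' - S)) \<le> b} \<subseteq> Pow (A - Z - O') \<times> {D. D \<subseteq> A \<and> card D \<le> b}"
    proof (rule image_subsetI)
      fix S assume S: "S \<in> {S. S \<subseteq> A \<and> card ((S \<inter> Z) \<union> (O' - S)) \<le> b}"
      then have "S - Z - O' \<subseteq> A - Z - O'" "(S \<inter> Z) \<union> (O' - S) \<subseteq> A" using ZO(1,2) by auto
      then show "?f S \<in> Pow (A - Z - O') \<times> {D. D \<subseteq> A \<and> card D \<le> b}" using S by simp
    qed
    have "finite {D. D \<subseteq> A \<and> card D \<le> b}" by (rule finite_subset[of _ "Pow A"]) (use A in auto)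
    then show "finite (Pow (A - Z - O') \<times> {D. D \<subseteq> A \<and> card D \<le> b})" using A by simp
  qed
  also have "\<dots> = 2 ^ card (A - Z - O') * card {D. D \<subseteq> A \<and> card D \<le> b}"
    using A by (simp add: card_cartesian_product card_Pow)
  finally show ?thesis .
qed

lemma step_fun_cong: "c x = c x' \<Longrightarrow> c y = c y' \<Longrightarrow> step_fun V c f x y = step_fun V c f x' y'"
  unfolding step_fun_def by (rule fibre_avg_cong) simp

text \<open>Lets missing edges be treated as edges of the complement. For points of \<open>V\<close>
  the fibre is nonempty; over an empty fibre both averages would be 0.\<close>

lemma step_fun_one_minus:
  assumes V: "finite V" and xy: "x \<in> V" "y \<in> V"
  shows "step_fun V c (\<lambda>x y. 1 - f x y) x y = 1 - step_fun V c f x y"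
proof -
  let ?F = "{w' \<in> V \<times> V. map_prod c c w' = map_prod c c (x, y)}"
  have F: "finite ?F" "(x, y) \<in> ?F" using V xy by auto
  have "card ?F \<noteq> 0" unfolding card_0_eq[OF F(1)] using F(2) by blast
  then have nz: "real (card ?F) \<noteq> 0" by (simp only: of_nat_eq_0_iff not_False_eq_True)
  have "(\<Sum>w\<in>?F. case_prod (\<lambda>x y. 1 - f x y) w) = real (card ?F) - (\<Sum>w\<in>?F. case_prod f w)"
    by (simp add: split_def sum_subtractf)
  then show ?thesis using nz unfolding step_fun_def fibre_avg_def by (simp add: diff_divide_distrib)
qed

definition ordered_pairs :: "nat \<Rightarrow> (nat \<times> nat) set" where
  "ordered_pairs n = {(x, y). 1 \<le> x \<and> x < y \<and> y \<le> n}"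

lemma finite_ordered_pairs: "finite (ordered_pairs n)"
  by (rule finite_subset[of _ "{1..n} \<times> {1..n}"]) (auto simp: ordered_pairs_def)

lemma card_ordered_pairs: "card (ordered_pairs n) = n choose 2"
  unfolding ordered_pairs_def by (rule card_pairs_less)

definition sparse_template_graphs :: "nat \<Rightarrow> nat \<Rightarrow> real \<Rightarrow> real \<Rightarrow> nat pair_pre_digraph set" where
  "sparse_template_graphs n K \<gamma> s = {G. pair_graph G \<and> pverts G = {1..n} \<and>
     (\<exists>c. (\<forall>x. c x < K) \<and>
       real (card {(x, y) \<in> {1..n} \<times> {1..n}. \<gamma> \<le> step_fun {1..n} c (adj G) x y \<and> step_fun {1..n} c (adj G) x y \<le> 1 - \<gamma>}) \<le> s)}"

lemma inj_on_ordered_arcs: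
  "inj_on (\<lambda>G. ordered_pairs n \<inter> parcs G) {G. pair_graph G \<and> pverts G = {1..n}}"
proof (rule inj_onI)
  fix G G' :: "nat pair_pre_digraph"
  assume G: "G \<in> {G. pair_graph G \<and> pverts G = {1..n}}" and G': "G' \<in> {G. pair_graph G \<and> pverts G = {1..n}}"
    and eq: "ordered_pairs n \<inter> parcs G = ordered_pairs n \<inter> parcs G'"
  have rec: "(x, y) \<in> parcs F \<longleftrightarrow> (x, y) \<in> ordered_pairs n \<inter> parcs F \<or> (y, x) \<in> ordered_pairs n \<inter> parcs F"
    if "F \<in> {G. pair_graph G \<and> pverts G = {1..n}}" for F :: "nat pair_pre_digraph" and x y
  proof -
    interpret pair_graph F using that by simp
    have v: "pverts F = {1..n}" using that by simp
    show ?thesis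
    proof
      assume a: "(x, y) \<in> parcs F"
      then have "x \<noteq> y" "x \<in> {1..n}" "y \<in> {1..n}" "(y, x) \<in> parcs F"
        using no_loops' wellformed' arcs_symmetric v by blast+
      then show "(x, y) \<in> ordered_pairs n \<inter> parcs F \<or> (y, x) \<in> ordered_pairs n \<inter> parcs F"
        using a by (cases "x < y") (auto simp: ordered_pairs_def)
    next
      assume "(x, y) \<in> ordered_pairs n \<inter> parcs F \<or> (y, x) \<in> ordered_pairs n \<inter> parcs F"
      then show "(x, y) \<in> parcs F" using arcs_symmetric by blast
    qed
  qed
  have "(x, y) \<in> parcs G \<longleftrightarrow> (x, y) \<in> parcs G'" for x y
    using rec[OF G, of x y] rec[OF G', of x y] unfolding eq by blast
  then have "parcs G = parcs G'" by auto
  then show "G = G'" using G G' by (auto intro: pair_pre_digraph.equality)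
qed

lemma finite_sparse_template_graphs: "finite (sparse_template_graphs n K \<gamma> s)"
proof (rule finite_imageD)
  show "finite ((\<lambda>G. ordered_pairs n \<inter> parcs G) ` sparse_template_graphs n K \<gamma> s)"
    by (rule finite_subset[of _ "Pow (ordered_pairs n)"]) (auto simp: finite_ordered_pairs)
  show "inj_on (\<lambda>G. ordered_pairs n \<inter> parcs G) (sparse_template_graphs n K \<gamma> s)"
    by (rule inj_on_subset[OF inj_on_ordered_arcs]) (auto simp: sparse_template_graphs_def)
qed

text \<open>
  A template \<open>(c, Z, O')\<close> prescribes non-edges on the pairs whose classes lie in \<open>Z\<close>, edges on those
  with classes in \<open>O'\<close>, and leaves all other pairs free.
\<close>

definition class_pairs :: "nat \<Rightarrow> (nat \<Rightarrow> nat) \<Rightarrow> (nat \<times> nat) set \<Rightarrow> (nat \<times> nat) set" where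
  "class_pairs n c Z = {(x, y) \<in> ordered_pairs n. (c x, c y) \<in> Z}"

definition templates :: "nat \<Rightarrow> nat \<Rightarrow> real \<Rightarrow> ((nat \<Rightarrow> nat) \<times> (nat \<times> nat) set \<times> (nat \<times> nat) set) set" where
  "templates n K s = {(c, Z, O'). c \<in> {1..n} \<rightarrow>\<^sub>E {..<K} \<and> Z \<subseteq> {..<K} \<times> {..<K} \<and> O' \<subseteq> {..<K} \<times> {..<K} \<and>
     class_pairs n c Z \<inter> class_pairs n c O' = {} \<and>
     real (card (ordered_pairs n - class_pairs n c Z - class_pairs n c O')) \<le> s}"

definition near_template :: "nat \<Rightarrow> nat \<Rightarrow> (nat \<Rightarrow> nat) \<times> (nat \<times> nat) set \<times> (nat \<times> nat) set \<Rightarrow> (nat \<times> nat) set set" where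
  "near_template n b = (\<lambda>(c, Z, O'). {S. S \<subseteq> ordered_pairs n \<and>
     card ((S \<inter> class_pairs n c Z) \<union> (class_pairs n c O' - S)) \<le> b})"

lemma class_pairs_subset: "class_pairs n c Z \<subseteq> ordered_pairs n"
  by (auto simp: class_pairs_def)

text \<open>For fixed \<open>K\<close> the bound is only exponential in n, hence negligible on the
  scale of the theorem.\<close>

lemma templates_bounds:
  shows "finite (templates n K s)" "card (templates n K s) \<le> K ^ n * (2 ^ (K * K) * 2 ^ (K * K))"
proof -
  let ?B = "({1..n} \<rightarrow>\<^sub>E {..<K}) \<times> Pow ({..<K} \<times> {..<K}) \<times> Pow ({..<K} \<times> {..<K})"
  have sub: "templates n K s \<subseteq> ?B" by (auto simp: templates_def)
  have fin: "finite ?B" by (intro finite_cartesian_product finite_PiE) auto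
  show "finite (templates n K s)" using sub fin by (rule finite_subset)
  have "card ?B = K ^ n * (2 ^ (K * K) * 2 ^ (K * K))"
    by (simp add: card_cartesian_product card_PiE card_Pow)
  then show "card (templates n K s) \<le> K ^ n * (2 ^ (K * K) * 2 ^ (K * K))" using card_mono[OF fin sub] by simp
qed

text \<open>\<open>Z\<close> and \<open>O'\<close> collect the class pairs with density below
  \<open>\<gamma>\<close> and above \<open>1 - \<gamma>\<close>. Either kind of violation occurs on
  at most a fraction \<open>\<gamma>\<close> of all ordered pairs, which explains
  \<open>2 * \<gamma>\<close>.\<close>

lemma sparse_template_graphs_near:
  assumes G: "G \<in> sparse_template_graphs n K \<gamma> s" and \<gamma>: "0 < \<gamma>" "\<gamma> \<le> 1 / 2" and b: "2 * \<gamma> * real n ^ 2 < real b + 1"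
  shows "\<exists>t\<in>templates n K (s / 2). ordered_pairs n \<inter> parcs G \<in> near_template n b t"
proof -
  define V where "V = {1..n}"
  have V: "finite V" "card V = n" by (auto simp: V_def)
  have pg: "pair_graph G" using G by (simp add: sparse_template_graphs_def)
  interpret pair_graph G by (rule pg)
  obtain c where c: "\<forall>x. c x < K" and stars:
    "real (card {(x, y) \<in> V \<times> V. \<gamma> \<le> step_fun V c (adj G) x y \<and> step_fun V c (adj G) x y \<le> 1 - \<gamma>}) \<le> s"
    using G unfolding sparse_template_graphs_def V_def by blast
  define W where "W = step_fun V c (adj G)"
  have "(x, y) \<in> parcs G \<longleftrightarrow> (y, x) \<in> parcs G" for x y using arcs_symmetric by blast
  then have Wsym: "W x y = W y x" for x y unfolding W_def by (intro step_fun_sym) (simp add: adj_def)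
  have Wc: "W x y = W x' y'" if "c x = c x'" "c y = c y'" for x y x' y'
    unfolding W_def using that by (rule step_fun_cong)
  define c' where "c' = restrict c V"
  define Z where "Z = {(c x, c y) |x y. x \<in> V \<and> y \<in> V \<and> W x y < \<gamma>}"
  define O' where "O' = {(c x, c y) |x y. x \<in> V \<and> y \<in> V \<and> 1 - \<gamma> < W x y}"
  have opV: "x \<in> V \<and> y \<in> V" if "(x, y) \<in> ordered_pairs n" for x y
    using that by (auto simp: ordered_pairs_def V_def)
  \<comment> \<open>A condition on \<open>W x y\<close> depends on the classes of \<open>x\<close>
    and \<open>y\<close> only, so passing to class pairs and back loses nothing.\<close>
  have cls: "(x, y) \<in> class_pairs n c' {(c x, c y) |x y. x \<in> V \<and> y \<in> V \<and> p (W x y)}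
      \<longleftrightarrow> (x, y) \<in> ordered_pairs n \<and> p (W x y)" (is "_ \<in> class_pairs n c' ?P \<longleftrightarrow> _") for p x y
  proof (cases "(x, y) \<in> ordered_pairs n")
    case True
    then have xy: "x \<in> V" "y \<in> V" using opV by auto
    have "(c x, c y) \<in> ?P \<longleftrightarrow> p (W x y)"
    proof
      assume "(c x, c y) \<in> ?P"
      then obtain x' y' where "c x = c x'" "c y = c y'" "p (W x' y')" by blast
      then show "p (W x y)" using Wc[of x x' y y'] by simp
    qed (use xy in blast)
    then show ?thesis using True xy by (simp add: class_pairs_def c'_def)
  qed (simp add: class_pairs_def)
  have Z: "(x, y) \<in> class_pairs n c' Z \<longleftrightarrow> (x, y) \<in> ordered_pairs n \<and> W x y < \<gamma>" for x y
    unfolding Z_def by (rule cls)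
  have O: "(x, y) \<in> class_pairs n c' O' \<longleftrightarrow> (x, y) \<in> ordered_pairs n \<and> 1 - \<gamma> < W x y" for x y
    unfolding O'_def by (rule cls)
  define St where "St = ordered_pairs n - class_pairs n c' Z - class_pairs n c' O'"
  have St: "(x, y) \<in> St \<longleftrightarrow> (x, y) \<in> ordered_pairs n \<and> \<gamma> \<le> W x y \<and> W x y \<le> 1 - \<gamma>" for x y
    unfolding St_def using Z O by (auto simp: not_less)
  have finSt: "finite St" unfolding St_def using finite_ordered_pairs by simp
  \<comment> \<open>The bound \<open>s\<close> counts ordered pairs, so every free pair in
    increasing order occurs twice in it; hence \<open>s / 2\<close> for the template.\<close>
  have cardSt: "2 * real (card St) \<le> s"
  proof -
    let ?stars = "{(x, y) \<in> V \<times> V. \<gamma> \<le> W x y \<and> W x y \<le> 1 - \<gamma>}"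
    have "card (St \<union> prod.swap ` St) = card St + card (prod.swap ` St)"
      by (rule card_Un_disjoint) (use finSt in \<open>auto simp: St ordered_pairs_def\<close>)
    also have "\<dots> = 2 * card St" by (simp add: card_image)
    finally have "2 * card St = card (St \<union> prod.swap ` St)" by simp
    also have "\<dots> \<le> card ?stars"
    proof (rule card_mono)
      show "finite ?stars" by (rule finite_subset[of _ "V \<times> V"]) (use V in auto)
      show "St \<union> prod.swap ` St \<subseteq> ?stars" 
      proof
        fix w assume w: "w \<in> St \<union> prod.swap ` St"
        obtain x y where xy: "w = (x, y)" by (cases w)
        have "(x, y) \<in> St \<or> (y, x) \<in> St" using w unfolding xy by auto
        then show "w \<in> ?stars" using St[of x y] St[of y x] opV[of x y] opV[of y x] Wsym[of x y] unfolding xy by auto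
      qed
    qed
    finally have "real (2 * card St) \<le> real (card ?stars)" by (rule of_nat_mono)
    then show ?thesis using stars unfolding W_def by simp
  qed
  define S where "S = ordered_pairs n \<inter> parcs G"
  \<comment> \<open>Used twice: for edges on \<open>Z\<close> with \<open>adj G\<close>, and for
    missing edges on \<open>O'\<close> with its complement.\<close>
  have small: "real (card ({w \<in> V \<times> V. p w} \<inter> {w. g w = (1::real)})) \<le> \<gamma> * real n ^ 2"
    if p: "\<And>w w'. map_prod c c w = map_prod c c w' \<Longrightarrow> p w = p w'"
      and g: "\<And>w. g w \<ge> 0" and f: "g = case_prod f"
      and le: "\<And>w. w \<in> V \<times> V \<Longrightarrow> p w \<Longrightarrow> step_fun V c f (fst w) (snd w) \<le> \<gamma>" for p g f
  proof -
    have fin: "finite {w \<in> V \<times> V. p w}" using V by simp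
    have "real (card ({w \<in> V \<times> V. p w} \<inter> {w. g w = 1})) = (\<Sum>w\<in>{w \<in> V \<times> V. p w} \<inter> {w. g w = 1}. g w)"
      by simp
    also have "\<dots> \<le> (\<Sum>w\<in>{w \<in> V \<times> V. p w}. g w)" by (rule sum_mono2) (use fin g in auto)
    also have "\<dots> \<le> \<gamma> * real n ^ 2"
      unfolding f V(2)[symmetric] by (rule step_fun_sum_rect[OF V(1) le p]) (use \<gamma> in auto)
    finally show ?thesis .
  qed
  have Wp: "W (fst w) (snd w) = W (fst w') (snd w')" if "map_prod c c w = map_prod c c w'" for w w'
    using that by (intro Wc) (cases w, cases w', auto)+
  have e1: "real (card ({w \<in> V \<times> V. W (fst w) (snd w) < \<gamma>} \<inter> {w. case_prod (adj G) w = 1})) \<le> \<gamma> * real n ^ 2"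
  proof (rule small[OF _ _ refl])
    show "(W (fst w) (snd w) < \<gamma>) = (W (fst w') (snd w') < \<gamma>)"
      if "map_prod c c w = map_prod c c w'" for w w' using Wp[OF that] by simp
    show "0 \<le> (case w of (x, y) \<Rightarrow> adj G x y)" for w by (cases w) (simp add: adj_def)
    show "step_fun V c (adj G) (fst w) (snd w) \<le> \<gamma>" if "W (fst w) (snd w) < \<gamma>" for w
      using that unfolding W_def by simp
  qed
  have e2: "real (card ({w \<in> V \<times> V. 1 - \<gamma> < W (fst w) (snd w)} \<inter> {w. case_prod (\<lambda>x y. 1 - adj G x y) w = 1})) \<le> \<gamma> * real n ^ 2"
  proof (rule small[OF _ _ refl])
    show "(1 - \<gamma> < W (fst w) (snd w)) = (1 - \<gamma> < W (fst w') (snd w'))"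
      if "map_prod c c w = map_prod c c w'" for w w' using Wp[OF that] by simp
    show "0 \<le> (case w of (x, y) \<Rightarrow> 1 - adj G x y)" for w by (cases w) (simp add: adj_def)
    show "step_fun V c (\<lambda>x y. 1 - adj G x y) (fst w) (snd w) \<le> \<gamma>"
      if "w \<in> V \<times> V" "1 - \<gamma> < W (fst w) (snd w)" for w
      using step_fun_one_minus[OF V(1), of "fst w" "snd w" c "adj G"] that unfolding W_def by auto
  qed
  have "card ((S \<inter> class_pairs n c' Z) \<union> (class_pairs n c' O' - S))
      \<le> card (({w \<in> V \<times> V. W (fst w) (snd w) < \<gamma>} \<inter> {w. case_prod (adj G) w = 1}) \<union>
          ({w \<in> V \<times> V. 1 - \<gamma> < W (fst w) (snd w)} \<inter> {w. case_prod (\<lambda>x y. 1 - adj G x y) w = 1}))"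
  proof (rule card_mono)
    show "(S \<inter> class_pairs n c' Z) \<union> (class_pairs n c' O' - S)
      \<subseteq> ({w \<in> V \<times> V. W (fst w) (snd w) < \<gamma>} \<inter> {w. case_prod (adj G) w = 1}) \<union>
          ({w \<in> V \<times> V. 1 - \<gamma> < W (fst w) (snd w)} \<inter> {w. case_prod (\<lambda>x y. 1 - adj G x y) w = 1})"
    proof
      fix w assume w: "w \<in> (S \<inter> class_pairs n c' Z) \<union> (class_pairs n c' O' - S)"
      obtain x y where xy: "w = (x, y)" by (cases w)
      show "w \<in> ({w \<in> V \<times> V. W (fst w) (snd w) < \<gamma>} \<inter> {w. case_prod (adj G) w = 1}) \<union>
          ({w \<in> V \<times> V. 1 - \<gamma> < W (fst w) (snd w)} \<inter> {w. case_prod (\<lambda>x y. 1 - adj G x y) w = 1})"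
        using w Z[of x y] O[of x y] opV[of x y] unfolding xy S_def by (auto simp: adj_def)
    qed
  qed (use V in auto)
  also have "\<dots> \<le> card ({w \<in> V \<times> V. W (fst w) (snd w) < \<gamma>} \<inter> {w. case_prod (adj G) w = 1})
      + card ({w \<in> V \<times> V. 1 - \<gamma> < W (fst w) (snd w)} \<inter> {w. case_prod (\<lambda>x y. 1 - adj G x y) w = 1})"
    by (rule card_Un_le)
  finally have "real (card ((S \<inter> class_pairs n c' Z) \<union> (class_pairs n c' O' - S))) < real b + 1"
    using e1 e2 b by linarith
  then have "S \<in> near_template n b (c', Z, O')" unfolding near_template_def S_def by simp
  moreover have "(c', Z, O') \<in> templates n K (s / 2)"
    unfolding templates_def
  proof (intro CollectI case_prodI conjI)
    show "c' \<in> {1..n} \<rightarrow>\<^sub>E {..<K}" using c by (auto simp: c'_def V_def)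
    show "Z \<subseteq> {..<K} \<times> {..<K}" "O' \<subseteq> {..<K} \<times> {..<K}" using c by (auto simp: Z_def O'_def)
    show "class_pairs n c' Z \<inter> class_pairs n c' O' = {}"
    proof (rule equals0I)
      fix w assume w: "w \<in> class_pairs n c' Z \<inter> class_pairs n c' O'"
      obtain x y where "w = (x, y)" by (cases w)
      then show False using w Z[of x y] O[of x y] \<gamma> by simp
    qed
    show "real (card (ordered_pairs n - class_pairs n c' Z - class_pairs n c' O')) \<le> s / 2"
      using cardSt unfolding St_def by simp
  qed
  ultimately show ?thesis unfolding S_def by blast
qed

text \<open>The exponent adds up the choice of the classes, of the two sets of class pairs, of the
  free pairs, and of the violations. The parameter \<open>x\<close> of
  \<open>card_small_subsets\<close> is kept free, to be balanced against \<open>\<gamma>\<close>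
  later.\<close>

lemma card_sparse_template_graphs:
  assumes K: "1 \<le> K" and \<gamma>: "0 < \<gamma>" "\<gamma> \<le> 1 / 2" and x: "0 < x" "x \<le> 1"
  shows "real (card (sparse_template_graphs n K \<gamma> s))
    \<le> 2 powr (real n * log 2 (real K) + 2 * real K ^ 2 + s / 2 + real n ^ 2 * (log 2 (1 + x) + 2 * \<gamma> * log 2 (1 / x)))"
proof -
  define b where "b = nat \<lfloor>2 * \<gamma> * real n ^ 2\<rfloor>"
  have "0 \<le> 2 * \<gamma> * real n ^ 2" using \<gamma> by simp
  then have b: "2 * \<gamma> * real n ^ 2 < real b + 1" "real b \<le> 2 * \<gamma> * real n ^ 2" unfolding b_def by linarith+
  define B where "B = card {D. D \<subseteq> ordered_pairs n \<and> card D \<le> b}"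
  have "card (sparse_template_graphs n K \<gamma> s) = card ((\<lambda>G. ordered_pairs n \<inter> parcs G) ` sparse_template_graphs n K \<gamma> s)"
    by (rule card_image[symmetric], rule inj_on_subset[OF inj_on_ordered_arcs]) (auto simp: sparse_template_graphs_def)
  also have "\<dots> \<le> card (\<Union>t\<in>templates n K (s / 2). near_template n b t)"
  proof (rule card_mono)
    have "finite (near_template n b t)" for t
      by (rule finite_subset[of _ "Pow (ordered_pairs n)"])
        (auto simp: near_template_def finite_ordered_pairs split: prod.splits)
    then show "finite (\<Union>t\<in>templates n K (s / 2). near_template n b t)" using templates_bounds(1) by blast
    show "(\<lambda>G. ordered_pairs n \<inter> parcs G) ` sparse_template_graphs n K \<gamma> s \<subseteq> (\<Union>t\<in>templates n K (s / 2). near_template n b t)"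
      using sparse_template_graphs_near[OF _ \<gamma> b(1)] by blast
  qed
  also have "\<dots> \<le> (\<Sum>t\<in>templates n K (s / 2). card (near_template n b t))"
    by (rule card_UN_le[OF templates_bounds(1)])
  finally have "real (card (sparse_template_graphs n K \<gamma> s)) \<le> real (\<Sum>t\<in>templates n K (s / 2). card (near_template n b t))"
    by (rule of_nat_mono)
  also have "\<dots> = (\<Sum>t\<in>templates n K (s / 2). real (card (near_template n b t)))" by simp
  also have "\<dots> \<le> (\<Sum>t\<in>templates n K (s / 2). 2 powr (s / 2) * real B)"
  proof (rule sum_mono)
    fix t assume t: "t \<in> templates n K (s / 2)"
    obtain c Z O' where tt: "t = (c, Z, O')" by (cases t)
    let ?m = "card (ordered_pairs n - class_pairs n c Z - class_pairs n c O')"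
    have "card (near_template n b t) \<le> 2 ^ ?m * B"
      unfolding tt near_template_def prod.case B_def
      by (rule card_near_template[OF finite_ordered_pairs class_pairs_subset class_pairs_subset])
        (use t in \<open>simp add: tt templates_def\<close>)
    then have "real (card (near_template n b t)) \<le> real (2 ^ ?m * B)" by (rule of_nat_mono)
    also have "\<dots> = 2 powr real ?m * real B" by (simp add: powr_realpow)
    also have "\<dots> \<le> 2 powr (s / 2) * real B"
      using t by (intro mult_right_mono powr_mono) (auto simp: tt templates_def)
    finally show "real (card (near_template n b t)) \<le> 2 powr (s / 2) * real B" .
  qed
  also have "\<dots> = real (card (templates n K (s / 2))) * (2 powr (s / 2) * real B)" by simp
  also have "\<dots> \<le> 2 powr (real n * log 2 (real K) + 2 * real K ^ 2) * (2 powr (s / 2) *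
      2 powr (real n ^ 2 * (log 2 (1 + x) + 2 * \<gamma> * log 2 (1 / x))))"
  proof (intro mult_mono mult_left_mono)
    have "real (card (templates n K (s / 2))) \<le> real (K ^ n * (2 ^ (K * K) * 2 ^ (K * K)))"
      using templates_bounds(2) by (rule of_nat_mono)
    also have "\<dots> = real K ^ n * 2 ^ (2 * K ^ 2)"
      by (simp add: power2_eq_square mult_2 power_add)
    also have "\<dots> = 2 powr (real n * log 2 (real K)) * 2 powr real (2 * K ^ 2)"
    proof -
      have "real K ^ n = real K powr real n" using K by (simp add: powr_realpow)
      also have "\<dots> = (2 powr log 2 (real K)) powr real n" using K by simp
      also have "\<dots> = 2 powr (real n * log 2 (real K))" unfolding powr_powr by (simp add: mult.commute)
      finally have "real K ^ n = 2 powr (real n * log 2 (real K))" .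
      moreover have "(2::real) ^ (2 * K ^ 2) = 2 powr real (2 * K ^ 2)" by (rule powr_realpow[symmetric]) simp
      ultimately show ?thesis by simp
    qed
    also have "\<dots> = 2 powr (real n * log 2 (real K) + 2 * real K ^ 2)" by (simp add: powr_add)
    finally show "real (card (templates n K (s / 2))) \<le> 2 powr (real n * log 2 (real K) + 2 * real K ^ 2)" .
    \<comment> \<open>The factor of about 2 wasted here is affordable, because this term is later
      multiplied by a small multiple of \<open>\<epsilon>\<close>.\<close>
    have N: "real (n choose 2) \<le> real n ^ 2"
    proof -
      have "n choose 2 \<le> n ^ 2" using binomial_fact_pow[of n 2] by simp
      then show ?thesis by (simp flip: of_nat_power)
    qed
    have "real B \<le> (1 + x) ^ (n choose 2) / x ^ b"
      using card_small_subsets[OF finite_ordered_pairs x, of n b] x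
      by (simp add: B_def card_ordered_pairs field_simps)
    also have "\<dots> = (1 + x) powr real (n choose 2) * (1 / x) powr real b"
      using x by (simp add: powr_realpow power_one_over)
    also have "\<dots> \<le> (1 + x) powr (real n ^ 2) * (1 / x) powr (2 * \<gamma> * real n ^ 2)"
      using x N b by (intro mult_mono powr_mono) auto
    also have "\<dots> = 2 powr (log 2 (1 + x) * real n ^ 2) * 2 powr (log 2 (1 / x) * (2 * \<gamma> * real n ^ 2))"
    proof -
      have "(2 powr log 2 (1 + x)) = 1 + x" "(2 powr log 2 (1 / x)) = 1 / x" using x by simp_all
      then show ?thesis by (simp only: powr_powr[symmetric])
    qed
    also have "\<dots> = 2 powr (real n ^ 2 * (log 2 (1 + x) + 2 * \<gamma> * log 2 (1 / x)))"
      unfolding powr_add[symmetric] by (simp only: algebra_simps)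
    finally show "real B \<le> 2 powr (real n ^ 2 * (log 2 (1 + x) + 2 * \<gamma> * log 2 (1 / x)))" .
  qed auto
  also have "\<dots> = 2 powr (real n * log 2 (real K) + 2 * real K ^ 2 + s / 2 + real n ^ 2 * (log 2 (1 + x) + 2 * \<gamma> * log 2 (1 / x)))"
    by (simp add: powr_add)
  finally show ?thesis .
qed

text \<open>First \<open>x\<close> makes \<open>log 2 (1 + x)\<close> small; then
  \<open>\<gamma>\<close> is taken small against \<open>log 2 (1 / x)\<close>.\<close>

lemma entropy_parameters:
  fixes e :: real
  assumes e: "0 < e"
  shows "\<exists>x \<gamma>. 0 < x \<and> x \<le> 1 \<and> 0 < \<gamma> \<and> \<gamma> \<le> 1 / 2 \<and> log 2 (1 + x) + 2 * \<gamma> * log 2 (1 / x) \<le> e"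
proof -
  define x where "x = min 1 (2 powr (e / 2) - 1)"
  have "1 < 2 powr (e / 2)" using e by (intro gr_one_powr) auto
  then have x: "0 < x" "x \<le> 1" "1 + x \<le> 2 powr (e / 2)" by (auto simp: x_def)
  have "log 2 (1 + x) \<le> log 2 (2 powr (e / 2))" using x by (subst log_le_cancel_iff) auto
  then have 1: "log 2 (1 + x) \<le> e / 2" by simp
  have L: "0 \<le> log 2 (1 / x)" using x by (subst zero_le_log_cancel_iff) auto
  \<comment> \<open>The summand 1 keeps the denominator positive when \<open>x = 1\<close>.\<close>
  define \<gamma> where "\<gamma> = min (1 / 2) (e / (4 * (log 2 (1 / x) + 1)))"
  have \<gamma>: "\<gamma> \<le> 1 / 2" "\<gamma> \<le> e / (4 * (log 2 (1 / x) + 1))"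
    unfolding \<gamma>_def by (rule min.cobounded1, rule min.cobounded2)
  have \<gamma>0: "0 < \<gamma>" using e L unfolding \<gamma>_def by simp
  have "2 * \<gamma> * log 2 (1 / x) \<le> 2 * (e / (4 * (log 2 (1 / x) + 1))) * (log 2 (1 / x) + 1)"
    using \<gamma>(2) \<gamma>0 L e by (intro mult_mono) auto
  also have "\<dots> = e / 2" using L by (simp add: field_simps)
  finally show ?thesis using 1 x \<gamma>(1) \<gamma>0 by (intro exI[of _ x] exI[of _ \<gamma>]) auto
qed

theorem theorem3:
  fixes H :: "nat pair_pre_digraph" and h r :: nat and \<epsilon> :: real
  assumes "pair_graph H" and "pverts H = {1..h}" and "2 \<le> h"
    and "r = coloring_number (induced_free H)"
    and "\<epsilon> > 0"
  shows "\<exists>\<delta>::real. \<delta> > 0 \<and>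
    (\<forall>\<^sub>F n in sequentially.
      (1 - 1 / real r) * real (n choose 2)
        \<le> log 2 (real (card (type_free_graphs n H
              (nat \<lfloor>\<delta> * ln (real n)\<rfloor>) (nat \<lceil>real n powr (1 - sqrt \<delta>)\<rceil>)))) \<and>
      log 2 (real (card (type_free_graphs n H
              (nat \<lfloor>\<delta> * ln (real n)\<rfloor>) (nat \<lceil>real n powr (1 - sqrt \<delta>)\<rceil>))))
        \<le> (1 - 1 / real r + \<epsilon>) * real (n choose 2))"
proof -
  note H = assms(1-3) and \<epsilon> = assms(5)
  have r: "1 \<le> r" and lowc: "\<exists>s\<le>r. clique_indep_class r s \<subseteq> induced_free H"
    and up: "\<And>s. s \<le> Suc r \<Longrightarrow> \<not> clique_indep_class (Suc r) s \<subseteq> induced_free H"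
    using coloring_number_induced_free[OF H] unfolding assms(4) by blast+
  obtain s where s: "s \<le> r" "clique_indep_class r s \<subseteq> induced_free H" using lowc by blast
  have "0 < \<epsilon> / 8" using \<epsilon> by simp
  from entropy_parameters[OF this] obtain x \<gamma> where x: "0 < x" "x \<le> 1" and \<gamma>: "0 < \<gamma>" "\<gamma> \<le> 1 / 2"
    and ent: "log 2 (1 + x) + 2 * \<gamma> * log 2 (1 / x) \<le> \<epsilon> / 8" by blast
  define a where "a = 1 - 1 / real r"
  have "1 / real r \<le> 1" using r by simp
  then have a: "0 \<le> a" unfolding a_def by simp
  have "0 < \<epsilon> / 4" using \<epsilon> by simp
  from type_free_sparse_template[OF H r up \<gamma> this] obtain K :: nat and \<delta> where \<delta>: "0 < \<delta>"
    and ev: "\<forall>\<^sub>F n in sequentially.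
     \<forall>G\<in>type_free_graphs n H (nat \<lfloor>\<delta> * ln (real n)\<rfloor>) (nat \<lceil>real n powr (1 - sqrt \<delta>)\<rceil>).
       \<exists>c. (\<forall>x. c x < K) \<and>
         real (card {(x, y) \<in> {1..n} \<times> {1..n}. \<gamma> \<le> step_fun {1..n} c (adj G) x y \<and> step_fun {1..n} c (adj G) x y \<le> 1 - \<gamma>})
           \<le> (1 - 1 / real r + \<epsilon> / 4) * real n ^ 2" by blast
  define L where "L = log 2 (real K)"
  \<comment> \<open>Ensures \<open>p \<ge> 1\<close>, as the lower bound picks a vertex from every
    part.\<close>
  have e1: "\<forall>\<^sub>F n in sequentially. 1 \<le> \<delta> * ln (real n)" using \<delta> by real_asymp
  \<comment> \<open>Of the available \<open>\<epsilon> * n ^ 2 / 2\<close>, the surplus of free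
    pairs and the violations take one eighth of \<open>\<epsilon> * n ^ 2\<close> each; the
    remaining quarter absorbs all terms that are at most linear in n.\<close>
  have e2: "\<forall>\<^sub>F n in sequentially. real n * L + 2 * real K ^ 2 + (a + \<epsilon> / 4) * real n ^ 2 / 2 + real n ^ 2 * (\<epsilon> / 8)
      \<le> (a + \<epsilon>) * (real n * (real n - 1) / 2)"
  proof -
    have "\<forall>\<^sub>F n in sequentially. real n * L + 2 * real K ^ 2 + (a + \<epsilon>) * real n / 2 \<le> \<epsilon> / 4 * real n ^ 2"
      using \<epsilon> by real_asymp
    then show ?thesis by eventually_elim (simp add: field_simps power2_eq_square)
  qed
  have "\<forall>\<^sub>F n in sequentially.
      (1 - 1 / real r) * real (n choose 2)
        \<le> log 2 (real (card (type_free_graphs n H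
              (nat \<lfloor>\<delta> * ln (real n)\<rfloor>) (nat \<lceil>real n powr (1 - sqrt \<delta>)\<rceil>)))) \<and>
      log 2 (real (card (type_free_graphs n H
              (nat \<lfloor>\<delta> * ln (real n)\<rfloor>) (nat \<lceil>real n powr (1 - sqrt \<delta>)\<rceil>))))
        \<le> (1 - 1 / real r + \<epsilon>) * real (n choose 2)"
    using ev e1 e2 eventually_ge_at_top[of 1]
  proof eventually_elim
    case (elim n)
    define p where "p = nat \<lfloor>\<delta> * ln (real n)\<rfloor>"
    define q where "q = nat \<lceil>real n powr (1 - sqrt \<delta>)\<rceil>"
    define P where "P = type_free_graphs n H p q"
    have p: "1 \<le> p" using elim(2) unfolding p_def by linarith
    have "0 < real n powr (1 - sqrt \<delta>)" using elim(4) by simp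
    then have q: "1 \<le> q" unfolding q_def by linarith
    have low: "(1 - 1 / real r) * real (n choose 2) \<le> log 2 (real (card P))"
      unfolding P_def by (rule type_free_graphs_lower[OF H(1) r s p q])
    have choose: "real (n choose 2) = real n * (real n - 1) / 2"
    proof -
      have "n choose 2 = n * (n - 1) div 2" by (rule choose_two)
      moreover have "even (n * (n - 1))" by (cases "even n") auto
      ultimately have "real (n choose 2) = real (n * (n - 1)) / 2" by (simp only: real_of_nat_div of_nat_numeral)
      then show ?thesis using elim(4) by (simp add: of_nat_diff)
    qed
    have "log 2 (real (card P)) \<le> (a + \<epsilon>) * real (n choose 2)"
    proof (cases "P = {}")
      case True
      \<comment> \<open>\<open>log 2 0\<close> is 0, so it is enough that the right-hand side is
        nonnegative.\<close>
      then show ?thesis using a \<epsilon> by (simp add: log_def)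
    next
      case False
      have sub: "P \<subseteq> sparse_template_graphs n K \<gamma> ((1 - 1 / real r + \<epsilon> / 4) * real n ^ 2)"
      proof
        fix G assume G: "G \<in> P"
        then have "pair_graph G" "pverts G = {1..n}" by (simp_all add: P_def type_free_graphs_def)
        moreover note bspec[OF elim(1), OF G[unfolded P_def p_def q_def]]
        ultimately show "G \<in> sparse_template_graphs n K \<gamma> ((1 - 1 / real r + \<epsilon> / 4) * real n ^ 2)"
          by (simp add: sparse_template_graphs_def)
      qed
      obtain G where "G \<in> P" using False by blast
      then have "G \<in> sparse_template_graphs n K \<gamma> ((1 - 1 / real r + \<epsilon> / 4) * real n ^ 2)" using sub by blast
      then obtain c :: "nat \<Rightarrow> nat" where "\<forall>x. c x < K" unfolding sparse_template_graphs_def by blast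
      \<comment> \<open>Positivity of \<open>K\<close> is read off the colouring of an arbitrary
        member of \<open>P\<close>.\<close>
      then have "c 0 < K" by blast
      then have K: "1 \<le> K" by simp
      have "finite P" unfolding P_def by (rule finite_type_free_graphs)
      then have pos: "0 < real (card P)" using False by (simp add: card_gt_0_iff)
      have "real (card P) \<le> real (card (sparse_template_graphs n K \<gamma> ((1 - 1 / real r + \<epsilon> / 4) * real n ^ 2)))"
        by (rule of_nat_mono, rule card_mono[OF finite_sparse_template_graphs sub])
      also have "\<dots> \<le> 2 powr (real n * log 2 (real K) + 2 * real K ^ 2 + (1 - 1 / real r + \<epsilon> / 4) * real n ^ 2 / 2
          + real n ^ 2 * (log 2 (1 + x) + 2 * \<gamma> * log 2 (1 / x)))"
        by (rule card_sparse_template_graphs[OF K \<gamma> x])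
      finally have "log 2 (real (card P)) \<le> real n * log 2 (real K) + 2 * real K ^ 2 + (1 - 1 / real r + \<epsilon> / 4) * real n ^ 2 / 2
          + real n ^ 2 * (log 2 (1 + x) + 2 * \<gamma> * log 2 (1 / x))"
        using pos by (simp add: log_le_iff)
      also have "\<dots> \<le> real n * L + 2 * real K ^ 2 + (a + \<epsilon> / 4) * real n ^ 2 / 2 + real n ^ 2 * (\<epsilon> / 8)"
        using mult_left_mono[OF ent, of "real n ^ 2"] unfolding L_def a_def by simp
      also have "\<dots> \<le> (a + \<epsilon>) * real (n choose 2)" unfolding choose by (rule elim(3))
      finally show ?thesis .
    qed
    then show ?case using low unfolding P_def p_def q_def a_def by blast
  qed
  then show ?thesis using \<delta> by blast
qed

end
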